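(* Fix integers $k,q\ge1$ and constants $d\ge1$, $A>0$, $\xi>0$, $C>0$ and an inverse temperature $\beta>0$. For each $n$, let $\mathsf d$ be a distance on $[n]$ with $|B_{\mathsf d}(v,r)|\le A\,r^d$ for any $v\in[n]$ and any $r>0$, let $H$ be a self-adjoint operator on $(\mathbb C^q)^{\otimes n}$ (the Hamiltonian), and let the Gibbs state $\omega=e^{-\beta H}/\mathrm{Tr}\,e^{-\beta H}$ have correlation length $\xi$ (with constant $C$) with respect to $\mathsf d$. Let $\omega_{E^*,\Delta}$ be the microcanonical state of width $\Delta=\Delta(n)>0$ with energy $$E^*=\operatorname{argmax}_E\, e^{-\beta E}\,\mathrm{Tr}\,P(E,\Delta).$$ Then $$\frac1n\big\|\omega_{E^*,\Delta}-\omega\big\|_{k\text{-}W_1\mathrm{loc}}=o(1)\qquad\text{as } n\to\infty,$$ whenever $\Delta=\exp\big(-o\big(n^{\frac1{2d+1}}\big)\big)$ and $\Delta=o\big(n^{\frac1{2d+1}}\big)$.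
   Context: $[n]=\{1,\dots,n\}$ labels $n$ spins, each with Hilbert space $\mathbb C^q$. For $\Lambda\subseteq[n]$, $\mathcal O_\Lambda$ is the set of self-adjoint operators on $\bigotimes_{x\in\Lambda}\mathbb C^q$ ($\mathcal O_\emptyset$ = real scalars); an element of $\mathcal O_\Lambda$ is identified with its tensor product with the identity on the other spins. $P(E,\Delta)$ is the orthogonal projector onto the subspace spanned by the eigenvectors of $H$ with eigenvalues in $(E-\Delta,E]$, and the microcanonical state with energy $E$ and width $\Delta$ is $\omega_{E,\Delta}=P(E,\Delta)/\mathrm{Tr}\,P(E,\Delta)$. A self-adjoint operator $G$ on $(\mathbb C^q)^{\otimes n}$ is $k$-local if it can be written as $G=\sum_{\Lambda\subseteq[n],|\Lambda|\le k}g_\Lambda$ with $g_\Lambda\in\mathcal O_\Lambda$; $\mathcal O^{(k)}_{[n]}$ is the set of these. The local norm of $G\in\mathcal O_{[n]}$ is, with $\|\cdot\|$ the operator norm, $$\|G\|_{\mathrm{loc}}=2\min\Big\{\max_{x\in[n]}\sum_{\Lambda\ni x}\|g_\Lambda\| : G=\sum_{\Lambda\subseteq[n]}g_\Lambda,\ g_\Lambda\in\mathcal O_\Lambda\Big\},$$ where the minimum is over all decompositions of $G$, with no restriction on $|\Lambda|$. The $k$-local quantum $W_1$ distance between states (positive semidefinite operators of trace one) is $$\|\rho-\sigma\|_{k\text{-}W_1\mathrm{loc}}=\max\{\mathrm{Tr}[(\rho-\sigma)G]: G\in\mathcal O^{(k)}_{[n]},\ \|G\|_{\mathrm{loc}}\le1\}.$$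 $B_{\mathsf d}(v,r)$ is the ball of $\mathsf d$ in $[n]$ with center $v$ and radius $r$. A state $\omega$ has correlation length $\xi$ with constant $C$ (independent of $n$) with respect to $\mathsf d$ if for any two disjoint regions $\Lambda_1,\Lambda_2\subset[n]$ and any $h_{\Lambda_1}\in\mathcal O_{\Lambda_1}$, $h_{\Lambda_2}\in\mathcal O_{\Lambda_2}$, writing $\langle X\rangle=\mathrm{Tr}(\omega X)$, $$|\langle h_{\Lambda_1}h_{\Lambda_2}\rangle-\langle h_{\Lambda_1}\rangle\langle h_{\Lambda_2}\rangle|\le C\|h_{\Lambda_1}\|\|h_{\Lambda_2}\|e^{-\mathsf d(\Lambda_1,\Lambda_2)/\xi},\qquad \mathsf d(\Lambda_1,\Lambda_2)=\min_{x_i\in\Lambda_i}\mathsf d(x_1,x_2).$$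
   Formalization: The bound |B(v,r)| ≤ A r^d is required only for r ≥ 1, not for every r > 0: since the ball always contains its center v, the bound fails for small r, so no distance could satisfy it as written. *)

theory Defs
  imports
    "HOL-Analysis.Abstract_Metric_Spaces"
    "HOL-Library.Landau_Symbols"
    "Jordan_Normal_Form.Schur_Decomposition"
begin

subsection \<open>Operators as complex matrices\<close>

definition self_adjoint :: "nat \<Rightarrow> complex mat set" where
  "self_adjoint N = {A \<in> carrier_mat N N. mat_adjoint A = A}"

definition tr :: "complex mat \<Rightarrow> complex" where
  "tr A = (\<Sum>i<dim_row A. A $$ (i, i))"

definition vnorm :: "complex vec \<Rightarrow> real" where
  "vnorm v = sqrt (Re (v \<bullet>c v))"

definition op_norm :: "complex mat \<Rightarrow> real" where
  "op_norm A = Sup {vnorm (A *\<^sub>v v) | v. v \<in> carrier_vec (dim_col A) \<and> vnorm v = 1}"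

definition mat_exp :: "complex mat \<Rightarrow> complex mat" where
  "mat_exp A = mat (dim_row A) (dim_col A) (\<lambda>(i, j). \<Sum>m. (A ^\<^sub>m m) $$ (i, j) / fact m)"

definition orth_projector :: "nat \<Rightarrow> complex vec set \<Rightarrow> complex mat" where
  "orth_projector N W =
     (THE P. P \<in> self_adjoint N \<and> P * P = P \<and> {P *\<^sub>v v | v. v \<in> carrier_vec N} = W)"

subsection \<open>Spin systems\<close>

text \<open>
  The basis of the \<open>n\<close>-spin space is indexed by \<open>i < q ^ n\<close>: the basis vector with index \<open>i\<close> is the
  tensor product over \<open>x \<in> {1..n}\<close> of the basis vectors of \<open>\<complex>\<^sup>q\<close> with index \<open>spin q x i\<close>, the
  \<open>x\<close>-th base-\<open>q\<close> digit of \<open>i\<close> (spin 1 being the least significant one). In the same way the spins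
  in \<open>\<Lambda>\<close>, in increasing order, index the basis of the space attached to \<open>\<Lambda>\<close>, and \<open>sub_index q \<Lambda> i\<close>
  is the index of the restriction to \<open>\<Lambda>\<close> of the configuration \<open>i\<close>.
\<close>

definition spin :: "nat \<Rightarrow> nat \<Rightarrow> nat \<Rightarrow> nat" where
  "spin q x i = i div q ^ (x - 1) mod q"

definition sub_index :: "nat \<Rightarrow> nat set \<Rightarrow> nat \<Rightarrow> nat" where
  "sub_index q \<Lambda> i = (\<Sum>x\<in>\<Lambda>. spin q x i * q ^ card {y \<in> \<Lambda>. y < x})"

text \<open>The tensor product of an operator \<open>g\<close> on the spins in \<open>\<Lambda>\<close> with the identity on the others.\<close>

definition tensor_id :: "nat \<Rightarrow> nat \<Rightarrow> nat set \<Rightarrow> complex mat \<Rightarrow> complex mat" where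
  "tensor_id q n \<Lambda> g = mat (q ^ n) (q ^ n) (\<lambda>(i, j).
     if \<forall>x \<in> {1..n} - \<Lambda>. spin q x i = spin q x j
     then g $$ (sub_index q \<Lambda> i, sub_index q \<Lambda> j) else 0)"

text \<open>\<open>\<O>\<^sub>\<Lambda>\<close>, after the identification with operators on all \<open>n\<close> spins.\<close>

definition observables :: "nat \<Rightarrow> nat \<Rightarrow> nat set \<Rightarrow> complex mat set" where
  "observables q n \<Lambda> = tensor_id q n \<Lambda> ` self_adjoint (q ^ card \<Lambda>)"

definition decomposes :: "nat \<Rightarrow> nat \<Rightarrow> nat set set \<Rightarrow> (nat set \<Rightarrow> complex mat) \<Rightarrow> complex mat \<Rightarrow> bool" where
  "decomposes q n S g G \<longleftrightarrow>
     (\<forall>\<Lambda>\<in>S. g \<Lambda> \<in> observables q n \<Lambda>) \<and>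
     G = mat (q ^ n) (q ^ n) (\<lambda>(i, j). \<Sum>\<Lambda>\<in>S. g \<Lambda> $$ (i, j))"

definition k_local :: "nat \<Rightarrow> nat \<Rightarrow> nat \<Rightarrow> complex mat set" where
  "k_local q n k =
     {G \<in> self_adjoint (q ^ n). \<exists>g. decomposes q n {\<Lambda>. \<Lambda> \<subseteq> {1..n} \<and> card \<Lambda> \<le> k} g G}"

text \<open>
  For \<open>n \<ge> 1\<close> the infimum below is attained, and so is the supremum in the definition of the
  \<open>W\<^sub>1\<close> distance between states (finite dimension; multiples of the identity change neither value),
  so these are the minimum and the maximum.
\<close>

definition local_norm :: "nat \<Rightarrow> nat \<Rightarrow> complex mat \<Rightarrow> real" where
  "local_norm q n G = 2 * Inf
     {Max ((\<lambda>x. \<Sum>\<Lambda> | \<Lambda> \<subseteq> {1..n} \<and> x \<in> \<Lambda>. op_norm (g \<Lambda>)) ` {1..n}) | g.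
        decomposes q n {\<Lambda>. \<Lambda> \<subseteq> {1..n}} g G}"

definition W1_loc_dist :: "nat \<Rightarrow> nat \<Rightarrow> nat \<Rightarrow> complex mat \<Rightarrow> complex mat \<Rightarrow> real" where
  "W1_loc_dist q n k \<rho> \<sigma> =
     Sup {Re (tr ((\<rho> - \<sigma>) * G)) | G. G \<in> k_local q n k \<and> local_norm q n G \<le> 1}"

subsection \<open>Gibbs and microcanonical states\<close>

definition gibbs_state :: "complex mat \<Rightarrow> real \<Rightarrow> complex mat" where
  "gibbs_state H \<beta> =
     (1 / tr (mat_exp (complex_of_real (- \<beta>) \<cdot>\<^sub>m H))) \<cdot>\<^sub>m mat_exp (complex_of_real (- \<beta>) \<cdot>\<^sub>m H)"

definition energy_projector :: "complex mat \<Rightarrow> real \<Rightarrow> real \<Rightarrow> complex mat" where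
  "energy_projector H E \<Delta> = orth_projector (dim_row H)
     (LinearCombinations.module.span class_ring (module_vec TYPE(complex) (dim_row H))
        {v. \<exists>e\<in>{E - \<Delta><..E}. eigenvector H v (complex_of_real e)})"

definition microcanonical_state :: "complex mat \<Rightarrow> real \<Rightarrow> real \<Rightarrow> complex mat" where
  "microcanonical_state H E \<Delta> =
     (1 / tr (energy_projector H E \<Delta>)) \<cdot>\<^sub>m energy_projector H E \<Delta>"

subsection \<open>Geometry and correlations\<close>

text \<open>
  The growth bound is required for radii \<open>r \<ge> 1\<close> only: since \<open>v\<close> lies in the ball, no distance
  satisfies it for all real \<open>r > 0\<close>.
\<close>

definition polynomial_growth :: "nat \<Rightarrow> (nat \<Rightarrow> nat \<Rightarrow> real) \<Rightarrow> real \<Rightarrow> real \<Rightarrow> bool" where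
  "polynomial_growth n D A d \<longleftrightarrow>
     (\<forall>v\<in>{1..n}. \<forall>r\<ge>1. real (card (Metric_space.mcball {1..n} D v r)) \<le> A * r powr d)"

text \<open>
  Regions are taken nonempty, so that their distance is a minimum over a nonempty set. For an empty
  region the observable is a scalar and the correlation vanishes.
\<close>

definition region_dist :: "(nat \<Rightarrow> nat \<Rightarrow> real) \<Rightarrow> nat set \<Rightarrow> nat set \<Rightarrow> real" where
  "region_dist D \<Lambda>1 \<Lambda>2 = Min {D x y | x y. x \<in> \<Lambda>1 \<and> y \<in> \<Lambda>2}"

definition has_correlation_length ::
  "nat \<Rightarrow> nat \<Rightarrow> (nat \<Rightarrow> nat \<Rightarrow> real) \<Rightarrow> complex mat \<Rightarrow> real \<Rightarrow> real \<Rightarrow> bool" where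
  "has_correlation_length q n D \<omega> \<xi> C \<longleftrightarrow>
     (\<forall>\<Lambda>1 \<Lambda>2. \<Lambda>1 \<subseteq> {1..n} \<and> \<Lambda>2 \<subseteq> {1..n} \<and> \<Lambda>1 \<noteq> {} \<and> \<Lambda>2 \<noteq> {} \<and> \<Lambda>1 \<inter> \<Lambda>2 = {} \<longrightarrow>
       (\<forall>h1 \<in> observables q n \<Lambda>1. \<forall>h2 \<in> observables q n \<Lambda>2.
          cmod (tr (\<omega> * (h1 * h2)) - tr (\<omega> * h1) * tr (\<omega> * h2))
            \<le> C * op_norm h1 * op_norm h2 * exp (- region_dist D \<Lambda>1 \<Lambda>2 / \<xi>)))"

end

theory Submission
  imports Defs "HOL-Analysis.L2_Norm" "HOL-Library.FuncSet" "HOL-Real_Asymp.Real_Asymp"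
    "Jordan_Normal_Form.Char_Poly"
begin

text \<open>
  Two facts are combined. First, the microcanonical state is dominated by the Gibbs state: it is at
  most \<open>M \<omega>\<close>, where \<open>M\<close> is the ratio of the partition function to \<open>e\<^sup>-\<^sup>\<beta>\<^sup>E Tr P(E, \<Delta>)\<close> at the optimal
  energy. The eigenvalues above \<open>min H + ln (2 q\<^sup>n) / \<beta>\<close> carry at most half of the partition
  function, and the others are covered by \<open>O(n / \<Delta>)\<close> windows of width \<open>\<Delta>\<close>, so that
  \<open>ln M = o(n\<^sup>1\<^sup>/\<^sup>(\<^sup>2\<^sup>d\<^sup>+\<^sup>1\<^sup>))\<close>. Second, for a centred sum \<open>X\<close> of observables
  on at most \<open>L\<close> spins, clustering bounds the moments \<open>Tr \<omega> X\<^sup>m\<close>: in the expansion of \<open>X\<^sup>m\<close> every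
  product with a factor at distance more than \<open>r\<close> from all the others is exponentially small, and in
  the remaining products the factors are attached to a dominating set of at most \<open>m / 2\<close> of them.

  If \<open>m \<ge> ln M\<close> is a power of two, iterating \<open>(Tr \<rho> Y)\<^sup>2 \<le> Tr \<rho> Y\<^sup>2\<close> transfers the moment bound to the
  microcanonical state \<open>\<rho>\<close>, and with \<open>r\<close> proportional to \<open>m\<close> the bound is
  \<open>O(m\<^sup>1\<^sup>+\<^sup>d\<^sup>/\<^sup>2 n\<^sup>1\<^sup>/\<^sup>2) = o(n)\<close> because \<open>d + 2 \<le> 2 d + 1\<close>. The terms on more than \<open>L\<close> spins in an arbitrary
  decomposition of local norm at most one have total norm \<open>O(n / L)\<close>.
\<close>

subsection \<open>Adjoints\<close>

text \<open>Domination alone controls expectations only up to the factor M, which may grow with n.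
  But M^(1/m) \<le> e once m \<ge> ln M, so an m-th moment pays a bounded factor for the change of
  state. This bounds m from below. Clustering bounds it from above: products with an isolated factor
  must beat (2e/\<epsilon>)^m, which takes a radius proportional to m; balls then hold O(m^d) spins,
  and the other products contribute about (m^2 m^d n)^(m/2), which is below (\<epsilon> n)^m only if
  m^(d+2) is small against n. Both states are functions of \<open>H\<close>, hence diagonal in one
  eigenbasis, and domination becomes an inequality between eigenvalue weights, whether or not the
  observable commutes with them. The change of state is made on an even moment, where the
  expectation is a weighted average of squared norms. The cutoff L answers the local norm: a
  decomposition that nearly attains it may use sets of every size, even for a k-local operator,
  while the weight of the terms close to a given set is controlled only through the size of that
  set. L depends on the accuracy alone, so it does not change the powers of n.\<close>

lemma mat_adjoint_carrier [simp]: "A \<in> carrier_mat m n \<Longrightarrow> mat_adjoint A \<in> carrier_mat n m"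
  unfolding mat_adjoint_def by (auto simp: mat_of_rows_def)

lemma mat_adjoint_index [simp]:
  "i < dim_col A \<Longrightarrow> j < dim_row A \<Longrightarrow> mat_adjoint A $$ (i, j) = conjugate (A $$ (j, i))"
  unfolding mat_adjoint_def by (simp add: mat_of_rows_def)

lemma mat_adjoint_dim [simp]:
  "dim_row (mat_adjoint A) = dim_col A" "dim_col (mat_adjoint A) = dim_row A"
  unfolding mat_adjoint_def by (auto simp: mat_of_rows_def)

lemma self_adjoint_iff:
  "A \<in> self_adjoint N \<longleftrightarrow>
     A \<in> carrier_mat N N \<and> (\<forall>i<N. \<forall>j<N. A $$ (i, j) = cnj (A $$ (j, i)))"
proof
  assume a: "A \<in> self_adjoint N"
  show "A \<in> carrier_mat N N \<and> (\<forall>i<N. \<forall>j<N. A $$ (i, j) = cnj (A $$ (j, i)))"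
  proof (intro conjI allI impI)
    show "A \<in> carrier_mat N N" using a by (simp add: self_adjoint_def)
    fix i j assume "i < N" "j < N"
    moreover have "dim_row A = N" "dim_col A = N" using a by (auto simp: self_adjoint_def)
    ultimately have "mat_adjoint A $$ (i, j) = cnj (A $$ (j, i))" by simp
    moreover have "mat_adjoint A = A" using a by (simp add: self_adjoint_def)
    ultimately show "A $$ (i, j) = cnj (A $$ (j, i))" by simp
  qed
next
  assume a: "A \<in> carrier_mat N N \<and> (\<forall>i<N. \<forall>j<N. A $$ (i, j) = cnj (A $$ (j, i)))"
  have "mat_adjoint A = A"
  proof (rule eq_matI)
    fix i j assume "i < dim_row A" "j < dim_col A"
    then show "mat_adjoint A $$ (i, j) = A $$ (i, j)"
      using a by (metis carrier_matD conjugate_complex_def mat_adjoint_index)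
  qed (use a in auto)
  then show "A \<in> self_adjoint N" using a by (simp add: self_adjoint_def)
qed

text \<open>Entries as sums over \<open>{..<m}\<close> instead of scalar products of rows and
  columns: the form on which \<open>sum.swap\<close> and reindexing act from here on.\<close>

lemma index_mult_sum:
  assumes "A \<in> carrier_mat l m" "B \<in> carrier_mat m n" "i < l" "j < n"
  shows "(A * B) $$ (i, j) = (\<Sum>k<m. A $$ (i, k) * B $$ (k, j))"
  using assms by (auto simp: scalar_prod_def lessThan_atLeast0)

lemma index_mult_vec_sum:
  assumes "A \<in> carrier_mat l m" "v \<in> carrier_vec m" "i < l"
  shows "(A *\<^sub>v v) $ i = (\<Sum>k<m. A $$ (i, k) * v $ k)"
  using assms by (auto simp: scalar_prod_def lessThan_atLeast0)

lemma cscalar_prod_sum: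
  fixes v w :: "complex vec"
  assumes "w \<in> carrier_vec n"
  shows "v \<bullet>c w = (\<Sum>i<n. v $ i * cnj (w $ i))"
  using assms by (auto simp: scalar_prod_def lessThan_atLeast0)

lemma adjoint_mult:
  fixes A B :: "complex mat"
  assumes "A \<in> carrier_mat l m" "B \<in> carrier_mat m n"
  shows "mat_adjoint (A * B) = mat_adjoint B * mat_adjoint A"
proof (rule eq_matI)
  fix i j assume "i < dim_row (mat_adjoint B * mat_adjoint A)" "j < dim_col (mat_adjoint B * mat_adjoint A)"
  then have ij: "i < n" "j < l" using assms by auto
  have "mat_adjoint (A * B) $$ (i, j) = cnj ((A * B) $$ (j, i))"
    using assms ij by simp
  also have "\<dots> = (\<Sum>k<m. cnj (A $$ (j, k) * B $$ (k, i)))"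
    by (simp only: index_mult_sum[OF assms ij(2,1)] cnj_sum)
  also have "\<dots> = (\<Sum>k<m. mat_adjoint B $$ (i, k) * mat_adjoint A $$ (k, j))"
    using assms ij by (intro sum.cong) auto
  also have "\<dots> = (mat_adjoint B * mat_adjoint A) $$ (i, j)"
    by (rule index_mult_sum[symmetric, OF _ _ ij]) (use assms in auto)
  finally show "mat_adjoint (A * B) $$ (i, j) = (mat_adjoint B * mat_adjoint A) $$ (i, j)" .
qed (use assms in auto)

lemma adjoint_adjoint [simp]: "mat_adjoint (mat_adjoint A) = (A :: complex mat)"
  by (rule eq_matI) auto

lemma adjoint_cscalar_prod:
  fixes A :: "complex mat"
  assumes A: "A \<in> carrier_mat m n" and v: "v \<in> carrier_vec n" and w: "w \<in> carrier_vec m"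
  shows "(A *\<^sub>v v) \<bullet>c w = v \<bullet>c (mat_adjoint A *\<^sub>v w)"
proof -
  have "(A *\<^sub>v v) \<bullet>c w = (\<Sum>i<m. \<Sum>k<n. A $$ (i, k) * v $ k * cnj (w $ i))"
    unfolding cscalar_prod_sum[OF w]
    by (intro sum.cong refl) (simp add: index_mult_vec_sum[OF A v] sum_distrib_right del: index_mult_mat_vec)
  also have "\<dots> = (\<Sum>k<n. \<Sum>i<m. A $$ (i, k) * v $ k * cnj (w $ i))"
    by (rule sum.swap)
  also have "\<dots> = (\<Sum>k<n. v $ k * cnj ((mat_adjoint A *\<^sub>v w) $ k))"
  proof (intro sum.cong refl)
    fix k assume k: "k \<in> {..<n}"
    have "cnj ((mat_adjoint A *\<^sub>v w) $ k) = (\<Sum>i<m. cnj (mat_adjoint A $$ (k, i) * w $ i))"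
      using k index_mult_vec_sum[OF mat_adjoint_carrier[OF A] w] by (simp only: lessThan_iff cnj_sum)
    also have "\<dots> = (\<Sum>i<m. A $$ (i, k) * cnj (w $ i))"
      using A k by (intro sum.cong) auto
    finally show "(\<Sum>i<m. A $$ (i, k) * v $ k * cnj (w $ i)) = v $ k * cnj ((mat_adjoint A *\<^sub>v w) $ k)"
      by (simp only: sum_distrib_left mult_ac)
  qed
  also have "\<dots> = v \<bullet>c (mat_adjoint A *\<^sub>v w)"
    by (rule cscalar_prod_sum[symmetric]) (rule mult_mat_vec_carrier[OF mat_adjoint_carrier[OF A] w])
  finally show ?thesis .
qed

subsection \<open>The operator norm\<close>

lemma cscalar_prod_norms:
  assumes "v \<in> carrier_vec n"
  shows "v \<bullet>c v = complex_of_real (\<Sum>i<n. (cmod (v $ i))\<^sup>2)"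
  unfolding cscalar_prod_sum[OF assms] of_real_sum
  by (intro sum.cong refl) (simp only: complex_norm_square)

lemma vnorm_L2: "v \<in> carrier_vec n \<Longrightarrow> vnorm v = L2_set (\<lambda>i. cmod (v $ i)) {..<n}"
  by (simp only: vnorm_def L2_set_def cscalar_prod_norms Re_complex_of_real)

lemma cscalar_prod_self: "v \<bullet>c v = complex_of_real ((vnorm v)\<^sup>2)"
proof -
  have "(vnorm v)\<^sup>2 = (\<Sum>i<dim_vec v. (cmod (v $ i))\<^sup>2)"
    unfolding vnorm_L2[OF carrier_vec_dim_vec] L2_set_def
    by (rule real_sqrt_pow2) (simp add: sum_nonneg)
  then show ?thesis by (simp only: cscalar_prod_norms[OF carrier_vec_dim_vec])
qed

lemma vnorm_nonneg [simp]: "vnorm v \<ge> 0"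
  unfolding vnorm_L2[OF carrier_vec_dim_vec] by simp

lemma vnorm_eq_0: "v \<in> carrier_vec n \<Longrightarrow> vnorm v = 0 \<longleftrightarrow> v = 0\<^sub>v n"
  using conjugate_square_eq_0_vec[of v n] cscalar_prod_self[of v] by auto

lemma vnorm_smult: "vnorm (c \<cdot>\<^sub>v v) = cmod c * vnorm v"
proof -
  have "vnorm (c \<cdot>\<^sub>v v) = L2_set (\<lambda>i. cmod c * cmod (v $ i)) {..<dim_vec v}"
    by (subst vnorm_L2[of _ "dim_vec v"]) (auto intro!: L2_set_cong simp: norm_mult)
  then show ?thesis
    by (simp add: vnorm_L2[OF carrier_vec_dim_vec] L2_set_right_distrib)
qed

lemma vnorm_triangle:
  assumes "v \<in> carrier_vec n" "w \<in> carrier_vec n"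
  shows "vnorm (v + w) \<le> vnorm v + vnorm w"
proof -
  have "vnorm (v + w) \<le> L2_set (\<lambda>i. cmod (v $ i) + cmod (w $ i)) {..<n}"
    using assms by (subst vnorm_L2[of _ n]) (auto intro!: L2_set_mono norm_triangle_ineq)
  also have "\<dots> \<le> vnorm v + vnorm w"
    using assms by (simp add: vnorm_L2[of _ n] L2_set_triangle_ineq)
  finally show ?thesis .
qed

lemma Cauchy_Schwarz_vnorm:
  assumes "v \<in> carrier_vec n" "w \<in> carrier_vec n"
  shows "cmod (v \<bullet>c w) \<le> vnorm v * vnorm w"
proof -
  have "cmod (v \<bullet>c w) \<le> (\<Sum>i<n. cmod (v $ i * cnj (w $ i)))"
    unfolding cscalar_prod_sum[OF assms(2)] by (rule norm_sum)
  also have "\<dots> = (\<Sum>i<n. \<bar>cmod (v $ i)\<bar> * \<bar>cmod (w $ i)\<bar>)"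
    by (simp add: norm_mult)
  also have "\<dots> \<le> vnorm v * vnorm w"
    unfolding vnorm_L2[OF assms(1)] vnorm_L2[OF assms(2)] by (rule L2_set_mult_ineq)
  finally show ?thesis .
qed

text \<open>The sum of the moduli of all entries is a crude bound, but enough to make the
  \<open>Sup\<close> in \<open>op_norm\<close> a genuine least upper bound.\<close>

lemma vnorm_mult_vec_bounded:
  assumes A: "A \<in> carrier_mat m n"
  shows "bdd_above {vnorm (A *\<^sub>v v) | v. v \<in> carrier_vec (dim_col A) \<and> vnorm v = 1}"
proof (rule bdd_aboveI)
  fix x assume "x \<in> {vnorm (A *\<^sub>v v) | v. v \<in> carrier_vec (dim_col A) \<and> vnorm v = 1}"
  then obtain v where v: "v \<in> carrier_vec n" "vnorm v = 1" "x = vnorm (A *\<^sub>v v)"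
    using A by auto
  have comp: "cmod (v $ k) \<le> 1" if "k < n" for k
    using member_le_L2_set[of "{..<n}" k "\<lambda>i. cmod (v $ i)"] that v vnorm_L2[of v n] by auto
  have "x \<le> (\<Sum>i<m. cmod ((A *\<^sub>v v) $ i))"
    unfolding v(3) using A v
    by (subst vnorm_L2[of _ m]) (auto intro!: L2_set_le_sum simp del: index_mult_mat_vec)
  also have "\<dots> \<le> (\<Sum>i<m. \<Sum>k<n. cmod (A $$ (i, k)))"
  proof (intro sum_mono)
    fix i assume "i \<in> {..<m}"
    then have "cmod ((A *\<^sub>v v) $ i) \<le> (\<Sum>k<n. cmod (A $$ (i, k) * v $ k))"
      by (simp only: index_mult_vec_sum[OF A v(1)] lessThan_iff norm_sum)
    also have "\<dots> \<le> (\<Sum>k<n. cmod (A $$ (i, k)))"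
      using comp by (intro sum_mono) (auto simp: norm_mult mult_left_le)
    finally show "cmod ((A *\<^sub>v v) $ i) \<le> (\<Sum>k<n. cmod (A $$ (i, k)))" .
  qed
  finally show "x \<le> (\<Sum>i<m. \<Sum>k<n. cmod (A $$ (i, k)))" .
qed

lemma vnorm_mult_vec_le:
  assumes A: "A \<in> carrier_mat m n" and v: "v \<in> carrier_vec n"
  shows "vnorm (A *\<^sub>v v) \<le> op_norm A * vnorm v"
proof (cases "v = 0\<^sub>v n")
  case True
  then have "A *\<^sub>v v = 0\<^sub>v m" using A by auto
  then show ?thesis using True vnorm_eq_0[of "0\<^sub>v m" m] vnorm_eq_0[of "0\<^sub>v n" n] by simp
next
  case False
  then have pos: "vnorm v > 0" using vnorm_eq_0[OF v] vnorm_nonneg[of v] by linarith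
  define u where "u = complex_of_real (1 / vnorm v) \<cdot>\<^sub>v v"
  have u: "u \<in> carrier_vec n" "vnorm u = 1" using v pos by (auto simp: u_def vnorm_smult norm_divide)
  have "vnorm (A *\<^sub>v u) \<le> op_norm A"
    unfolding op_norm_def using A u by (intro cSup_upper vnorm_mult_vec_bounded) auto
  moreover have "A *\<^sub>v u = complex_of_real (1 / vnorm v) \<cdot>\<^sub>v (A *\<^sub>v v)"
    unfolding u_def using A v by (simp add: mult_mat_vec)
  ultimately show ?thesis using pos by (simp add: vnorm_smult norm_divide field_simps)
qed

lemma unit_vec_vnorm: "n > 0 \<Longrightarrow> vnorm (unit_vec n 0) = 1"
proof -
  assume "n > 0"
  have "cmod (unit_vec n 0 $ i) = (if i = 0 then 1 else 0)" if "i < n" for i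
    using that by (auto simp: unit_vec_def)
  then have "L2_set (\<lambda>i. cmod (unit_vec n 0 $ i)) {..<n} = L2_set (\<lambda>i. if i = 0 then 1 else 0) {..<n}"
    by (intro L2_set_cong) auto
  also have "\<dots> = 1" using \<open>n > 0\<close> by (simp add: L2_set_def if_distrib[of "\<lambda>x. x\<^sup>2"] cong: if_cong)
  finally show ?thesis by (simp add: vnorm_L2[of _ n])
qed

text \<open>The assumption \<open>n > 0\<close> provides a unit vector, so that the
  \<open>Sup\<close> is taken over a nonempty set.\<close>

lemma op_norm_le:
  assumes A: "A \<in> carrier_mat m n" "n > 0"
    and le: "\<And>v. v \<in> carrier_vec n \<Longrightarrow> vnorm v = 1 \<Longrightarrow> vnorm (A *\<^sub>v v) \<le> c"
  shows "op_norm A \<le> c"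
  unfolding op_norm_def
proof (rule cSup_least)
  have "vnorm (A *\<^sub>v unit_vec n 0) \<in> {vnorm (A *\<^sub>v v) | v. v \<in> carrier_vec (dim_col A) \<and> vnorm v = 1}"
    using A unit_vec_vnorm[of n] by auto
  then show "{vnorm (A *\<^sub>v v) | v. v \<in> carrier_vec (dim_col A) \<and> vnorm v = 1} \<noteq> {}" by blast
qed (use A le in auto)

lemma op_norm_nonneg:
  assumes "A \<in> carrier_mat m n" "n > 0"
  shows "op_norm A \<ge> 0"
  using vnorm_mult_vec_le[OF assms(1), of "unit_vec n 0"] unit_vec_vnorm[OF assms(2)]
    order_trans[OF vnorm_nonneg[of "A *\<^sub>v unit_vec n 0"]] by simp

lemma op_norm_mult:
  assumes A: "A \<in> carrier_mat l m" and B: "B \<in> carrier_mat m n" and "m > 0" "n > 0"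
  shows "op_norm (A * B) \<le> op_norm A * op_norm B"
proof (rule op_norm_le)
  fix v :: "complex vec" assume v: "v \<in> carrier_vec n" "vnorm v = 1"
  have "vnorm (A * B *\<^sub>v v) = vnorm (A *\<^sub>v (B *\<^sub>v v))" using A B v by simp
  also have "\<dots> \<le> op_norm A * vnorm (B *\<^sub>v v)" by (rule vnorm_mult_vec_le) (use A B v in auto)
  also have "\<dots> \<le> op_norm A * op_norm B"
    using vnorm_mult_vec_le[OF B v(1)] v op_norm_nonneg[OF A \<open>m > 0\<close>] by (simp add: mult_left_mono)
  finally show "vnorm (A * B *\<^sub>v v) \<le> op_norm A * op_norm B" .
qed (use assms in auto)

lemma op_norm_add:
  assumes A: "A \<in> carrier_mat m n" and B: "B \<in> carrier_mat m n" and "n > 0"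
  shows "op_norm (A + B) \<le> op_norm A + op_norm B"
proof (rule op_norm_le)
  fix v :: "complex vec" assume v: "v \<in> carrier_vec n" "vnorm v = 1"
  have "vnorm ((A + B) *\<^sub>v v) = vnorm (A *\<^sub>v v + B *\<^sub>v v)"
    using A B v by (simp add: add_mult_distrib_mat_vec)
  also have "\<dots> \<le> vnorm (A *\<^sub>v v) + vnorm (B *\<^sub>v v)"
    using A B v by (intro vnorm_triangle[of _ m]) auto
  also have "\<dots> \<le> op_norm A + op_norm B"
    using vnorm_mult_vec_le[OF A v(1)] vnorm_mult_vec_le[OF B v(1)] v by simp
  finally show "vnorm ((A + B) *\<^sub>v v) \<le> op_norm A + op_norm B" .
qed (use assms in auto)

lemma op_norm_smult_le:
  assumes A: "A \<in> carrier_mat m n" and "n > 0"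
  shows "op_norm (c \<cdot>\<^sub>m A) \<le> cmod c * op_norm A"
proof (rule op_norm_le)
  fix v :: "complex vec" assume v: "v \<in> carrier_vec n" "vnorm v = 1"
  have "(c \<cdot>\<^sub>m A) *\<^sub>v v = c \<cdot>\<^sub>v (A *\<^sub>v v)" using A v by (intro eq_vecI) auto
  then show "vnorm ((c \<cdot>\<^sub>m A) *\<^sub>v v) \<le> cmod c * op_norm A"
    using vnorm_mult_vec_le[OF A v(1)] v by (simp add: vnorm_smult mult_left_mono)
qed (use assms in auto)

lemma op_norm_one: "n > 0 \<Longrightarrow> op_norm (1\<^sub>m n) \<le> 1"
  by (rule op_norm_le[of _ n n]) auto

text \<open>With w = A* v and v a unit vector, |w|^2 = <A w, v> \<le> |A w| \<le> |A| |w|, and one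
  factor |w| cancels.\<close>

lemma op_norm_adjoint_le:
  assumes A: "A \<in> carrier_mat n n" and "n > 0"
  shows "op_norm (mat_adjoint A) \<le> op_norm A"
proof (rule op_norm_le)
  fix v :: "complex vec" assume v: "v \<in> carrier_vec n" "vnorm v = 1"
  let ?w = "mat_adjoint A *\<^sub>v v"
  have w: "?w \<in> carrier_vec n" by (rule mult_mat_vec_carrier[OF mat_adjoint_carrier[OF A] v(1)])
  have "(vnorm ?w)\<^sup>2 = cmod (?w \<bullet>c ?w)"
    unfolding cscalar_prod_self by (simp only: norm_of_real abs_of_nonneg zero_le_power2)
  also have "?w \<bullet>c ?w = (A *\<^sub>v ?w) \<bullet>c v" using adjoint_cscalar_prod[OF A w v(1)] by simp
  also have "cmod \<dots> \<le> vnorm (A *\<^sub>v ?w)"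
    using Cauchy_Schwarz_vnorm[of "A *\<^sub>v ?w" n v] A v w by auto
  also have "\<dots> \<le> op_norm A * vnorm ?w" by (rule vnorm_mult_vec_le[OF A w])
  finally have "vnorm ?w * vnorm ?w \<le> op_norm A * vnorm ?w" by (simp add: power2_eq_square)
  then show "vnorm ?w \<le> op_norm A"
    using op_norm_nonneg[OF A \<open>n > 0\<close>] vnorm_nonneg[of ?w]
    by (cases "vnorm ?w = 0") (simp_all add: mult_le_cancel_right)
qed (use assms in auto)

subsection \<open>Diagonalization of Hermitian matrices\<close>

definition unitary :: "nat \<Rightarrow> complex mat \<Rightarrow> bool" where
  "unitary N U \<longleftrightarrow> U \<in> carrier_mat N N \<and> mat_adjoint U * U = 1\<^sub>m N"

text \<open>The functional calculus f(A) for A = U diag(ev) U*, with \<open>f\<close> depending on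
  the index of the eigenvector rather than on the eigenvalue. States, projectors and exponentials of
  one Hamiltonian thus share one \<open>U\<close>.\<close>

definition fcalc :: "nat \<Rightarrow> complex mat \<Rightarrow> (nat \<Rightarrow> complex) \<Rightarrow> complex mat" where
  "fcalc N U f = U * mat_diag N f * mat_adjoint U"

lemma unitary_carrier: "unitary N U \<Longrightarrow> U \<in> carrier_mat N N"
  by (simp add: unitary_def)

lemma unitary_right: "unitary N U \<Longrightarrow> U * mat_adjoint U = 1\<^sub>m N"
  unfolding unitary_def using mat_mult_left_right_inverse[of "mat_adjoint U" N U] by auto

lemma adjoint_mult_index:
  fixes U :: "complex mat"
  assumes "U \<in> carrier_mat m N" "i < N" "j < N"
  shows "(mat_adjoint U * U) $$ (i, j) = (\<Sum>k<m. cnj (U $$ (k, i)) * U $$ (k, j))"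
proof -
  have "(mat_adjoint U * U) $$ (i, j) = (\<Sum>k<m. mat_adjoint U $$ (i, k) * U $$ (k, j))"
    by (rule index_mult_sum[OF mat_adjoint_carrier[OF assms(1)] assms])
  also have "\<dots> = (\<Sum>k<m. cnj (U $$ (k, i)) * U $$ (k, j))"
    using assms by (intro sum.cong) auto
  finally show ?thesis .
qed

lemma unitary_cols:
  assumes "unitary N U" "i < N" "j < N"
  shows "(\<Sum>k<N. cnj (U $$ (k, i)) * U $$ (k, j)) = (if i = j then 1 else 0)"
proof -
  have "(mat_adjoint U * U) $$ (i, j) = (if i = j then 1 else 0)"
    using assms by (simp add: unitary_def)
  then show ?thesis using adjoint_mult_index[OF unitary_carrier[OF assms(1)] assms(2,3)] by simp
qed

lemma unitaryI:
  assumes "U \<in> carrier_mat N N"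
    and "\<And>i j. i < N \<Longrightarrow> j < N \<Longrightarrow>
      (\<Sum>k<N. cnj (U $$ (k, i)) * U $$ (k, j)) = (if i = j then 1 else 0)"
  shows "unitary N U"
  unfolding unitary_def
proof (intro conjI eq_matI)
  fix i j assume "i < dim_row (1\<^sub>m N :: complex mat)" "j < dim_col (1\<^sub>m N :: complex mat)"
  then have ij: "i < N" "j < N" by auto
  show "(mat_adjoint U * U) $$ (i, j) = 1\<^sub>m N $$ (i, j)"
    unfolding adjoint_mult_index[OF assms(1) ij] assms(2)[OF ij] using ij by simp
qed (use assms(1) in auto)

lemma unitary_mult:
  assumes "unitary N U" "unitary N V"
  shows "unitary N (U * V)"
proof -
  have U: "U \<in> carrier_mat N N" and V: "V \<in> carrier_mat N N"
    using assms by (auto simp: unitary_def)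
  have "mat_adjoint (U * V) * (U * V) = mat_adjoint V * (mat_adjoint U * U) * V"
    using U V by (simp add: adjoint_mult[OF U V] assoc_mult_mat[of _ N N _ N _ N] mult_carrier_mat[of _ N N _ N])
  also have "\<dots> = 1\<^sub>m N" using assms V by (simp add: unitary_def)
  finally show ?thesis using U V by (simp add: unitary_def)
qed

lemma fcalc_carrier [simp]: "U \<in> carrier_mat N N \<Longrightarrow> fcalc N U f \<in> carrier_mat N N"
  unfolding fcalc_def by auto

lemma fcalc_index:
  assumes "U \<in> carrier_mat N N" "i < N" "j < N"
  shows "fcalc N U f $$ (i, j) = (\<Sum>k<N. U $$ (i, k) * f k * cnj (U $$ (j, k)))"
proof -
  have "fcalc N U f $$ (i, j) = (\<Sum>k<N. (U * mat_diag N f) $$ (i, k) * mat_adjoint U $$ (k, j))"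
    unfolding fcalc_def using assms by (intro index_mult_sum[of _ N N _ N]) auto
  also have "\<dots> = (\<Sum>k<N. U $$ (i, k) * f k * cnj (U $$ (j, k)))"
    using assms by (intro sum.cong) (auto simp: mat_diag_mult_right[OF assms(1)])
  finally show ?thesis .
qed

lemma fcalc_mult:
  assumes "unitary N U"
  shows "fcalc N U f * fcalc N U g = fcalc N U (\<lambda>k. f k * g k)"
proof -
  have U: "U \<in> carrier_mat N N" using assms by (simp add: unitary_def)
  have "fcalc N U f * fcalc N U g
      = U * mat_diag N f * ((mat_adjoint U * U) * mat_diag N g * mat_adjoint U)"
    unfolding fcalc_def using U by (simp add: assoc_mult_mat[of _ N N _ N _ N] mult_carrier_mat[of _ N N _ N])
  also have "\<dots> = U * (mat_diag N f * mat_diag N g) * mat_adjoint U"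
    using assms U by (simp add: unitary_def left_mult_one_mat[of _ N N] assoc_mult_mat[of _ N N _ N _ N] mult_carrier_mat[of _ N N _ N] del: mat_diag_diag)
  finally show ?thesis by (simp add: fcalc_def)
qed

lemma fcalc_one: "unitary N U \<Longrightarrow> fcalc N U (\<lambda>_. 1) = 1\<^sub>m N"
  using unitary_right[of N U] unitary_carrier[of N U] by (simp add: fcalc_def)

lemma fcalc_smult:
  assumes "U \<in> carrier_mat N N"
  shows "c \<cdot>\<^sub>m fcalc N U f = fcalc N U (\<lambda>k. c * f k)"
  using assms
  by (intro eq_matI) (auto simp: fcalc_index sum_distrib_left mult_ac carrier_matD[OF fcalc_carrier])

lemma fcalc_cong: "(\<And>k. k < N \<Longrightarrow> f k = g k) \<Longrightarrow> fcalc N U f = fcalc N U g"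
  unfolding fcalc_def mat_diag_def by (auto intro!: arg_cong2[of _ _ _ _ "(*)"])

lemma fcalc_pow:
  assumes "unitary N U"
  shows "fcalc N U f ^\<^sub>m m = fcalc N U (\<lambda>k. f k ^ m)"
proof (induction m)
  case 0
  then show ?case using assms fcalc_one[OF assms] by (simp add: unitary_def carrier_matD[OF fcalc_carrier])
next
  case (Suc m)
  then show ?case using assms by (simp add: fcalc_mult mult.commute)
qed

lemma fcalc_self_adjoint:
  assumes "U \<in> carrier_mat N N" "\<And>k. k < N \<Longrightarrow> cnj (f k) = f k"
  shows "fcalc N U f \<in> self_adjoint N"
  unfolding self_adjoint_iff
proof (intro conjI allI impI)
  fix i j assume "i < N" "j < N"
  then show "fcalc N U f $$ (i, j) = cnj (fcalc N U f $$ (j, i))"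
    using assms by (auto simp: fcalc_index mult_ac intro!: sum.cong)
qed (use assms in auto)

lemma tr_mult:
  assumes "X \<in> carrier_mat m n" "Y \<in> carrier_mat n m"
  shows "tr (X * Y) = (\<Sum>i<m. \<Sum>k<n. X $$ (i, k) * Y $$ (k, i))"
proof -
  have "dim_row (X * Y) = m" using assms by simp
  then show ?thesis unfolding tr_def
    by (simp only:) (intro sum.cong refl index_mult_sum[OF assms]; simp)
qed

lemma tr_fcalc:
  assumes "unitary N U"
  shows "tr (fcalc N U f) = (\<Sum>k<N. f k)"
proof -
  have U: "U \<in> carrier_mat N N" using assms by (simp add: unitary_def)
  have "tr (fcalc N U f) = (\<Sum>i<N. \<Sum>k<N. U $$ (i, k) * f k * cnj (U $$ (i, k)))"
    unfolding tr_def using U by (auto simp: fcalc_index carrier_matD[OF fcalc_carrier] intro!: sum.cong)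
  also have "\<dots> = (\<Sum>k<N. f k * (\<Sum>i<N. cnj (U $$ (i, k)) * U $$ (i, k)))"
    by (subst sum.swap) (simp add: sum_distrib_left mult_ac)
  also have "\<dots> = (\<Sum>k<N. f k)" by (intro sum.cong refl) (simp add: unitary_cols[OF assms])
  finally show ?thesis .
qed

lemma unitary_col_vnorm:
  assumes "unitary N U" "k < N"
  shows "vnorm (col U k) = 1"
proof -
  have U: "U \<in> carrier_mat N N" using assms by (simp add: unitary_def)
  have "col U k \<bullet>c col U k = (\<Sum>i<N. col U k $ i * cnj (col U k $ i))"
    by (rule cscalar_prod_sum) (metis U col_dim carrier_matD(1))
  also have "\<dots> = (\<Sum>i<N. cnj (U $$ (i, k)) * U $$ (i, k))"
    using U assms by (intro sum.cong) auto
  also have "\<dots> = 1" using unitary_cols[OF assms assms(2)] by simp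
  finally show ?thesis by (simp add: vnorm_def)
qed

text \<open>The trace evaluated in the eigenbasis: an expectation is a weighted combination of the
  diagonal values <X u, u> over the columns u of \<open>U\<close>, so states with the same
  \<open>U\<close> are compared through their weights.\<close>

lemma tr_fcalc_mult:
  assumes "unitary N U" "X \<in> carrier_mat N N"
  shows "tr (fcalc N U f * X) = (\<Sum>k<N. f k * ((X *\<^sub>v col U k) \<bullet>c col U k))"
proof -
  have U: "U \<in> carrier_mat N N" using assms by (simp add: unitary_def)
  have e: "(X *\<^sub>v col U k) \<bullet>c col U k = (\<Sum>i<N. \<Sum>j<N. X $$ (i, j) * U $$ (j, k) * cnj (U $$ (i, k)))"
    if "k < N" for k
  proof -
    have "(X *\<^sub>v col U k) \<bullet>c col U k = (\<Sum>i<N. (X *\<^sub>v col U k) $ i * cnj (col U k $ i))"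
      by (rule cscalar_prod_sum) (metis U col_dim carrier_matD(1))
    also have "\<dots> = (\<Sum>i<N. (\<Sum>j<N. X $$ (i, j) * col U k $ j) * cnj (col U k $ i))"
      by (intro sum.cong refl arg_cong2[of _ _ _ _ "(*)"] index_mult_vec_sum[OF assms(2)])
         (metis U col_dim carrier_matD(1), simp)
    also have "\<dots> = (\<Sum>i<N. \<Sum>j<N. X $$ (i, j) * U $$ (j, k) * cnj (U $$ (i, k)))"
      using U that by (auto simp: sum_distrib_right intro!: sum.cong)
    finally show ?thesis .
  qed
  have "tr (fcalc N U f * X) = (\<Sum>j<N. \<Sum>i<N. fcalc N U f $$ (j, i) * X $$ (i, j))"
    by (rule tr_mult[OF fcalc_carrier[OF U] assms(2)])
  also have "\<dots> = (\<Sum>j<N. \<Sum>i<N. \<Sum>k<N. f k * (X $$ (i, j) * U $$ (j, k) * cnj (U $$ (i, k))))"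
    using U by (auto intro!: sum.cong simp: fcalc_index sum_distrib_left mult_ac)
  also have "\<dots> = (\<Sum>j<N. \<Sum>k<N. \<Sum>i<N. f k * (X $$ (i, j) * U $$ (j, k) * cnj (U $$ (i, k))))"
    by (intro sum.cong refl sum.swap)
  also have "\<dots> = (\<Sum>k<N. \<Sum>j<N. \<Sum>i<N. f k * (X $$ (i, j) * U $$ (j, k) * cnj (U $$ (i, k))))"
    by (rule sum.swap)
  also have "\<dots> = (\<Sum>k<N. f k * (\<Sum>j<N. \<Sum>i<N. X $$ (i, j) * U $$ (j, k) * cnj (U $$ (i, k))))"
    by (simp add: sum_distrib_left)
  also have "\<dots> = (\<Sum>k<N. f k * ((X *\<^sub>v col U k) \<bullet>c col U k))"
  proof (intro sum.cong refl arg_cong2[of _ _ _ _ "(*)"])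
    fix k assume "k \<in> {..<N}"
    then show "(\<Sum>j<N. \<Sum>i<N. X $$ (i, j) * U $$ (j, k) * cnj (U $$ (i, k))) = (X *\<^sub>v col U k) \<bullet>c col U k"
      by (subst e) (simp, rule sum.swap)
  qed
  finally show ?thesis .
qed

text \<open>Deflation: an eigenvector, which exists because the characteristic polynomial splits
  over the complex numbers, is completed to an orthonormal basis. In that basis the matrix is a
  scalar plus a Hermitian block of dimension one less, to which the induction hypothesis
  applies.\<close>

theorem hermitian_diagonalization:
  assumes "A \<in> self_adjoint N"
  shows "\<exists>U ev. unitary N U \<and> A = fcalc N U (\<lambda>k. complex_of_real (ev k))"
  using assms
proof (induction N arbitrary: A)
  case 0
  then have "A \<in> carrier_mat 0 0" by (simp add: self_adjoint_iff)
  then have "unitary 0 A" "A = fcalc 0 A (\<lambda>k. 0)"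
    by (auto simp: fcalc_def intro!: unitaryI)
  then show ?case by (intro exI[of _ A] exI[of _ "\<lambda>_. 0"]) auto
next
  case (Suc n)
  let ?N = "Suc n"
  have A: "A \<in> carrier_mat ?N ?N" using Suc.prems by (simp add: self_adjoint_iff)
  obtain e v where v: "eigenvector A v e"
  proof -
    obtain es where es: "char_poly A = (\<Prod>a\<leftarrow>es. [:- a, 1:])" "length es = ?N"
      using char_poly_factorized[OF A] by auto
    then obtain e es' where "es = e # es'" by (cases es) auto
    then have "poly (char_poly A) e = 0" using es by simp
    then have "eigenvalue A e" by (simp add: eigenvalue_root_char_poly[OF A])
    then show ?thesis using that by (auto simp: eigenvalue_def)
  qed
  have vN: "v \<in> carrier_vec ?N" and v0: "v \<noteq> 0\<^sub>v ?N" and Av: "A *\<^sub>v v = e \<cdot>\<^sub>v v"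
    using v A by (auto simp: eigenvector_def)
  interpret cof_vec_space ?N "TYPE(complex)" .
  define b where "b = basis_completion v"
  define ws where "ws = gram_schmidt ?N b"
  have dist_b: "distinct b"
    and indep: "\<not> lin_dep (set b)" and b: "set b \<subseteq> carrier_vec ?N" and hdb: "hd b = v"
    and len_b: "length b = ?N" using basis_completion[OF vN v0, folded b_def] by auto
  from hdb len_b obtain vs where bv: "b = v # vs" by (cases b) auto
  from gram_schmidt_result[OF b dist_b indep refl, folded ws_def]
  have ws: "set ws \<subseteq> carrier_vec ?N" "corthogonal ws" "length ws = ?N"
    by (auto simp: len_b)
  have ws0: "ws ! 0 = v" using gram_schmidt_hd[OF vN, of vs, folded bv] ws(3)
    unfolding ws_def by (metis hd_conv_nth length_0_conv nat.simps(3))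
  have wsc: "ws ! j \<in> carrier_vec ?N" if "j < ?N" for j using ws that by auto
  have wsn: "vnorm (ws ! j) > 0" if "j < ?N" for j
  proof -
    have "ws ! j \<bullet>c ws ! j \<noteq> 0" using corthogonalD[OF ws(2), of j j] ws(3) that by simp
    then have "vnorm (ws ! j) \<noteq> 0" unfolding cscalar_prod_self by simp
    then show ?thesis using vnorm_nonneg[of "ws ! j"] by linarith
  qed
  \<comment> \<open>Gram-Schmidt returns an orthogonal family that still contains \<open>v\<close>
    itself; dividing each column by its length makes the matrix unitary.\<close>
  define U where "U = mat ?N ?N (\<lambda>(i, j). ws ! j $ i / complex_of_real (vnorm (ws ! j)))"
  have U: "U \<in> carrier_mat ?N ?N" by (simp add: U_def)
  have unitU: "unitary ?N U"
  proof (rule unitaryI[OF U])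
    fix i j assume ij: "i < ?N" "j < ?N"
    have "(\<Sum>k<?N. cnj (U $$ (k, i)) * U $$ (k, j))
        = (\<Sum>k<?N. ws ! j $ k * cnj (ws ! i $ k)) / (of_real (vnorm (ws ! i)) * of_real (vnorm (ws ! j)))"
      unfolding sum_divide_distrib using ij
      by (intro sum.cong) (auto simp: U_def mult_ac)
    also have "(\<Sum>k<?N. ws ! j $ k * cnj (ws ! i $ k)) = ws ! j \<bullet>c ws ! i"
      by (rule cscalar_prod_sum[symmetric]) (use wsc ij in auto)
    also have "ws ! j \<bullet>c ws ! i = (if i = j then of_real ((vnorm (ws ! i))\<^sup>2) else 0)"
      using corthogonalD[OF ws(2), of j i] ws(3) ij cscalar_prod_self by auto
    finally show "(\<Sum>k<?N. cnj (U $$ (k, i)) * U $$ (k, j)) = (if i = j then 1 else 0)"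
      using wsn[OF ij(1)] by (auto simp: power2_eq_square)
  qed
  define A' where "A' = mat_adjoint U * A * U"
  have A': "A' \<in> carrier_mat ?N ?N" unfolding A'_def by (intro mult_carrier_mat[of _ ?N ?N _ ?N] mat_adjoint_carrier U A)
  have sA: "mat_adjoint A = A" using Suc.prems by (simp add: self_adjoint_def)
  have "mat_adjoint A' = mat_adjoint U * mat_adjoint (mat_adjoint U * A)"
    unfolding A'_def by (rule adjoint_mult[OF mult_carrier_mat[OF mat_adjoint_carrier[OF U] A] U])
  also have "mat_adjoint (mat_adjoint U * A) = A * U"
    using adjoint_mult[OF mat_adjoint_carrier[OF U] A] sA by simp
  also have "mat_adjoint U * (A * U) = A'"
    unfolding A'_def by (rule assoc_mult_mat[symmetric, OF mat_adjoint_carrier[OF U] A U])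
  finally have "mat_adjoint A' = A'" .
  then have "A' \<in> self_adjoint ?N" using A' by (simp add: self_adjoint_def)
  then have herm: "A' $$ (i, j) = cnj (A' $$ (j, i))" if "i < ?N" "j < ?N" for i j
    using that unfolding self_adjoint_iff by blast
  have AU0: "(A * U) $$ (k, 0) = e * U $$ (k, 0)" if k: "k < ?N" for k
  proof -
    have "(A * U) $$ (k, 0) = (\<Sum>l<?N. A $$ (k, l) * U $$ (l, 0))"
      by (rule index_mult_sum[OF A U k]) simp
    also have "\<dots> = (\<Sum>l<?N. A $$ (k, l) * v $ l) / of_real (vnorm v)"
      unfolding sum_divide_distrib by (intro sum.cong) (auto simp: U_def ws0)
    also have "(\<Sum>l<?N. A $$ (k, l) * v $ l) = (A *\<^sub>v v) $ k"
      by (rule index_mult_vec_sum[OF A vN k, symmetric])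
    finally show ?thesis unfolding Av using k vN by (simp add: U_def ws0)
  qed
  have col0: "A' $$ (i, 0) = (if i = 0 then e else 0)" if i: "i < ?N" for i
  proof -
    have "A' = mat_adjoint U * (A * U)"
      unfolding A'_def using U A by (simp add: assoc_mult_mat[of _ ?N ?N _ ?N _ ?N] mult_carrier_mat[of _ ?N ?N _ ?N])
    then have "A' $$ (i, 0) = (\<Sum>k<?N. mat_adjoint U $$ (i, k) * (A * U) $$ (k, 0))"
      using index_mult_sum[of "mat_adjoint U" ?N ?N "A * U" ?N i 0] U A i by simp
    also have "\<dots> = e * (\<Sum>k<?N. cnj (U $$ (k, i)) * U $$ (k, 0))"
      unfolding sum_distrib_left using U i
      by (intro sum.cong) (auto simp: AU0 simp del: index_mult_mat(1))
    also have "\<dots> = (if i = 0 then e else 0)"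
      using unitary_cols[OF unitU i, of 0] by simp
    finally show ?thesis .
  qed
  \<comment> \<open>The first column vanishes below the corner because it comes from an eigenvector;
    the first row does so because \<open>A'\<close> is Hermitian. Hence \<open>A'\<close> is block
    diagonal.\<close>
  have row0: "A' $$ (0, i) = (if i = 0 then e else 0)" if i: "i < ?N" for i
    by (metis col0 complex_cnj_zero herm i zero_less_Suc)
  have "cnj e = e" using herm[of 0 0] col0[of 0] by simp
  then have e_real: "complex_of_real (Re e) = e" by (simp add: complex_eq_iff)
  define A3 where "A3 = mat n n (\<lambda>(i, j). A' $$ (Suc i, Suc j))"
  have "A3 \<in> self_adjoint n"
    unfolding self_adjoint_iff
  proof (intro conjI allI impI)
    fix i j assume "i < n" "j < n"
    then show "A3 $$ (i, j) = cnj (A3 $$ (j, i))"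
      using herm[of "Suc i" "Suc j"] by (simp add: A3_def)
  qed (simp add: A3_def)
  from Suc.IH[OF this] obtain U3 ev3 where
    U3: "unitary n U3" and A3: "A3 = fcalc n U3 (\<lambda>k. complex_of_real (ev3 k))" by auto
  have U3c: "U3 \<in> carrier_mat n n" using U3 by (simp add: unitary_def)
  \<comment> \<open>The direct sum of the 1 by 1 identity and \<open>U3\<close>: it diagonalizes the
    lower block and leaves the eigenvector in place.\<close>
  define F where "F = mat ?N ?N (\<lambda>(i, j). case i of 0 \<Rightarrow> (if j = 0 then 1 else 0)
    | Suc i' \<Rightarrow> (case j of 0 \<Rightarrow> 0 | Suc j' \<Rightarrow> U3 $$ (i', j')))"
  have F: "F \<in> carrier_mat ?N ?N" by (simp add: F_def)
  have Fi: "F $$ (0, 0) = 1" "\<And>j. j < n \<Longrightarrow> F $$ (0, Suc j) = 0" "\<And>i. i < n \<Longrightarrow> F $$ (Suc i, 0) = 0"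
    "\<And>i j. i < n \<Longrightarrow> j < n \<Longrightarrow> F $$ (Suc i, Suc j) = U3 $$ (i, j)"
    by (auto simp: F_def)
  have unitF: "unitary ?N F"
  proof (rule unitaryI[OF F])
    fix i j assume ij: "i < ?N" "j < ?N"
    show "(\<Sum>k<?N. cnj (F $$ (k, i)) * F $$ (k, j)) = (if i = j then 1 else 0)"
      unfolding sum.lessThan_Suc_shift using ij unitary_cols[OF U3]
      by (cases i; cases j) (auto simp: Fi)
  qed
  define ev where "ev k = (case k of 0 \<Rightarrow> Re e | Suc k' \<Rightarrow> ev3 k')" for k
  have A'F: "A' = fcalc ?N F (\<lambda>k. complex_of_real (ev k))"
  proof (rule eq_matI)
    fix i j assume "i < dim_row (fcalc ?N F (\<lambda>k. complex_of_real (ev k)))"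
      "j < dim_col (fcalc ?N F (\<lambda>k. complex_of_real (ev k)))"
    then have ij: "i < ?N" "j < ?N" by (simp_all add: carrier_matD[OF fcalc_carrier[OF F]])
    show "A' $$ (i, j) = fcalc ?N F (\<lambda>k. complex_of_real (ev k)) $$ (i, j)"
    proof (cases "i = 0 \<or> j = 0")
      case True
      then show ?thesis
        unfolding fcalc_index[OF F ij] sum.lessThan_Suc_shift using ij col0[of i] row0[of j] e_real
        by (cases i; cases j) (auto simp: Fi ev_def)
    next
      case False
      then obtain i' j' where s: "i = Suc i'" "j = Suc j'" by (cases i; cases j) auto
      then have l: "i' < n" "j' < n" using ij by auto
      have "A' $$ (i, j) = A3 $$ (i', j')" using l s by (simp add: A3_def)
      then show ?thesis
        unfolding fcalc_index[OF F ij] sum.lessThan_Suc_shift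
        using l s by (simp add: A3 fcalc_index[OF U3c l] Fi ev_def)
    qed
  qed (use A' carrier_matD[OF fcalc_carrier[OF F]] in auto)
  have "U * A' * mat_adjoint U = (U * mat_adjoint U) * A * (U * mat_adjoint U)"
    unfolding A'_def using U A by (simp add: assoc_mult_mat[of _ ?N ?N _ ?N _ ?N] mult_carrier_mat[of _ ?N ?N _ ?N])
  also have "\<dots> = A" using A unitary_right[OF unitU] by simp
  finally have "A = U * (F * mat_diag ?N (\<lambda>k. complex_of_real (ev k)) * mat_adjoint F) * mat_adjoint U"
    by (simp add: A'F fcalc_def)
  also have "\<dots> = fcalc ?N (U * F) (\<lambda>k. complex_of_real (ev k))"
    unfolding fcalc_def using U F
    by (simp add: adjoint_mult[OF U F] assoc_mult_mat[of _ ?N ?N _ ?N _ ?N] mult_carrier_mat[of _ ?N ?N _ ?N])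
  finally show ?case using unitary_mult[OF unitU unitF] by blast
qed

subsection \<open>Functional calculus\<close>

lemma fcalc_mult_vec:
  assumes U: "U \<in> carrier_mat N N" and v: "v \<in> carrier_vec N" and i: "i < N"
  shows "(fcalc N U f *\<^sub>v v) $ i = (\<Sum>k<N. U $$ (i, k) * (f k * (v \<bullet>c col U k)))"
proof -
  have y: "v \<bullet>c col U k = (\<Sum>j<N. v $ j * cnj (U $$ (j, k)))" if "k < N" for k
  proof -
    have "col U k \<in> carrier_vec N" using U by (metis col_dim carrier_matD(1))
    then show ?thesis using U that by (simp add: cscalar_prod_sum[of "col U k" N v])
  qed
  have "(fcalc N U f *\<^sub>v v) $ i = (\<Sum>j<N. fcalc N U f $$ (i, j) * v $ j)"
    by (rule index_mult_vec_sum[OF fcalc_carrier[OF U] v i])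
  also have "\<dots> = (\<Sum>j<N. \<Sum>k<N. U $$ (i, k) * f k * cnj (U $$ (j, k)) * v $ j)"
    by (intro sum.cong refl) (simp add: fcalc_index[OF U i] sum_distrib_right)
  also have "\<dots> = (\<Sum>k<N. \<Sum>j<N. U $$ (i, k) * f k * cnj (U $$ (j, k)) * v $ j)"
    by (rule sum.swap)
  also have "\<dots> = (\<Sum>k<N. U $$ (i, k) * (f k * (v \<bullet>c col U k)))"
    by (intro sum.cong refl) (simp add: y sum_distrib_left mult_ac)
  finally show ?thesis .
qed

lemma unitary_cols_cscalar:
  assumes "unitary N U" "k < N" "l < N"
  shows "col U k \<bullet>c col U l = (if k = l then 1 else 0)"
proof -
  have U: "U \<in> carrier_mat N N" by (rule unitary_carrier[OF assms(1)])
  have "col U l \<in> carrier_vec N" using U by (metis col_dim carrier_matD(1))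
  then have "col U k \<bullet>c col U l = (\<Sum>i<N. cnj (U $$ (i, l)) * U $$ (i, k))"
    using U assms by (simp add: cscalar_prod_sum[of "col U l" N "col U k"] mult.commute)
  then show ?thesis using unitary_cols[OF assms(1,3,2)] by auto
qed

lemma fcalc_mult_col:
  assumes "unitary N U" "k < N"
  shows "fcalc N U f *\<^sub>v col U k = f k \<cdot>\<^sub>v col U k"
proof (rule eq_vecI)
  have U: "U \<in> carrier_mat N N" by (rule unitary_carrier[OF assms(1)])
  then have c: "col U k \<in> carrier_vec N" by (metis col_dim carrier_matD(1))
  fix i assume "i < dim_vec (f k \<cdot>\<^sub>v col U k)"
  then have i: "i < N" using U by simp
  have "(fcalc N U f *\<^sub>v col U k) $ i = (\<Sum>l<N. U $$ (i, l) * (f l * (col U k \<bullet>c col U l)))"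
    by (rule fcalc_mult_vec[OF U c i])
  also have "\<dots> = (\<Sum>l<N. if k = l then U $$ (i, l) * f l else 0)"
    by (intro sum.cong refl) (simp add: unitary_cols_cscalar[OF assms])
  also have "\<dots> = (f k \<cdot>\<^sub>v col U k) $ i" using assms(2) i U by simp
  finally show "(fcalc N U f *\<^sub>v col U k) $ i = (f k \<cdot>\<^sub>v col U k) $ i" .
qed (use unitary_carrier[OF assms(1)] carrier_matD[OF fcalc_carrier[OF unitary_carrier[OF assms(1)]]] in auto)

text \<open>The series in \<open>mat_exp\<close> is summed entry by entry, and in the eigenbasis
  each entry is a finite combination of scalar exponential series.\<close>

lemma mat_exp_fcalc:
  assumes "unitary N U"
  shows "mat_exp (c \<cdot>\<^sub>m fcalc N U f) = fcalc N U (\<lambda>k. exp (c * f k))"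
proof (rule eq_matI)
  have U: "U \<in> carrier_mat N N" by (rule unitary_carrier[OF assms(1)])
  note d = carrier_matD[OF fcalc_carrier[OF U]]
  fix i j assume "i < dim_row (fcalc N U (\<lambda>k. exp (c * f k)))" "j < dim_col (fcalc N U (\<lambda>k. exp (c * f k)))"
  then have ij: "i < N" "j < N" by (simp_all add: d)
  have "(\<lambda>m. \<Sum>k<N. U $$ (i, k) * ((c * f k) ^ m /\<^sub>R fact m) * cnj (U $$ (j, k)))
      sums (\<Sum>k<N. U $$ (i, k) * exp (c * f k) * cnj (U $$ (j, k)))"
    by (intro sums_sum sums_mult sums_mult2 exp_converges)
  moreover have "(\<Sum>k<N. U $$ (i, k) * ((c * f k) ^ m /\<^sub>R fact m) * cnj (U $$ (j, k)))
      = ((c \<cdot>\<^sub>m fcalc N U f) ^\<^sub>m m) $$ (i, j) / fact m" for m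
    unfolding fcalc_smult[OF U] fcalc_pow[OF assms] fcalc_index[OF U ij] sum_divide_distrib
    by (intro sum.cong refl) (simp add: scaleR_conv_of_real field_simps)
  ultimately have "(\<Sum>m. ((c \<cdot>\<^sub>m fcalc N U f) ^\<^sub>m m) $$ (i, j) / fact m)
      = (\<Sum>k<N. U $$ (i, k) * exp (c * f k) * cnj (U $$ (j, k)))"
    by (simp add: sums_iff)
  then show "mat_exp (c \<cdot>\<^sub>m fcalc N U f) $$ (i, j) = fcalc N U (\<lambda>k. exp (c * f k)) $$ (i, j)"
    using ij by (simp add: mat_exp_def d fcalc_index[OF U ij])
qed (simp_all add: mat_exp_def carrier_matD[OF fcalc_carrier[OF unitary_carrier[OF assms(1)]]])

lemma gibbs_state_fcalc:
  assumes "unitary N U"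
  shows "gibbs_state (fcalc N U (\<lambda>k. complex_of_real (ev k))) \<beta>
    = fcalc N U (\<lambda>k. complex_of_real (exp (- \<beta> * ev k) / (\<Sum>l<N. exp (- \<beta> * ev l))))"
proof -
  have "mat_exp (complex_of_real (- \<beta>) \<cdot>\<^sub>m fcalc N U (\<lambda>k. complex_of_real (ev k)))
      = fcalc N U (\<lambda>k. complex_of_real (exp (- \<beta> * ev k)))"
    unfolding mat_exp_fcalc[OF assms] by (intro fcalc_cong) (simp flip: exp_of_real)
  then show ?thesis
    unfolding gibbs_state_def
    by (simp add: tr_fcalc[OF assms] fcalc_smult[OF unitary_carrier[OF assms]] del: of_real_minus)
qed

text \<open>Discharges the definite description. Two self-adjoint idempotents with the same range
  satisfy P Q = Q and Q P = P; the adjoint of the second equation reads P Q = P, so they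
  coincide.\<close>

lemma orth_projector_eqI:
  assumes P: "P \<in> self_adjoint N" "P * P = P" "{P *\<^sub>v v | v. v \<in> carrier_vec N} = W"
  shows "orth_projector N W = P"
  unfolding orth_projector_def
proof (rule the_equality)
  show "P \<in> self_adjoint N \<and> P * P = P \<and> {P *\<^sub>v v |v. v \<in> carrier_vec N} = W" using assms by simp
  \<comment> \<open>An idempotent fixes its range: every column of \<open>B\<close> has the form
    \<open>A *\<^sub>v w\<close> and is therefore unchanged by \<open>A\<close>.\<close>
  have key: "A * B = B"
    if A: "A \<in> self_adjoint N" "A * A = A" and B: "B \<in> self_adjoint N"
      and sub: "{B *\<^sub>v v | v. v \<in> carrier_vec N} \<subseteq> {A *\<^sub>v v | v. v \<in> carrier_vec N}" for A B
  proof -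
    have Ac: "A \<in> carrier_mat N N" and Bc: "B \<in> carrier_mat N N"
      using A B by (auto simp: self_adjoint_def)
    have "col (A * B) j = col B j" if j: "j < N" for j
    proof -
      have "B *\<^sub>v unit_vec N j \<in> {A *\<^sub>v v | v. v \<in> carrier_vec N}"
        by (rule subsetD[OF sub]) (unfold mem_Collect_eq, intro exI[of _ "unit_vec N j"], simp)
      then obtain w where w: "w \<in> carrier_vec N" "B *\<^sub>v unit_vec N j = A *\<^sub>v w" by auto
      have "col B j = B *\<^sub>v unit_vec N j"
        using Bc j by (intro eq_vecI) (simp_all add: scalar_prod_right_unit[of _ N])
      then have cB: "col B j = A *\<^sub>v w" using w(2) by simp
      have "col (A * B) j = A *\<^sub>v col B j" by (rule col_mult2[OF Ac Bc j])
      also have "\<dots> = (A * A) *\<^sub>v w" using Ac w cB by (simp add: assoc_mult_mat_vec[of _ N N _ N] del: A(2))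
      finally show ?thesis using A(2) cB by simp
    qed
    then show "A * B = B" using Ac Bc by (intro mat_col_eqI) auto
  qed
  fix Q assume Q: "Q \<in> self_adjoint N \<and> Q * Q = Q \<and> {Q *\<^sub>v v |v. v \<in> carrier_vec N} = W"
  have PQ: "P * Q = Q" and QP: "Q * P = P"
    by (rule key; use Q assms in simp)+
  have ad: "mat_adjoint P = P" "mat_adjoint Q = Q" "P \<in> carrier_mat N N" "Q \<in> carrier_mat N N"
    using Q P by (auto simp: self_adjoint_def)
  have "mat_adjoint (Q * P) = mat_adjoint P * mat_adjoint Q"
    by (rule adjoint_mult[OF ad(4,3)])
  then show "Q = P" unfolding QP ad(1,2) PQ by simp
qed

text \<open>Connects the span of all eigenvectors, a basis-free object, with the columns of the
  chosen \<open>U\<close>. The range of the projector is spanned by columns that are themselves such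
  eigenvectors; conversely every eigenvector with eigenvalue in \<open>I\<close> is fixed by the
  projector, whose range is a subspace.\<close>

lemma spectral_subspace_span:
  fixes ev :: "nat \<Rightarrow> real" and I :: "real set"
  assumes un: "unitary N U"
  defines "S \<equiv> {v. \<exists>e\<in>I. eigenvector (fcalc N U (\<lambda>k. complex_of_real (ev k))) v (complex_of_real e)}"
  shows "{fcalc N U (\<lambda>k. if ev k \<in> I then 1 else 0) *\<^sub>v v | v. v \<in> carrier_vec N}
    = LinearCombinations.module.span class_ring (module_vec TYPE(complex) N) S"
proof -
  interpret vec_space "TYPE(complex)" N .
  let ?H = "fcalc N U (\<lambda>k. complex_of_real (ev k))"
  let ?P = "fcalc N U (\<lambda>k. if ev k \<in> I then 1 else 0)"
  have U: "U \<in> carrier_mat N N" by (rule unitary_carrier[OF un])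
  have c: "col U k \<in> carrier_vec N" for k using U by (metis col_dim carrier_matD(1))
  have H: "?H \<in> carrier_mat N N" and P: "?P \<in> carrier_mat N N" using U by auto
  have Hsa: "mat_adjoint ?H = ?H" using fcalc_self_adjoint[OF U, of "\<lambda>k. complex_of_real (ev k)"]
    by (simp add: self_adjoint_def)
  have Ssub: "S \<subseteq> carrier_vec N" using H by (auto simp: S_def eigenvector_def)
  have colS: "col U k \<in> S" if "k < N" "ev k \<in> I" for k
  proof -
    have "col U k \<noteq> 0\<^sub>v N" using unitary_col_vnorm[OF un that(1)] vnorm_eq_0[OF c, of k] by auto
    then have "eigenvector ?H (col U k) (complex_of_real (ev k))"
      using H c by (simp add: eigenvector_def fcalc_mult_col[OF un that(1)] carrier_matD[OF H])
    then show ?thesis using that(2) unfolding S_def by blast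
  qed
  show ?thesis
  proof (rule antisym)
    interpret sp: submodule class_ring "span S" V by (rule span_is_submodule) (use Ssub in simp)
    show "{?P *\<^sub>v v | v. v \<in> carrier_vec N} \<subseteq> span S"
    proof
      fix x assume "x \<in> {?P *\<^sub>v v | v. v \<in> carrier_vec N}"
      then obtain v where v: "v \<in> carrier_vec N" "x = ?P *\<^sub>v v" by auto
      have comb: "vec N (\<lambda>i. \<Sum>k\<in>K. U $$ (i, k) * a k) \<in> span S"
        if "finite K" "K \<subseteq> {k. k < N \<and> ev k \<in> I}" for K a
        using that
      proof (induction K rule: finite_induct)
        case empty
        have "vec N (\<lambda>i. \<Sum>k\<in>{}. U $$ (i, k) * a k) = 0\<^sub>v N" by auto
        then show ?case using sp.zero_closed by (simp add: module_vec_simps)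
      next
        case (insert k K)
        have "vec N (\<lambda>i. \<Sum>k\<in>insert k K. U $$ (i, k) * a k)
            = a k \<cdot>\<^sub>v col U k + vec N (\<lambda>i. \<Sum>k\<in>K. U $$ (i, k) * a k)"
          using insert U by (intro eq_vecI) auto
        moreover have "col U k \<in> span S" using colS[of k] in_own_span[of S] Ssub insert.prems by auto
        ultimately show ?case
          using sp.m_closed[of "a k \<cdot>\<^sub>v col U k"] sp.smult_closed[of "a k" "col U k"] insert
          by (simp add: module_vec_simps class_ring_simps)
      qed
      have "x = vec N (\<lambda>i. \<Sum>k | k < N \<and> ev k \<in> I. U $$ (i, k) * (v \<bullet>c col U k))"
      proof (rule eq_vecI)
        fix i assume "i < dim_vec (vec N (\<lambda>i. \<Sum>k | k < N \<and> ev k \<in> I. U $$ (i, k) * (v \<bullet>c col U k)))"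
        then have i: "i < N" by simp
        show "x $ i = vec N (\<lambda>i. \<Sum>k | k < N \<and> ev k \<in> I. U $$ (i, k) * (v \<bullet>c col U k)) $ i"
          unfolding v(2) fcalc_mult_vec[OF U v(1) i] index_vec[OF i]
          by (rule sum.mono_neutral_cong_right) auto
      qed (simp add: v carrier_matD[OF P])
      then show "x \<in> span S" using comb[of "{k. k < N \<and> ev k \<in> I}"] by simp
    qed
  next
    show "span S \<subseteq> {?P *\<^sub>v v | v. v \<in> carrier_vec N}"
    proof (rule span_is_subset)
      show "S \<subseteq> {?P *\<^sub>v v | v. v \<in> carrier_vec N}"
      proof
        fix v assume "v \<in> S"
        then obtain e where e: "e \<in> I" "?H *\<^sub>v v = complex_of_real e \<cdot>\<^sub>v v"
          and v: "v \<in> carrier_vec N" using H by (auto simp: S_def eigenvector_def)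
        \<comment> \<open>Eigenvectors for different eigenvalues are orthogonal, so \<open>v\<close>
          has no component along the columns that the projector removes.\<close>
        have z: "v \<bullet>c col U k = 0" if k: "k < N" "ev k \<notin> I" for k
        proof -
          have "(?H *\<^sub>v v) \<bullet>c col U k = v \<bullet>c (?H *\<^sub>v col U k)"
            using adjoint_cscalar_prod[OF H v c[of k]] by (simp only: Hsa)
          then have "complex_of_real e * (v \<bullet>c col U k) = complex_of_real (ev k) * (v \<bullet>c col U k)"
            unfolding e(2) fcalc_mult_col[OF un k(1)] using v c[of k]
            by (simp add: conjugate_smult_vec)
          then show ?thesis using e(1) k(2) by auto
        qed
        have "?P *\<^sub>v v = fcalc N U (\<lambda>_. 1) *\<^sub>v v"
        proof (rule eq_vecI)
          fix i assume "i < dim_vec (fcalc N U (\<lambda>_. 1) *\<^sub>v v)"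
          then have i: "i < N" using carrier_matD[OF fcalc_carrier[OF U]] by simp
          show "(?P *\<^sub>v v) $ i = (fcalc N U (\<lambda>_. 1) *\<^sub>v v) $ i"
            unfolding fcalc_mult_vec[OF U v i] by (intro sum.cong refl) (auto simp: z)
        qed (simp add: carrier_matD[OF fcalc_carrier[OF U]])
        then have "v = ?P *\<^sub>v v" using v by (simp add: fcalc_one[OF un])
        then show "v \<in> {?P *\<^sub>v v | v. v \<in> carrier_vec N}" using v by blast
      qed
      show "submodule class_ring {?P *\<^sub>v v | v. v \<in> carrier_vec N} V"
      proof (rule submodule.intro)
        show "module class_ring V" by (rule vec_module)
        show "{?P *\<^sub>v v | v. v \<in> carrier_vec N} \<subseteq> carrier V"
          using P by (auto simp: module_vec_simps)
        fix v w assume "v \<in> {?P *\<^sub>v v | v. v \<in> carrier_vec N}" "w \<in> {?P *\<^sub>v v | v. v \<in> carrier_vec N}"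
        then obtain x y where "x \<in> carrier_vec N" "y \<in> carrier_vec N" "v = ?P *\<^sub>v x" "w = ?P *\<^sub>v y" by auto
        then have "v + w = ?P *\<^sub>v (x + y)" "x + y \<in> carrier_vec N"
          by (auto simp: mult_add_distrib_mat_vec[OF P])
        then show "v \<oplus>\<^bsub>V\<^esub> w \<in> {?P *\<^sub>v v | v. v \<in> carrier_vec N}" unfolding module_vec_simps by blast
      next
        have "0\<^sub>v N = ?P *\<^sub>v 0\<^sub>v N" using P by auto
        then show "\<zero>\<^bsub>V\<^esub> \<in> {?P *\<^sub>v v | v. v \<in> carrier_vec N}"
          unfolding module_vec_simps using zero_carrier_vec by blast
      next
        fix a v assume "v \<in> {?P *\<^sub>v v | v. v \<in> carrier_vec N}"
        then obtain x where "x \<in> carrier_vec N" "v = ?P *\<^sub>v x" by auto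
        then have "a \<cdot>\<^sub>v v = ?P *\<^sub>v (a \<cdot>\<^sub>v x)" "a \<cdot>\<^sub>v x \<in> carrier_vec N"
          by (auto simp: mult_mat_vec[OF P])
        then show "a \<odot>\<^bsub>V\<^esub> v \<in> {?P *\<^sub>v v | v. v \<in> carrier_vec N}" unfolding module_vec_simps by blast
      qed
    qed
  qed
qed

lemma energy_projector_fcalc:
  assumes un: "unitary N U"
  shows "energy_projector (fcalc N U (\<lambda>k. complex_of_real (ev k))) e \<delta>
    = fcalc N U (\<lambda>k. if ev k \<in> {e - \<delta><..e} then 1 else 0)"
proof -
  have U: "U \<in> carrier_mat N N" by (rule unitary_carrier[OF un])
  show ?thesis
    unfolding energy_projector_def carrier_matD[OF fcalc_carrier[OF U]]
  proof (rule orth_projector_eqI)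
    show "fcalc N U (\<lambda>k. if ev k \<in> {e - \<delta><..e} then 1 else 0) \<in> self_adjoint N"
      by (rule fcalc_self_adjoint[OF U]) auto
    show "fcalc N U (\<lambda>k. if ev k \<in> {e - \<delta><..e} then 1 else 0) * fcalc N U (\<lambda>k. if ev k \<in> {e - \<delta><..e} then 1 else 0)
      = fcalc N U (\<lambda>k. if ev k \<in> {e - \<delta><..e} then 1 else 0)"
      unfolding fcalc_mult[OF un] by (intro fcalc_cong) auto
  qed (rule spectral_subspace_span[OF un])
qed

lemma tr_energy_projector:
  assumes "unitary N U"
  shows "tr (energy_projector (fcalc N U (\<lambda>k. complex_of_real (ev k))) e \<delta>)
    = of_nat (card {k. k < N \<and> ev k \<in> {e - \<delta><..e}})"
proof -
  have "(\<Sum>k<N. if ev k \<in> {e - \<delta><..e} then 1 else (0::complex))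
      = (\<Sum>k | k < N \<and> ev k \<in> {e - \<delta><..e}. 1)"
    by (rule sum.mono_neutral_cong_right) auto
  then show ?thesis by (simp only: energy_projector_fcalc[OF assms] tr_fcalc[OF assms] sum_constant mult_1_right)
qed

lemma microcanonical_state_fcalc:
  assumes "unitary N U"
  shows "microcanonical_state (fcalc N U (\<lambda>k. complex_of_real (ev k))) e \<delta>
    = fcalc N U (\<lambda>k. complex_of_real ((if ev k \<in> {e - \<delta><..e} then 1 else 0)
        / real (card {k. k < N \<and> ev k \<in> {e - \<delta><..e}})))"
  unfolding microcanonical_state_def tr_energy_projector[OF assms]
  unfolding energy_projector_fcalc[OF assms] fcalc_smult[OF unitary_carrier[OF assms]]
  by (intro fcalc_cong) auto

subsection \<open>States diagonal in an orthonormal basis\<close>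

lemma pow_mat_carrier [simp]: "A \<in> carrier_mat n n \<Longrightarrow> A ^\<^sub>m m \<in> carrier_mat n n"
  by (rule pow_carrier_mat)

lemma pow_mat_add:
  assumes "A \<in> carrier_mat n n"
  shows "A ^\<^sub>m (a + b) = A ^\<^sub>m a * A ^\<^sub>m b"
proof (induction b)
  case 0
  then show ?case using assms pow_mat_carrier[OF assms, of a] by simp
next
  case (Suc b)
  then show ?case
    using assoc_mult_mat[OF pow_mat_carrier[OF assms, of a] pow_mat_carrier[OF assms, of b] assms] by simp
qed

lemma pow_mat_self_adjoint:
  assumes "A \<in> self_adjoint n"
  shows "A ^\<^sub>m m \<in> self_adjoint n"
proof -
  have A: "A \<in> carrier_mat n n" "mat_adjoint A = A" using assms by (auto simp: self_adjoint_def)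
  have "mat_adjoint (A ^\<^sub>m m) = A ^\<^sub>m m"
  proof (induction m)
    case 0
    have "1\<^sub>m n \<in> self_adjoint n" unfolding self_adjoint_iff by auto
    then show ?case using A by (simp add: self_adjoint_def)
  next
    case (Suc m)
    have "mat_adjoint (A ^\<^sub>m Suc m) = A * A ^\<^sub>m m"
      using adjoint_mult[OF pow_mat_carrier[OF A(1), of m] A(1)] Suc A(2) by simp
    also have "\<dots> = A ^\<^sub>m (1 + m)" unfolding pow_mat_add[OF A(1)] using A(1) by simp
    finally show ?case by simp
  qed
  then show ?thesis using A by (simp add: self_adjoint_def)
qed

lemma cscalar_prod_commute:
  fixes v w :: "complex vec"
  assumes "v \<in> carrier_vec n" "w \<in> carrier_vec n"
  shows "v \<bullet>c w = cnj (w \<bullet>c v)"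
  unfolding cscalar_prod_sum[OF assms(1)] cscalar_prod_sum[OF assms(2)] cnj_sum
  by (simp add: mult.commute)

lemma self_adjoint_expectation_real:
  assumes "Y \<in> self_adjoint N" "v \<in> carrier_vec N"
  shows "(Y *\<^sub>v v) \<bullet>c v = complex_of_real (Re ((Y *\<^sub>v v) \<bullet>c v))"
proof -
  have Y: "Y \<in> carrier_mat N N" "mat_adjoint Y = Y" using assms by (auto simp: self_adjoint_def)
  have Yv: "Y *\<^sub>v v \<in> carrier_vec N" using Y assms by simp
  have "(Y *\<^sub>v v) \<bullet>c v = v \<bullet>c (Y *\<^sub>v v)"
    using adjoint_cscalar_prod[OF Y(1) assms(2,2)] unfolding Y(2) .
  also have "\<dots> = cnj ((Y *\<^sub>v v) \<bullet>c v)" by (rule cscalar_prod_commute[OF assms(2) Yv])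
  finally have "Im ((Y *\<^sub>v v) \<bullet>c v) = 0" by (metis Reals_cnj_iff complex_is_Real_iff)
  then show ?thesis by (simp add: complex_eq_iff)
qed

lemma self_adjoint_square_expectation:
  assumes "Y \<in> self_adjoint N" "v \<in> carrier_vec N"
  shows "((Y * Y) *\<^sub>v v) \<bullet>c v = complex_of_real ((vnorm (Y *\<^sub>v v))\<^sup>2)"
proof -
  have Y: "Y \<in> carrier_mat N N" "mat_adjoint Y = Y" using assms by (auto simp: self_adjoint_def)
  have Yv: "Y *\<^sub>v v \<in> carrier_vec N" using Y assms by simp
  have "((Y * Y) *\<^sub>v v) \<bullet>c v = (Y *\<^sub>v (Y *\<^sub>v v)) \<bullet>c v"
    using assoc_mult_mat_vec[OF Y(1,1) assms(2)] by simp
  also have "\<dots> = (Y *\<^sub>v v) \<bullet>c (Y *\<^sub>v v)"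
    using adjoint_cscalar_prod[OF Y(1) Yv assms(2)] unfolding Y(2) .
  finally show ?thesis by (simp only: cscalar_prod_self)
qed

text \<open>A density matrix given with an eigenbasis: the weights \<open>p\<close> form a
  probability distribution. The Gibbs and the microcanonical state become two instances with the
  same \<open>U\<close>.\<close>

locale diagonal_state =
  fixes N :: nat and U :: "complex mat" and p :: "nat \<Rightarrow> real"
  assumes unitary: "unitary N U"
    and nonneg: "k < N \<Longrightarrow> p k \<ge> 0"
    and sum_one: "(\<Sum>k<N. p k) = 1"
begin

definition state :: "complex mat" where
  "state = fcalc N U (\<lambda>k. complex_of_real (p k))"

lemma U_carrier: "U \<in> carrier_mat N N"
  by (rule unitary_carrier[OF unitary])

lemma state_carrier: "state \<in> carrier_mat N N"
  unfolding state_def by (rule fcalc_carrier[OF U_carrier])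

lemma col_carrier: "col U k \<in> carrier_vec N"
  by (metis U_carrier col_dim carrier_matD(1))

lemma tr_state: "tr state = 1"
  unfolding state_def tr_fcalc[OF unitary] using sum_one by (simp flip: of_real_sum)

lemma dim_pos: "N > 0"
  using sum_one by (cases N) auto

lemma expectation_le_op_norm:
  assumes X: "X \<in> carrier_mat N N"
  shows "cmod (tr (state * X)) \<le> op_norm X"
proof -
  have "cmod (tr (state * X)) \<le> (\<Sum>k<N. cmod (complex_of_real (p k) * ((X *\<^sub>v col U k) \<bullet>c col U k)))"
    unfolding state_def tr_fcalc_mult[OF unitary X] by (rule norm_sum)
  also have "\<dots> \<le> (\<Sum>k<N. p k * op_norm X)"
  proof (rule sum_mono)
    fix k assume k: "k \<in> {..<N}"
    have "cmod ((X *\<^sub>v col U k) \<bullet>c col U k) \<le> vnorm (X *\<^sub>v col U k) * vnorm (col U k)"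
      by (rule Cauchy_Schwarz_vnorm[of _ N]) (use X col_carrier in auto)
    also have "\<dots> \<le> op_norm X"
      using vnorm_mult_vec_le[OF X col_carrier[of k]] unitary_col_vnorm[OF unitary, of k] k by simp
    finally show "cmod (complex_of_real (p k) * ((X *\<^sub>v col U k) \<bullet>c col U k)) \<le> p k * op_norm X"
      using nonneg[of k] k by (simp add: norm_mult mult_left_mono)
  qed
  also have "\<dots> = op_norm X" using sum_one by (simp flip: sum_distrib_right)
  finally show ?thesis .
qed

lemma tr_self_adjoint:
  assumes "Y \<in> self_adjoint N"
  shows "tr (state * Y) = complex_of_real (\<Sum>k<N. p k * Re ((Y *\<^sub>v col U k) \<bullet>c col U k))"
proof -
  have Y: "Y \<in> carrier_mat N N" using assms by (simp add: self_adjoint_def)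
  have "tr (state * Y) = (\<Sum>k<N. complex_of_real (p k) * complex_of_real (Re ((Y *\<^sub>v col U k) \<bullet>c col U k)))"
    unfolding state_def tr_fcalc_mult[OF unitary Y]
    by (intro sum.cong refl arg_cong2[of _ _ _ _ "(*)"] self_adjoint_expectation_real[OF assms col_carrier])
  then show ?thesis by simp
qed

text \<open>The expectation of a square is an average of nonnegative numbers. This is what allows
  the weights of one state to be replaced by larger multiples of those of another.\<close>

lemma tr_square:
  assumes "Y \<in> self_adjoint N"
  shows "tr (state * (Y * Y)) = complex_of_real (\<Sum>k<N. p k * (vnorm (Y *\<^sub>v col U k))\<^sup>2)"
proof -
  have Y: "Y \<in> carrier_mat N N" using assms by (simp add: self_adjoint_def)
  have "tr (state * (Y * Y)) = (\<Sum>k<N. complex_of_real (p k) * complex_of_real ((vnorm (Y *\<^sub>v col U k))\<^sup>2))"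
    unfolding state_def tr_fcalc_mult[OF unitary mult_carrier_mat[OF Y Y]]
    by (intro sum.cong refl arg_cong2[of _ _ _ _ "(*)"] self_adjoint_square_expectation[OF assms col_carrier])
  then show ?thesis by (simp only: of_real_mult of_real_sum)
qed

text \<open>Nonnegativity of the variance of the diagonal values <Y u, u> under the weights
  \<open>p\<close>, followed by Cauchy-Schwarz: the square of <Y u, u> is at most |Y u|^2 for a unit
  vector u.\<close>

lemma expectation_Jensen:
  assumes "Y \<in> self_adjoint N"
  shows "(Re (tr (state * Y)))\<^sup>2 \<le> Re (tr (state * (Y * Y)))"
proof -
  have Y: "Y \<in> carrier_mat N N" using assms by (simp add: self_adjoint_def)
  define y where "y k = Re ((Y *\<^sub>v col U k) \<bullet>c col U k)" for k
  define \<mu> where "\<mu> = (\<Sum>k<N. p k * y k)"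
  have le: "(y k)\<^sup>2 \<le> (vnorm (Y *\<^sub>v col U k))\<^sup>2" if "k < N" for k
  proof -
    have "\<bar>y k\<bar> \<le> cmod ((Y *\<^sub>v col U k) \<bullet>c col U k)" unfolding y_def by (rule abs_Re_le_cmod)
    also have "\<dots> \<le> vnorm (Y *\<^sub>v col U k) * vnorm (col U k)"
      by (rule Cauchy_Schwarz_vnorm[of _ N]) (use Y col_carrier in auto)
    also have "\<dots> = vnorm (Y *\<^sub>v col U k)" using unitary_col_vnorm[OF unitary that] by simp
    finally show ?thesis by (metis abs_le_square_iff abs_of_nonneg vnorm_nonneg)
  qed
  have "0 \<le> (\<Sum>k<N. p k * (y k - \<mu>)\<^sup>2)" using nonneg by (intro sum_nonneg) auto
  also have "\<dots> = (\<Sum>k<N. p k * (y k)\<^sup>2) - 2 * \<mu> * (\<Sum>k<N. p k * y k) + \<mu>\<^sup>2 * (\<Sum>k<N. p k)"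
    unfolding sum_distrib_left sum_subtractf[symmetric] sum.distrib[symmetric]
    by (intro sum.cong refl) (simp add: power2_eq_square algebra_simps)
  also have "\<dots> = (\<Sum>k<N. p k * (y k)\<^sup>2) - \<mu>\<^sup>2"
    using sum_one by (simp add: \<mu>_def power2_eq_square)
  finally have "\<mu>\<^sup>2 \<le> (\<Sum>k<N. p k * (y k)\<^sup>2)" by simp
  also have "\<dots> \<le> (\<Sum>k<N. p k * (vnorm (Y *\<^sub>v col U k))\<^sup>2)"
    using le nonneg by (intro sum_mono mult_left_mono) auto
  finally show ?thesis unfolding tr_self_adjoint[OF assms] tr_square[OF assms] \<mu>_def y_def by simp
qed

text \<open>Each application of \<open>expectation_Jensen\<close> squares the observable, which
  explains the exponents \<open>2 ^ s\<close>; \<open>X\<close> itself never has to be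
  diagonalized.\<close>

lemma moment_le:
  assumes "X \<in> self_adjoint N"
  shows "\<bar>Re (tr (state * X))\<bar> ^ 2 ^ s \<le> \<bar>Re (tr (state * X ^\<^sub>m (2 ^ s)))\<bar>"
proof (induction s)
  case 0
  have "X \<in> carrier_mat N N" using assms by (simp add: self_adjoint_def)
  then show ?case by simp
next
  case (Suc s)
  have X: "X \<in> carrier_mat N N" using assms by (simp add: self_adjoint_def)
  have "\<bar>Re (tr (state * X))\<bar> ^ 2 ^ Suc s = (\<bar>Re (tr (state * X))\<bar> ^ 2 ^ s)\<^sup>2"
    by (simp add: power_mult[symmetric] mult.commute)
  also have "\<dots> \<le> (Re (tr (state * X ^\<^sub>m (2 ^ s))))\<^sup>2"
    using power_mono[OF Suc, of 2] by simp
  also have "\<dots> \<le> Re (tr (state * (X ^\<^sub>m (2 ^ s) * X ^\<^sub>m (2 ^ s))))"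
    by (rule expectation_Jensen[OF pow_mat_self_adjoint[OF assms]])
  also have "X ^\<^sub>m (2 ^ s) * X ^\<^sub>m (2 ^ s) = X ^\<^sub>m (2 ^ Suc s)"
    using pow_mat_add[OF X, of "2 ^ s" "2 ^ s"] by (simp add: mult_2)
  finally show ?case by linarith
qed

end

text \<open>The weights are exchanged only at the last squaring, where the moment is an average of
  squared norms. Hence \<open>M\<close> enters once, outside the power, and its root of order
  \<open>2 ^ Suc s\<close> is what finally counts. Writing \<open>Suc s\<close> makes the order
  even.\<close>

lemma dominated_state_moment:
  assumes p: "diagonal_state N U p" and m: "diagonal_state N U m"
    and dom: "\<And>k. k < N \<Longrightarrow> m k \<le> M * p k"
    and X: "X \<in> self_adjoint N"
  shows "\<bar>Re (tr (diagonal_state.state N U m * X))\<bar> ^ 2 ^ Suc s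
    \<le> M * cmod (tr (diagonal_state.state N U p * X ^\<^sub>m (2 ^ Suc s)))"
proof -
  interpret P: diagonal_state N U p by (rule p)
  interpret Q: diagonal_state N U m by (rule m)
  let ?nn = "\<lambda>w. \<Sum>k<N. w k * (vnorm (X ^\<^sub>m (2 ^ s) *\<^sub>v col U k))\<^sup>2"
  have nn: "?nn m \<ge> 0" "?nn p \<ge> 0"
    using P.nonneg Q.nonneg by (auto intro!: sum_nonneg mult_nonneg_nonneg)
  have Xc: "X \<in> carrier_mat N N" using X by (simp add: self_adjoint_def)
  let ?Y = "X ^\<^sub>m (2 ^ s)"
  have Y: "?Y \<in> self_adjoint N" by (rule pow_mat_self_adjoint[OF X])
  have YY: "X ^\<^sub>m (2 ^ Suc s) = ?Y * ?Y"
    using pow_mat_add[OF Xc, of "2 ^ s" "2 ^ s"] by (simp add: mult_2)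
  have "\<bar>Re (tr (Q.state * X))\<bar> ^ 2 ^ Suc s \<le> \<bar>Re (tr (Q.state * (?Y * ?Y)))\<bar>"
    using Q.moment_le[OF X, of "Suc s"] unfolding YY .
  also have "\<dots> = (\<Sum>k<N. m k * (vnorm (?Y *\<^sub>v col U k))\<^sup>2)"
    unfolding Q.tr_square[OF Y] Re_complex_of_real by (rule abs_of_nonneg[OF nn(1)])
  also have "\<dots> \<le> (\<Sum>k<N. M * p k * (vnorm (?Y *\<^sub>v col U k))\<^sup>2)"
    using dom by (intro sum_mono mult_right_mono) auto
  also have "\<dots> = M * (\<Sum>k<N. p k * (vnorm (?Y *\<^sub>v col U k))\<^sup>2)"
    by (simp add: sum_distrib_left mult.assoc)
  also have "\<dots> = M * cmod (tr (P.state * (?Y * ?Y)))"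
    unfolding P.tr_square[OF Y] norm_of_real abs_of_nonneg[OF nn(2)] ..
  finally show ?thesis unfolding YY .
qed

subsection \<open>Domination of the microcanonical state\<close>

lemma sum_UN_le:
  fixes f :: "'a \<Rightarrow> real"
  assumes "finite I" "\<And>i. i \<in> I \<Longrightarrow> finite (B i)" "\<And>x. f x \<ge> 0"
  shows "sum f (\<Union>i\<in>I. B i) \<le> (\<Sum>i\<in>I. sum f (B i))"
  using assms(1,2)
proof (induction I rule: finite_induct)
  case (insert i I)
  have "sum f (B i \<union> (\<Union>i\<in>I. B i)) \<le> sum f (B i) + sum f (\<Union>i\<in>I. B i)"
    using sum.union_inter[of "B i" "\<Union>i\<in>I. B i" f] insert
      sum_nonneg[of "B i \<inter> (\<Union>i\<in>I. B i)" f] assms(3) by force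
  then show ?case using insert by force
qed simp

lemma partition_function_le:
  fixes ev :: "nat \<Rightarrow> real" and \<beta> :: real and N :: nat
  defines "W \<equiv> \<lambda>\<delta> e. exp (- \<beta> * e) * real (card {k. k < N \<and> ev k \<in> {e - \<delta><..e}})"
  assumes "N > 0" "\<beta> > 0" "\<delta> > 0" and opt: "\<And>e. W \<delta> e \<le> W \<delta> E"
  shows "(\<Sum>k<N. exp (- \<beta> * ev k)) \<le> 2 * (ln (2 * real N) / \<beta> / \<delta> + 2) * exp (\<beta> * \<delta>) * W \<delta> E"
proof -
  \<comment> \<open>Chosen so that exp (- \<beta> T) = 1 / (2 N): the at most N eigenvalues above a
    + T together weigh at most half of the ground state term exp (- \<beta> a), which is itself at
    most \<open>Z\<close>.\<close>
  define T where "T = ln (2 * real N) / \<beta>"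
  have T: "T \<ge> 0" using \<open>N > 0\<close> \<open>\<beta> > 0\<close> by (simp add: T_def)
  define a where "a = Min (ev ` {..<N})"
  define Z where "Z = (\<Sum>k<N. exp (- \<beta> * ev k))"
  have a_le: "a \<le> ev k" if "k < N" for k using that by (simp add: a_def)
  have "a \<in> ev ` {..<N}" unfolding a_def using \<open>N > 0\<close> by (intro Min_in) auto
  then obtain k0 where k0: "k0 < N" "ev k0 = a" by auto
  have "exp (- \<beta> * ev k0) \<le> Z" unfolding Z_def using k0 by (intro member_le_sum) auto
  then have Za: "exp (- \<beta> * a) \<le> Z" by (simp add: k0)
  let ?low = "{k. k < N \<and> ev k \<le> a + T}" and ?high = "{k. k < N \<and> ev k > a + T}"
  have "(\<Sum>k\<in>?high. exp (- \<beta> * ev k)) \<le> (\<Sum>k\<in>?high. exp (- \<beta> * (a + T)))"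
    using \<open>\<beta> > 0\<close> by (intro sum_mono) auto
  also have "\<dots> \<le> real N * exp (- \<beta> * (a + T))"
  proof -
    have "card ?high \<le> card {..<N}" by (rule card_mono) auto
    then show ?thesis by simp
  qed
  also have "\<dots> = exp (- \<beta> * a) / 2"
  proof -
    have "exp (- \<beta> * (a + T)) = exp (- \<beta> * a) * exp (- (\<beta> * T))"
      by (simp add: exp_add[symmetric] algebra_simps)
    also have "\<beta> * T = ln (2 * real N)" using \<open>\<beta> > 0\<close> by (simp add: T_def)
    also have "exp (- ln (2 * real N)) = 1 / (2 * real N)"
      using \<open>N > 0\<close> by (simp add: exp_minus inverse_eq_divide)
    finally show ?thesis using \<open>N > 0\<close> by simp
  qed
  finally have high: "(\<Sum>k\<in>?high. exp (- \<beta> * ev k)) \<le> Z / 2" using Za by simp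
  have "Z = (\<Sum>k\<in>?low \<union> ?high. exp (- \<beta> * ev k))" unfolding Z_def by (intro sum.cong) auto
  also have "\<dots> = (\<Sum>k\<in>?low. exp (- \<beta> * ev k)) + (\<Sum>k\<in>?high. exp (- \<beta> * ev k))"
    by (rule sum.union_disjoint) auto
  finally have low: "Z \<le> 2 * (\<Sum>k\<in>?low. exp (- \<beta> * ev k))" using high by linarith
  define J where "J = nat \<lceil>T / \<delta>\<rceil>"
  \<comment> \<open>Windows are open on the left, so the lowest eigenvalue a lies in the one with j
    = 0. The indices 0 to J make J + 1 windows, and rounding up adds another one: this is the
    summand 2 in the bound.\<close>
  define win where "win j = {k. k < N \<and> ev k \<in> {a + real j * \<delta> - \<delta><..a + real j * \<delta>}}" for j
  have cover: "?low \<subseteq> (\<Union>j\<le>J. win j)"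
  proof
    fix k assume k: "k \<in> ?low"
    define x where "x = (ev k - a) / \<delta>"
    have x: "0 \<le> x" "x \<le> T / \<delta>" using k a_le[of k] \<open>\<delta> > 0\<close> by (auto simp: x_def divide_right_mono)
    have evx: "ev k = a + x * \<delta>" using \<open>\<delta> > 0\<close> by (simp add: x_def)
    define j where "j = nat \<lceil>x\<rceil>"
    have j: "real j = of_int \<lceil>x\<rceil>" using x by (simp add: j_def)
    have "x \<le> real j" "real j < x + 1" unfolding j by linarith+
    then have "x * \<delta> \<le> real j * \<delta>" "real j * \<delta> < (x + 1) * \<delta>" using \<open>\<delta> > 0\<close> by simp_all
    then have "k \<in> win j" using k unfolding win_def evx by (auto simp: algebra_simps evx)
    moreover have "j \<le> J" unfolding j_def J_def using x by (intro nat_mono ceiling_mono)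
    ultimately show "k \<in> (\<Union>j\<le>J. win j)" by blast
  qed
  have fin: "finite (win j)" for j by (simp add: win_def)
  have "(\<Sum>k\<in>?low. exp (- \<beta> * ev k)) \<le> (\<Sum>k\<in>(\<Union>j\<le>J. win j). exp (- \<beta> * ev k))"
    using cover fin by (intro sum_mono2) auto
  also have "\<dots> \<le> (\<Sum>j\<le>J. \<Sum>k\<in>win j. exp (- \<beta> * ev k))"
    using fin by (intro sum_UN_le) auto
  also have "\<dots> \<le> (\<Sum>j\<le>J. exp (\<beta> * \<delta>) * W \<delta> E)"
  proof (rule sum_mono)
    fix j assume "j \<in> {..J}"
    \<comment> \<open>Inside a window the Boltzmann factor exceeds its value at the upper end by at
      most exp (\<beta> \<delta>), the origin of that constant.\<close>
    have "(\<Sum>k\<in>win j. exp (- \<beta> * ev k)) \<le> (\<Sum>k\<in>win j. exp (- \<beta> * (a + real j * \<delta> - \<delta>)))"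
      using \<open>\<beta> > 0\<close> by (intro sum_mono) (auto simp: win_def)
    also have "\<dots> = exp (\<beta> * \<delta>) * W \<delta> (a + real j * \<delta>)"
      by (simp add: W_def win_def exp_add[symmetric] algebra_simps mult_exp_exp)
    also have "\<dots> \<le> exp (\<beta> * \<delta>) * W \<delta> E" using opt by simp
    finally show "(\<Sum>k\<in>win j. exp (- \<beta> * ev k)) \<le> exp (\<beta> * \<delta>) * W \<delta> E" .
  qed
  also have "\<dots> = (real J + 1) * (exp (\<beta> * \<delta>) * W \<delta> E)" by simp
  also have "\<dots> \<le> (T / \<delta> + 2) * (exp (\<beta> * \<delta>) * W \<delta> E)"
  proof (rule mult_right_mono)
    have "real J = of_int \<lceil>T / \<delta>\<rceil>" using T \<open>\<delta> > 0\<close> by (simp add: J_def)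
    then show "real J + 1 \<le> T / \<delta> + 2" by linarith
  qed (simp add: W_def)
  finally have "Z \<le> 2 * ((T / \<delta> + 2) * (exp (\<beta> * \<delta>) * W \<delta> E))" using low by linarith
  then show ?thesis unfolding Z_def T_def by (simp only: mult.assoc)
qed

subsection \<open>Observables on a set of spins\<close>

lemma spin_less: "q > 0 \<Longrightarrow> spin q x i < q"
  by (simp add: spin_def)

lemma spin_add_mult:
  assumes "1 \<le> x" "x \<le> n"
  shows "spin q x (i + c * q ^ n) = spin q x i"
proof (cases "q = 0")
  case False
  have "(x - 1) + Suc (n - x) = n" using assms by simp
  then have "q ^ n = q ^ (x - 1) * q ^ Suc (n - x)" by (metis power_add)
  then have "c * q ^ n = (c * q ^ (n - x) * q) * q ^ (x - 1)" by (simp add: mult_ac)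
  then have "(i + c * q ^ n) div q ^ (x - 1) = c * q ^ (n - x) * q + i div q ^ (x - 1)"
    using False by (simp only: div_mult_self1 power_not_zero not_False_eq_True)
  then show ?thesis by (simp add: spin_def)
qed (use assms in \<open>auto simp: spin_def zero_power\<close>)

lemma spin_top:
  assumes "i < q ^ n" "c < q"
  shows "spin q (Suc n) (i + c * q ^ n) = c"
  using assms by (simp add: spin_def)

text \<open>With \<open>spin_inject\<close> this identifies the indices below \<open>q ^ n\<close>
  with spin configurations: configurations can be prescribed freely, and indices are equal if they
  agree spin by spin.\<close>

lemma spin_exists:
  assumes "\<And>x. x \<in> {1..n} \<Longrightarrow> s x < q"
  shows "\<exists>i<q ^ n. \<forall>x\<in>{1..n}. spin q x i = s x"
  using assms
proof (induction n)
  case (Suc n)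
  then obtain i where i: "i < q ^ n" "\<forall>x\<in>{1..n}. spin q x i = s x" by fastforce
  have c: "s (Suc n) < q" using Suc.prems by simp
  let ?i = "i + s (Suc n) * q ^ n"
  have "?i < q ^ n + s (Suc n) * q ^ n" using i by simp
  also have "\<dots> = Suc (s (Suc n)) * q ^ n" by simp
  also have "\<dots> \<le> q * q ^ n" using c by (intro mult_right_mono) auto
  finally have "?i < q ^ Suc n" by simp
  moreover have "spin q x ?i = s x" if "x \<in> {1..Suc n}" for x
    using that i spin_add_mult[of x n q i] spin_top[OF i(1) c] by (cases "x = Suc n") auto
  ultimately show ?case by blast
qed simp

lemma spin_inject:
  assumes "i < q ^ n" "j < q ^ n" "\<And>x. x \<in> {1..n} \<Longrightarrow> spin q x i = spin q x j"
  shows "i = j"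
  using assms
proof (induction n arbitrary: i j)
  case (Suc n)
  have q: "q > 0" using Suc.prems(1) by (cases q) auto
  have dec: "k = k mod q ^ n + spin q (Suc n) k * q ^ n" if "k < q ^ Suc n" for k
  proof -
    have "k div q ^ n < q" using that q by (simp add: less_mult_imp_div_less)
    then have "spin q (Suc n) k = k div q ^ n" by (simp add: spin_def)
    then show ?thesis by (simp only: mod_div_mult_eq)
  qed
  have sp: "spin q x (k mod q ^ n) = spin q x k" if "k < q ^ Suc n" "x \<in> {1..n}" for k x
    using dec[OF that(1)] spin_add_mult[of x n q "k mod q ^ n" "spin q (Suc n) k"] that(2) by simp
  have "i mod q ^ n = j mod q ^ n"
  proof (rule Suc.IH)
    fix x assume x: "x \<in> {1..n}"
    then show "spin q x (i mod q ^ n) = spin q x (j mod q ^ n)"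
      using sp[OF Suc.prems(1) x] sp[OF Suc.prems(2) x] Suc.prems(3)[of x] by simp
  qed (use q in auto)
  then show ?case using dec[OF Suc.prems(1)] dec[OF Suc.prems(2)] Suc.prems(3)[of "Suc n"] by simp
qed simp

definition agree :: "nat \<Rightarrow> nat set \<Rightarrow> nat \<Rightarrow> nat \<Rightarrow> bool" where
  "agree q \<Lambda> i j \<longleftrightarrow> (\<forall>x\<in>\<Lambda>. spin q x i = spin q x j)"

text \<open>A new largest spin becomes the most significant digit. Adding the spins of a region in
  increasing order therefore exhibits \<open>sub_index\<close> as a base-q numeral.\<close>

lemma sub_index_insert_Max:
  assumes "finite \<Lambda>" "\<forall>a\<in>\<Lambda>. a < b"
  shows "sub_index q (insert b \<Lambda>) i = sub_index q \<Lambda> i + spin q b i * q ^ card \<Lambda>"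
proof -
  have "b \<notin> \<Lambda>" using assms by auto
  moreover have "{y \<in> insert b \<Lambda>. y < b} = \<Lambda>" using assms by auto
  moreover have "{y \<in> insert b \<Lambda>. y < x} = {y \<in> \<Lambda>. y < x}" if "x \<in> \<Lambda>" for x
    using assms that by auto
  ultimately show ?thesis
    unfolding sub_index_def using assms(1) by (simp add: add.commute cong: sum.cong)
qed

lemma sub_index_less:
  assumes "finite \<Lambda>" "q > 0"
  shows "sub_index q \<Lambda> i < q ^ card \<Lambda>"
  using assms(1)
proof (induction \<Lambda> rule: finite_linorder_max_induct)
  case empty
  then show ?case by (simp add: sub_index_def)
next
  case (insert b \<Lambda>)
  have "sub_index q \<Lambda> i + spin q b i * q ^ card \<Lambda> < Suc (spin q b i) * q ^ card \<Lambda>"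
    using insert by simp
  also have "\<dots> \<le> q * q ^ card \<Lambda>" using spin_less[OF assms(2), of b i] by (intro mult_right_mono) auto
  finally show ?case using insert sub_index_insert_Max[OF insert(1), of b q i]
    by (auto simp: card_insert_if)
qed

lemma sub_index_eq_iff:
  assumes "finite \<Lambda>" "q > 0"
  shows "sub_index q \<Lambda> i = sub_index q \<Lambda> j \<longleftrightarrow> agree q \<Lambda> i j"
  using assms(1)
proof (induction \<Lambda> rule: finite_linorder_max_induct)
  case empty
  then show ?case by (simp add: sub_index_def agree_def)
next
  case (insert b \<Lambda>)
  note l = sub_index_less[OF insert(1) assms(2)]
  have "sub_index q (insert b \<Lambda>) k mod q ^ card \<Lambda> = sub_index q \<Lambda> k"
    "sub_index q (insert b \<Lambda>) k div q ^ card \<Lambda> = spin q b k" for k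
    unfolding sub_index_insert_Max[OF insert(1,2)] using l[of k] assms(2) by auto
  then have "sub_index q (insert b \<Lambda>) i = sub_index q (insert b \<Lambda>) j
      \<longleftrightarrow> sub_index q \<Lambda> i = sub_index q \<Lambda> j \<and> spin q b i = spin q b j"
    by (metis sub_index_insert_Max[OF insert(1,2)])
  then show ?case using insert.IH by (auto simp: agree_def)
qed

text \<open>The matrices of the form \<open>g \<otimes> 1\<close> with \<open>g\<close> acting on the spins in \<open>\<Lambda>\<close>, characterised by their
  entries; unlike \<^const>\<open>observables\<close> this algebra is closed under products.\<close>

definition acts_on :: "nat \<Rightarrow> nat \<Rightarrow> nat set \<Rightarrow> complex mat set" where
  "acts_on q n \<Lambda> = {X \<in> carrier_mat (q ^ n) (q ^ n).
     (\<forall>i<q ^ n. \<forall>j<q ^ n. \<not> agree q ({1..n} - \<Lambda>) i j \<longrightarrow> X $$ (i, j) = 0) \<and>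
     (\<forall>i<q ^ n. \<forall>j<q ^ n. \<forall>i'<q ^ n. \<forall>j'<q ^ n.
        agree q ({1..n} - \<Lambda>) i j \<longrightarrow> agree q ({1..n} - \<Lambda>) i' j' \<longrightarrow>
        agree q \<Lambda> i i' \<longrightarrow> agree q \<Lambda> j j' \<longrightarrow> X $$ (i, j) = X $$ (i', j'))}"

lemma acts_onI:
  assumes "X \<in> carrier_mat (q ^ n) (q ^ n)"
    and "\<And>i j. i < q ^ n \<Longrightarrow> j < q ^ n \<Longrightarrow> \<not> agree q ({1..n} - \<Lambda>) i j \<Longrightarrow> X $$ (i, j) = 0"
    and "\<And>i j i' j'. i < q ^ n \<Longrightarrow> j < q ^ n \<Longrightarrow> i' < q ^ n \<Longrightarrow> j' < q ^ n \<Longrightarrow>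
        agree q ({1..n} - \<Lambda>) i j \<Longrightarrow> agree q ({1..n} - \<Lambda>) i' j' \<Longrightarrow>
        agree q \<Lambda> i i' \<Longrightarrow> agree q \<Lambda> j j' \<Longrightarrow> X $$ (i, j) = X $$ (i', j')"
  shows "X \<in> acts_on q n \<Lambda>"
  using assms unfolding acts_on_def by blast

lemma acts_onD:
  assumes "X \<in> acts_on q n \<Lambda>"
  shows "X \<in> carrier_mat (q ^ n) (q ^ n)"
    and "\<And>i j. i < q ^ n \<Longrightarrow> j < q ^ n \<Longrightarrow> \<not> agree q ({1..n} - \<Lambda>) i j \<Longrightarrow> X $$ (i, j) = 0"
    and "\<And>i j i' j'. i < q ^ n \<Longrightarrow> j < q ^ n \<Longrightarrow> i' < q ^ n \<Longrightarrow> j' < q ^ n \<Longrightarrow>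
        agree q ({1..n} - \<Lambda>) i j \<Longrightarrow> agree q ({1..n} - \<Lambda>) i' j' \<Longrightarrow>
        agree q \<Lambda> i i' \<Longrightarrow> agree q \<Lambda> j j' \<Longrightarrow> X $$ (i, j) = X $$ (i', j')"
  using assms unfolding acts_on_def by blast+

lemma observables_acts_on:
  assumes "\<Lambda> \<subseteq> {1..n}" "q > 0" "h \<in> observables q n \<Lambda>"
  shows "h \<in> acts_on q n \<Lambda>" "h \<in> self_adjoint (q ^ n)"
proof -
  have fin: "finite \<Lambda>" using assms(1) finite_subset by blast
  obtain g where g: "g \<in> self_adjoint (q ^ card \<Lambda>)" "h = tensor_id q n \<Lambda> g"
    using assms(3) by (auto simp: observables_def)
  have e: "h $$ (i, j) = (if agree q ({1..n} - \<Lambda>) i j then g $$ (sub_index q \<Lambda> i, sub_index q \<Lambda> j) else 0)"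
    if "i < q ^ n" "j < q ^ n" for i j
    using that by (simp add: g(2) tensor_id_def agree_def)
  have c: "h \<in> carrier_mat (q ^ n) (q ^ n)" by (simp add: g(2) tensor_id_def)
  show "h \<in> acts_on q n \<Lambda>"
  proof (rule acts_onI[OF c])
    fix i j i' j' assume a: "i < q ^ n" "j < q ^ n" "i' < q ^ n" "j' < q ^ n"
      "agree q ({1..n} - \<Lambda>) i j" "agree q ({1..n} - \<Lambda>) i' j'" "agree q \<Lambda> i i'" "agree q \<Lambda> j j'"
    then have "sub_index q \<Lambda> i = sub_index q \<Lambda> i'" "sub_index q \<Lambda> j = sub_index q \<Lambda> j'"
      by (simp_all add: sub_index_eq_iff[OF fin assms(2)])
    then show "h $$ (i, j) = h $$ (i', j')" using a by (simp add: e)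
  qed (simp add: e)
  show "h \<in> self_adjoint (q ^ n)"
    unfolding self_adjoint_iff
  proof (intro conjI allI impI c)
    fix i j assume a: "i < q ^ n" "j < q ^ n"
    have "g $$ (sub_index q \<Lambda> i, sub_index q \<Lambda> j) = cnj (g $$ (sub_index q \<Lambda> j, sub_index q \<Lambda> i))"
      using g(1) sub_index_less[OF fin assms(2)] unfolding self_adjoint_iff by blast
    moreover have "agree q ({1..n} - \<Lambda>) i j \<longleftrightarrow> agree q ({1..n} - \<Lambda>) j i"
      by (auto simp: agree_def)
    ultimately show "h $$ (i, j) = cnj (h $$ (j, i))" using a by (simp add: e)
  qed
qed

text \<open>Converse of \<open>observables_acts_on\<close>. The local matrix is read off from
  \<open>X\<close>: its entry (a, b) is the entry of \<open>X\<close> at any index pair that agrees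
  outside \<Lambda> and restricts to a and b, and the last clause of \<open>acts_on\<close> makes
  the choice irrelevant.\<close>

lemma acts_on_observables:
  assumes "\<Lambda> \<subseteq> {1..n}" "q > 0" "X \<in> acts_on q n \<Lambda>" "X \<in> self_adjoint (q ^ n)"
  shows "X \<in> observables q n \<Lambda>"
proof -
  have fin: "finite \<Lambda>" using assms(1) finite_subset by blast
  note X = acts_onD[OF assms(3)]
  define P where "P a b ij \<longleftrightarrow> fst ij < q ^ n \<and> snd ij < q ^ n \<and> agree q ({1..n} - \<Lambda>) (fst ij) (snd ij) \<and>
    sub_index q \<Lambda> (fst ij) = a \<and> sub_index q \<Lambda> (snd ij) = b" for a b and ij :: "nat \<times> nat"
  \<comment> \<open>The default 0 spares a proof that every pair (a, b) comes from some pair of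
    configurations; the cases without such a pair never occur in \<open>tensor_id\<close>.\<close>
  define c where "c a b = (if \<exists>ij. P a b ij then X $$ (SOME ij. P a b ij) else 0)" for a b
  have cI: "c a b = X $$ ij" if "P a b ij" for a b ij
  proof -
    define ij' where "ij' = (SOME ij. P a b ij)"
    have P': "P a b ij'" unfolding ij'_def using that by (rule someI)
    have "sub_index q \<Lambda> (fst ij) = sub_index q \<Lambda> (fst ij')" "sub_index q \<Lambda> (snd ij) = sub_index q \<Lambda> (snd ij')"
      using that P' by (simp_all add: P_def)
    then have "agree q \<Lambda> (fst ij) (fst ij')" "agree q \<Lambda> (snd ij) (snd ij')"
      by (simp_all add: sub_index_eq_iff[OF fin assms(2)])
    then have "X $$ (fst ij, snd ij) = X $$ (fst ij', snd ij')"
      using X(3)[of "fst ij" "snd ij" "fst ij'" "snd ij'"] that P' by (simp add: P_def)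
    moreover have "\<exists>ij. P a b ij" using that by blast
    ultimately show ?thesis by (simp add: c_def ij'_def[symmetric])
  qed
  define g where "g = mat (q ^ card \<Lambda>) (q ^ card \<Lambda>) (\<lambda>(a, b). c a b)"
  have herm: "c a b = cnj (c b a)" for a b
  proof (cases "\<exists>ij. P a b ij")
    case True
    then obtain i j where ij: "P a b (i, j)" by auto
    then have "P b a (j, i)" by (auto simp: P_def agree_def)
    moreover have "X $$ (i, j) = cnj (X $$ (j, i))"
      using assms(4) ij unfolding self_adjoint_iff P_def fst_conv snd_conv by blast
    ultimately show ?thesis using cI[OF ij] cI[of b a "(j, i)"] by simp
  next
    case False
    moreover have "\<not> P b a (i, j)" for i j
    proof
      assume "P b a (i, j)"
      then have "P a b (j, i)" by (auto simp: P_def agree_def)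
      then show False using False by blast
    qed
    ultimately show ?thesis by (simp add: c_def)
  qed
  have "g \<in> self_adjoint (q ^ card \<Lambda>)"
    unfolding self_adjoint_iff
  proof (intro conjI allI impI)
    fix a b assume "a < q ^ card \<Lambda>" "b < q ^ card \<Lambda>"
    then have "g $$ (a, b) = c a b" "g $$ (b, a) = c b a" by (simp_all add: g_def)
    then show "g $$ (a, b) = cnj (g $$ (b, a))" using herm[of a b] by (simp only:)
  qed (simp add: g_def)
  moreover have "X = tensor_id q n \<Lambda> g"
  proof (rule eq_matI)
    fix i j assume "i < dim_row (tensor_id q n \<Lambda> g)" "j < dim_col (tensor_id q n \<Lambda> g)"
    then have ij: "i < q ^ n" "j < q ^ n" by (simp_all add: tensor_id_def)
    have e: "tensor_id q n \<Lambda> g $$ (i, j)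
        = (if agree q ({1..n} - \<Lambda>) i j then g $$ (sub_index q \<Lambda> i, sub_index q \<Lambda> j) else 0)"
      using ij by (simp add: tensor_id_def agree_def)
    show "X $$ (i, j) = tensor_id q n \<Lambda> g $$ (i, j)"
    proof (cases "agree q ({1..n} - \<Lambda>) i j")
      case True
      then have "P (sub_index q \<Lambda> i) (sub_index q \<Lambda> j) (i, j)" using ij by (simp add: P_def)
      then have "g $$ (sub_index q \<Lambda> i, sub_index q \<Lambda> j) = X $$ (i, j)"
        using cI sub_index_less[OF fin assms(2)] by (simp add: g_def)
      then show ?thesis using True by (simp add: e)
    next
      case False
      then show ?thesis using X(2)[OF ij] by (simp add: e)
    qed
  qed (use X(1) in \<open>auto simp: tensor_id_def\<close>)
  ultimately show ?thesis by (auto simp: observables_def)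
qed

text \<open>The configuration that follows the first argument on \<Lambda> and the second elsewhere;
  all manipulations of supports are carried out with it.\<close>

lemma merge_exists:
  assumes "q > 0"
  shows "\<exists>m. \<forall>i j. m i j < q ^ n \<and> (\<forall>x\<in>{1..n}. spin q x (m i j) = (if x \<in> \<Lambda> then spin q x i else spin q x j))"
proof -
  have "\<exists>k. k < q ^ n \<and> (\<forall>x\<in>{1..n}. spin q x k = (if x \<in> \<Lambda> then spin q x i else spin q x j))" for i j
    using spin_exists[of n "\<lambda>x. if x \<in> \<Lambda> then spin q x i else spin q x j" q] spin_less[OF assms] by auto
  then show ?thesis by metis
qed

text \<open>Only intermediate configurations that agree with the row index outside \<Lambda>
  contribute. Exchanging their part outside \<Lambda> matches the terms of the two entries one by
  one and changes neither factor.\<close>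

lemma acts_on_mult:
  assumes q: "q > 0" and sub: "\<Lambda> \<subseteq> {1..n}" and "X \<in> acts_on q n \<Lambda>" "Y \<in> acts_on q n \<Lambda>"
  shows "X * Y \<in> acts_on q n \<Lambda>"
proof -
  note X = acts_onD[OF assms(3)] and Y = acts_onD[OF assms(4)]
  obtain m where m: "\<And>i j. m i j < q ^ n"
    "\<And>i j x. x \<in> {1..n} \<Longrightarrow> spin q x (m i j) = (if x \<in> \<Lambda> then spin q x i else spin q x j)"
    using merge_exists[OF q, of n \<Lambda>] by blast
  note XY = index_mult_sum[OF X(1) Y(1)]
  show ?thesis
  proof (rule acts_onI)
    show "X * Y \<in> carrier_mat (q ^ n) (q ^ n)" using X(1) Y(1) by simp
    fix i j assume ij: "i < q ^ n" "j < q ^ n" "\<not> agree q ({1..n} - \<Lambda>) i j"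
    show "(X * Y) $$ (i, j) = 0"
      unfolding XY[OF ij(1,2)]
    proof (rule sum.neutral, rule ballI)
      fix k assume k: "k \<in> {..<q ^ n}"
      have "\<not> agree q ({1..n} - \<Lambda>) i k \<or> \<not> agree q ({1..n} - \<Lambda>) k j"
        using ij(3) by (auto simp: agree_def)
      then show "X $$ (i, k) * Y $$ (k, j) = 0" using X(2)[of i k] Y(2)[of k j] ij k by auto
    qed
  next
    fix i j i' j' assume a: "i < q ^ n" "j < q ^ n" "i' < q ^ n" "j' < q ^ n"
      "agree q ({1..n} - \<Lambda>) i j" "agree q ({1..n} - \<Lambda>) i' j'" "agree q \<Lambda> i i'" "agree q \<Lambda> j j'"
    let ?K = "\<lambda>i. {k. k < q ^ n \<and> agree q ({1..n} - \<Lambda>) i k}"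
    have restr: "(X * Y) $$ (i, j) = (\<Sum>k\<in>?K i. X $$ (i, k) * Y $$ (k, j))"
      if "i < q ^ n" "j < q ^ n" for i j
      unfolding XY[OF that] by (rule sum.mono_neutral_right) (use X(2) that in auto)
    \<comment> \<open>Merging back with \<open>i\<close> restores \<open>k\<close>, which already
      agreed with \<open>i\<close> outside \<Lambda>; so the two merges are mutually inverse in the
      reindexing below.\<close>
    have mm: "m (m k i') i = k" if k: "k < q ^ n" "agree q ({1..n} - \<Lambda>) i k" for k i i'
      by (rule spin_inject[OF m(1) k(1)]) (use k(2) in \<open>auto simp: m(2) agree_def\<close>)
    have "(\<Sum>k\<in>?K i. X $$ (i, k) * Y $$ (k, j)) = (\<Sum>k\<in>?K i'. X $$ (i', k) * Y $$ (k, j'))"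
    proof (rule sum.reindex_bij_witness[where i = "\<lambda>k. m k i" and j = "\<lambda>k. m k i'"])
      fix k assume k: "k \<in> ?K i"
      show "m (m k i') i = k" using k by (intro mm) auto
      show "m k i' \<in> ?K i'" using m(1) by (auto simp: agree_def m(2))
      have "X $$ (i', m k i') = X $$ (i, k)"
        by (rule X(3)) (use a k m(1) sub in \<open>auto simp: agree_def m(2) subset_iff\<close>)
      moreover have "Y $$ (m k i', j') = Y $$ (k, j)"
        by (rule Y(3)) (use a k m(1) sub in \<open>auto simp: agree_def m(2) subset_iff\<close>)
      ultimately show "X $$ (i', m k i') * Y $$ (m k i', j') = X $$ (i, k) * Y $$ (k, j)" by simp
    next
      fix k assume k: "k \<in> ?K i'"
      show "m (m k i) i' = k" using k by (intro mm) auto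
      show "m k i \<in> ?K i" using m(1) by (auto simp: agree_def m(2))
    qed
    then show "(X * Y) $$ (i, j) = (X * Y) $$ (i', j')" using a by (simp only: restr)
  qed
qed

text \<open>For disjoint supports the product sum has a single term: the intermediate configuration
  must equal the column index on the first support and the row index elsewhere. The terms of X Y and
  Y X then consist of the same two entries.\<close>

lemma acts_on_commute:
  assumes q: "q > 0" and sub: "\<Lambda> \<subseteq> {1..n}" "\<Lambda>' \<subseteq> {1..n}" and disj: "\<Lambda> \<inter> \<Lambda>' = {}"
    and XL: "X \<in> acts_on q n \<Lambda>" and YL: "Y \<in> acts_on q n \<Lambda>'"
  shows "X * Y = Y * X"
proof -
  note X = acts_onD[OF XL] and Y = acts_onD[OF YL]
  have single: "\<exists>k<q ^ n. (\<forall>x\<in>{1..n}. spin q x k = (if x \<in> L then spin q x j else spin q x i)) \<and>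
      (A * B) $$ (i, j) = A $$ (i, k) * B $$ (k, j)"
    if ij: "i < q ^ n" "j < q ^ n" and A: "A \<in> acts_on q n L" and B: "B \<in> acts_on q n L'"
      and LL: "L \<inter> L' = {}" "L \<subseteq> {1..n}" for i j A B L L'
  proof -
    obtain m where m: "\<And>i j. m i j < q ^ n"
      "\<And>i j x. x \<in> {1..n} \<Longrightarrow> spin q x (m i j) = (if x \<in> L then spin q x i else spin q x j)"
      using merge_exists[OF q, of n L] by blast
    have "(A * B) $$ (i, j) = (\<Sum>k<q ^ n. A $$ (i, k) * B $$ (k, j))"
      by (rule index_mult_sum[OF acts_onD(1)[OF A] acts_onD(1)[OF B] ij])
    also have "\<dots> = (\<Sum>k\<in>{m j i}. A $$ (i, k) * B $$ (k, j))"
    proof (rule sum.mono_neutral_right)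
      show "\<forall>k\<in>{..<q ^ n} - {m j i}. A $$ (i, k) * B $$ (k, j) = 0"
      proof
        fix k assume k: "k \<in> {..<q ^ n} - {m j i}"
        show "A $$ (i, k) * B $$ (k, j) = 0"
        proof (rule ccontr)
          assume "A $$ (i, k) * B $$ (k, j) \<noteq> 0"
          then have "agree q ({1..n} - L) i k" "agree q ({1..n} - L') k j"
            using acts_onD(2)[OF A, of i k] acts_onD(2)[OF B, of k j] ij k by auto
          then have "k = m j i"
            using k LL by (intro spin_inject[of k q n "m j i"]) (auto simp: m agree_def)
          then show False using k by simp
        qed
      qed
    qed (use m(1) in auto)
    finally show ?thesis using m by (intro exI[of _ "m j i"]) auto
  qed
  show ?thesis
  proof (rule eq_matI)
    fix i j assume "i < dim_row (Y * X)" "j < dim_col (Y * X)"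
    then have ij: "i < q ^ n" "j < q ^ n" using X(1) Y(1) by auto
    obtain k where k: "k < q ^ n" "\<forall>x\<in>{1..n}. spin q x k = (if x \<in> \<Lambda> then spin q x j else spin q x i)"
      "(X * Y) $$ (i, j) = X $$ (i, k) * Y $$ (k, j)" using single[OF ij XL YL disj sub(1)] by blast
    obtain l where l: "l < q ^ n" "\<forall>x\<in>{1..n}. spin q x l = (if x \<in> \<Lambda>' then spin q x j else spin q x i)"
      "(Y * X) $$ (i, j) = Y $$ (i, l) * X $$ (l, j)" using single[OF ij YL XL _ sub(2)] disj by blast
    show "(X * Y) $$ (i, j) = (Y * X) $$ (i, j)"
    \<comment> \<open>A difference of i and j at a spin outside both supports survives in the
      intermediate configurations and makes both products vanish.\<close>
    proof (cases "agree q ({1..n} - (\<Lambda> \<union> \<Lambda>')) i j")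
      case True
      have "X $$ (i, k) = X $$ (l, j)"
        by (rule X(3)) (use ij k(1,2) l(1,2) True disj sub in \<open>auto simp: agree_def subset_iff\<close>)
      moreover have "Y $$ (k, j) = Y $$ (i, l)"
        by (rule Y(3)) (use ij k(1,2) l(1,2) True disj sub in \<open>auto simp: agree_def subset_iff\<close>)
      ultimately show ?thesis unfolding k(3) l(3) by simp
    next
      case False
      then obtain x where x: "x \<in> {1..n}" "x \<notin> \<Lambda>" "x \<notin> \<Lambda>'" "spin q x i \<noteq> spin q x j"
        unfolding agree_def by blast
      have "\<not> agree q ({1..n} - \<Lambda>') k j" "\<not> agree q ({1..n} - \<Lambda>) l j"
        using x k(2) l(2) by (force simp: agree_def)+
      then show ?thesis unfolding k(3) l(3) using X(2)[of l j] Y(2)[of k j] ij k(1) l(1) by simp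
    qed
  qed (use X(1) Y(1) in auto)
qed

text \<open>On the extra spins the operator is the identity: either both index pairs agree outside
  the smaller set and the entries match, or neither does and both entries are 0.\<close>

lemma acts_on_mono:
  assumes "\<Lambda> \<subseteq> \<Lambda>'" "\<Lambda>' \<subseteq> {1..n}" "X \<in> acts_on q n \<Lambda>"
  shows "X \<in> acts_on q n \<Lambda>'"
proof -
  note X = acts_onD[OF assms(3)]
  show ?thesis
  proof (rule acts_onI[OF X(1)])
    fix i j assume "i < q ^ n" "j < q ^ n" "\<not> agree q ({1..n} - \<Lambda>') i j"
    then show "X $$ (i, j) = 0" using assms(1) by (intro X(2)) (auto simp: agree_def)
  next
    fix i j i' j' assume a: "i < q ^ n" "j < q ^ n" "i' < q ^ n" "j' < q ^ n"
      "agree q ({1..n} - \<Lambda>') i j" "agree q ({1..n} - \<Lambda>') i' j'" "agree q \<Lambda>' i i'" "agree q \<Lambda>' j j'"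
    have iff: "agree q ({1..n} - \<Lambda>) i j \<longleftrightarrow> agree q ({1..n} - \<Lambda>) i' j'"
    proof -
      have "spin q x i = spin q x j \<longleftrightarrow> spin q x i' = spin q x j'" if "x \<in> {1..n}" for x
        using a(5-8) that by (cases "x \<in> \<Lambda>'") (auto simp: agree_def)
      then show ?thesis by (simp add: agree_def)
    qed
    show "X $$ (i, j) = X $$ (i', j')"
    proof (cases "agree q ({1..n} - \<Lambda>) i j")
      case True
      then show ?thesis using iff a assms(1) by (intro X(3)) (auto simp: agree_def)
    next
      case False
      then show ?thesis using iff X(2)[of i j] X(2)[of i' j'] a by simp
    qed
  qed
qed

lemma acts_on_one:
  assumes "\<Lambda> \<subseteq> {1..n}"
  shows "1\<^sub>m (q ^ n) \<in> acts_on q n \<Lambda>"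
proof (rule acts_onI)
  fix i j i' j' assume a: "i < q ^ n" "j < q ^ n" "i' < q ^ n" "j' < q ^ n"
    "agree q ({1..n} - \<Lambda>) i j" "agree q ({1..n} - \<Lambda>) i' j'" "agree q \<Lambda> i i'" "agree q \<Lambda> j j'"
  have "i = j \<longleftrightarrow> i' = j'"
  proof
    assume "i = j"
    then show "i' = j'" by (intro spin_inject[OF a(3,4)]) (use a(6-8) in \<open>auto simp: agree_def\<close>)
  next
    assume "i' = j'"
    then show "i = j" by (intro spin_inject[OF a(1,2)]) (use a(5,7,8) in \<open>auto simp: agree_def\<close>)
  qed
  then show "(1\<^sub>m (q ^ n) :: complex mat) $$ (i, j) = 1\<^sub>m (q ^ n) $$ (i', j')" using a by simp
qed (auto simp: agree_def)

lemma acts_on_add: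
  assumes "X \<in> acts_on q n \<Lambda>" "Y \<in> acts_on q n \<Lambda>"
  shows "X + Y \<in> acts_on q n \<Lambda>"
proof -
  note X = acts_onD[OF assms(1)] and Y = acts_onD[OF assms(2)]
  have e: "(X + Y) $$ (i, j) = X $$ (i, j) + Y $$ (i, j)" if "i < q ^ n" "j < q ^ n" for i j
    using that X(1) Y(1) by auto
  show ?thesis
  proof (rule acts_onI)
    fix i j i' j' assume a: "i < q ^ n" "j < q ^ n" "i' < q ^ n" "j' < q ^ n"
      "agree q ({1..n} - \<Lambda>) i j" "agree q ({1..n} - \<Lambda>) i' j'" "agree q \<Lambda> i i'" "agree q \<Lambda> j j'"
    show "(X + Y) $$ (i, j) = (X + Y) $$ (i', j')"
      unfolding e[OF a(1,2)] e[OF a(3,4)] X(3)[OF a] Y(3)[OF a] ..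
  qed (use X(1) Y(1) X(2) Y(2) e in auto)
qed

lemma acts_on_smult:
  assumes "X \<in> acts_on q n \<Lambda>"
  shows "c \<cdot>\<^sub>m X \<in> acts_on q n \<Lambda>"
proof -
  note X = acts_onD[OF assms(1)]
  have e: "(c \<cdot>\<^sub>m X) $$ (i, j) = c * X $$ (i, j)" if "i < q ^ n" "j < q ^ n" for i j
    using that X(1) by auto
  show ?thesis
  proof (rule acts_onI)
    fix i j i' j' assume a: "i < q ^ n" "j < q ^ n" "i' < q ^ n" "j' < q ^ n"
      "agree q ({1..n} - \<Lambda>) i j" "agree q ({1..n} - \<Lambda>) i' j'" "agree q \<Lambda> i i'" "agree q \<Lambda> j j'"
    show "(c \<cdot>\<^sub>m X) $$ (i, j) = (c \<cdot>\<^sub>m X) $$ (i', j')"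
      unfolding e[OF a(1,2)] e[OF a(3,4)] X(3)[OF a] ..
  qed (use X(1) X(2) e in auto)
qed

lemma acts_on_adjoint:
  assumes "X \<in> acts_on q n \<Lambda>"
  shows "mat_adjoint X \<in> acts_on q n \<Lambda>"
proof -
  note X = acts_onD[OF assms(1)]
  have e: "mat_adjoint X $$ (i, j) = cnj (X $$ (j, i))" if "i < q ^ n" "j < q ^ n" for i j
    using that X(1) by auto
  have sym: "agree q L i j \<longleftrightarrow> agree q L j i" for L i j by (auto simp: agree_def)
  show ?thesis
  proof (rule acts_onI)
    fix i j assume a: "i < q ^ n" "j < q ^ n" "\<not> agree q ({1..n} - \<Lambda>) i j"
    then show "mat_adjoint X $$ (i, j) = 0" using X(2)[of j i] sym[of _ i j] by (simp add: e)
  next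
    fix i j i' j' assume a: "i < q ^ n" "j < q ^ n" "i' < q ^ n" "j' < q ^ n"
      "agree q ({1..n} - \<Lambda>) i j" "agree q ({1..n} - \<Lambda>) i' j'" "agree q \<Lambda> i i'" "agree q \<Lambda> j j'"
    have "X $$ (j, i) = X $$ (j', i')"
      by (rule X(3)) (use a sym in blast)+
    then show "mat_adjoint X $$ (i, j) = mat_adjoint X $$ (i', j')" using a by (simp add: e)
  qed (use X(1) in auto)
qed

subsection \<open>Sums over tuples without isolated entries\<close>

text \<open>Ore: in a graph without isolated vertices the complement of a minimal dominating set is
  again dominating.\<close>

lemma small_dominating_set:
  assumes V: "finite V" and sym: "\<And>u v. R u v \<Longrightarrow> R v u"
    and nbr: "\<And>v. v \<in> V \<Longrightarrow> \<exists>u\<in>V. u \<noteq> v \<and> R v u"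
  shows "\<exists>S\<subseteq>V. 2 * card S \<le> card V \<and> (\<forall>v\<in>V - S. \<exists>u\<in>S. R v u)"
proof -
  define dom where "dom S \<longleftrightarrow> S \<subseteq> V \<and> (\<forall>v\<in>V - S. \<exists>u\<in>S. R v u)" for S
  have "dom V" by (simp add: dom_def)
  then obtain S where S: "dom S" and min: "\<And>S'. dom S' \<Longrightarrow> card S \<le> card S'"
    using ex_has_least_nat[of dom V card] by blast
  have fin: "finite S" using S V finite_subset by (auto simp: dom_def)
  have "\<exists>u\<in>V - S. R v u" if v: "v \<in> S" for v
  proof (rule ccontr)
    assume no: "\<not> (\<exists>u\<in>V - S. R v u)"
    \<comment> \<open>If all neighbours of \<open>v\<close> lie in \<open>S\<close>, then
      \<open>v\<close> can leave: one of its neighbours in \<open>S\<close> dominates it, and no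
      vertex outside \<open>S\<close> relied on \<open>v\<close>. This contradicts minimality, so
      every element of \<open>S\<close> has a neighbour outside.\<close>
    have "dom (S - {v})"
      unfolding dom_def
    proof (intro conjI ballI)
      fix w assume w: "w \<in> V - (S - {v})"
      show "\<exists>u\<in>S - {v}. R w u"
      proof (cases "w = v")
        case True
        obtain u where "u \<in> V" "u \<noteq> v" "R v u" using nbr[of v] v S by (auto simp: dom_def)
        then show ?thesis using no True by blast
      next
        case False
        then obtain u where "u \<in> S" "R w u" using w S by (auto simp: dom_def)
        moreover have "u \<noteq> v" using no \<open>R w u\<close> sym w False by blast
        ultimately show ?thesis by blast
      qed
    qed (use S in \<open>auto simp: dom_def\<close>)
    then have "card S \<le> card (S - {v})" by (rule min)
    then show False using v fin by (metis card_Diff1_less linorder_not_le)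
  qed
  then have compl: "\<forall>v\<in>V - (V - S). \<exists>u\<in>V - S. R v u" by blast
  have "card S + card (V - S) = card V"
    using S V fin by (simp add: dom_def card_Diff_subset card_mono)
  then have "2 * card S \<le> card V \<or> 2 * card (V - S) \<le> card V" by linarith
  then show ?thesis
  proof
    assume "2 * card S \<le> card V"
    then show ?thesis using S by (auto simp: dom_def)
  next
    assume "2 * card (V - S) \<le> card V"
    then show ?thesis using compl by blast
  qed
qed

text \<open>Splits off the coordinate j. Its constraint refers only to the coordinate \<phi> j,
  which is already in \<open>I\<close>, so a constrained sum over tuples becomes an iterated sum
  with an inner range that depends on the shorter tuple.\<close>

lemma PiE_insert_Sigma:
  assumes "j \<notin> I" "\<phi> j \<in> I" "\<And>i. i \<in> T \<Longrightarrow> i \<in> I \<and> \<phi> i \<in> I"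
  shows "{p \<in> insert j I \<rightarrow>\<^sub>E X. \<forall>i\<in>insert j T. c (p i) (p (\<phi> i))}
    = (\<lambda>(p, x). p(j := x)) ` (SIGMA p:{p \<in> I \<rightarrow>\<^sub>E X. \<forall>i\<in>T. c (p i) (p (\<phi> i))}. {x \<in> X. c x (p (\<phi> j))})"
    (is "?A = ?f ` ?B")
proof
  show "?A \<subseteq> ?f ` ?B"
  proof
    fix p assume p: "p \<in> ?A"
    let ?p = "p(j := undefined)"
    have "?p i = p i" if "i \<in> I" for i using that assms(1) by auto
    moreover have "?p \<in> I \<rightarrow>\<^sub>E X" using p assms(1) by (auto simp: PiE_def extensional_def)
    ultimately have "(?p, p j) \<in> ?B" using p assms by auto
    moreover have "p = ?f (?p, p j)" by auto
    ultimately show "p \<in> ?f ` ?B" by blast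
  qed
  show "?f ` ?B \<subseteq> ?A"
  proof
    fix p' assume "p' \<in> ?f ` ?B"
    then obtain p x where px: "p \<in> I \<rightarrow>\<^sub>E X" "\<forall>i\<in>T. c (p i) (p (\<phi> i))" "x \<in> X" "c x (p (\<phi> j))"
      "p' = p(j := x)" by auto
    have e: "p' i = p i" if "i \<in> I" for i using that assms(1) px(5) by auto
    have "p' \<in> insert j I \<rightarrow>\<^sub>E X" using px by (auto simp: PiE_def extensional_def)
    moreover have "c (p' i) (p' (\<phi> i))" if "i \<in> insert j T" for i
    proof (cases "i = j")
      case True
      then show ?thesis using px e[OF assms(2)] by simp
    next
      case False
      then show ?thesis using that px(2) e assms(3)[of i] by simp
    qed
    ultimately show "p' \<in> ?A" by blast
  qed
qed

lemma inj_on_fun_upd: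
  assumes "j \<notin> I"
  shows "inj_on (\<lambda>(p, x). p(j := x)) (SIGMA p:{p \<in> I \<rightarrow>\<^sub>E X. P p}. Y p)"
proof (rule inj_onI, clarify)
  fix p x p' x' assume a: "p \<in> I \<rightarrow>\<^sub>E X" "p' \<in> I \<rightarrow>\<^sub>E X" "p(j := x) = p'(j := x')"
  have "x = x'" using fun_cong[OF a(3), of j] by simp
  moreover have "p i = p' i" for i
  proof (cases "i = j")
    case True
    then show ?thesis using a(1,2) assms by (auto simp: PiE_def extensional_def)
  next
    case False
    then show ?thesis using fun_cong[OF a(3), of i] by simp
  qed
  ultimately show "p = p' \<and> x = x'" by auto
qed

text \<open>Coordinates in \<open>S\<close> are free and cost n each; a coordinate in
  \<open>T\<close> is tied to one in \<open>S\<close> and costs only \<open>K\<close>. Since the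
  constraints point from \<open>T\<close> into \<open>S\<close>, the coordinates of \<open>T\<close>
  can be summed out one at a time.\<close>

lemma sum_prod_attached_le:
  fixes w :: "'a \<Rightarrow> real"
  assumes "finite X" "\<And>x. w x \<ge> 0" "finite S" "finite T" "S \<inter> T = {}" "\<And>j. j \<in> T \<Longrightarrow> \<phi> j \<in> S"
    and n: "(\<Sum>x\<in>X. w x) \<le> n" and K: "\<And>y. y \<in> X \<Longrightarrow> (\<Sum>x | x \<in> X \<and> c x y. w x) \<le> K"
    and "K \<ge> 0"
  shows "(\<Sum>p | p \<in> (S \<union> T \<rightarrow>\<^sub>E X) \<and> (\<forall>j\<in>T. c (p j) (p (\<phi> j))). \<Prod>i\<in>S \<union> T. w (p i))
    \<le> n ^ card S * K ^ card T"
  using assms(4-6)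
proof (induction T rule: finite_induct)
  case empty
  have "(\<Sum>p\<in>S \<rightarrow>\<^sub>E X. \<Prod>i\<in>S. w (p i)) = (\<Prod>i\<in>S. \<Sum>x\<in>X. w x)"
    by (rule prod_sum_PiE[symmetric]) (use assms in auto)
  also have "\<dots> \<le> n ^ card S"
    using n assms(2) by (simp add: power_mono sum_nonneg)
  finally show ?case by simp
next
  case (insert j T)
  let ?I = "S \<union> T"
  have j: "j \<notin> ?I" "\<phi> j \<in> ?I" using insert by auto
  have T: "\<And>i. i \<in> T \<Longrightarrow> i \<in> ?I \<and> \<phi> i \<in> ?I" using insert by auto
  let ?P = "{p \<in> ?I \<rightarrow>\<^sub>E X. \<forall>i\<in>T. c (p i) (p (\<phi> i))}"
  have fin: "finite ?I" using insert assms by auto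
  have finP: "finite ?P" using finite_PiE[OF fin, of "\<lambda>_. X"] assms(1) by simp
  have ins: "S \<union> insert j T = insert j ?I" by auto
  have split: "{p. p \<in> insert j ?I \<rightarrow>\<^sub>E X \<and> (\<forall>i\<in>insert j T. c (p i) (p (\<phi> i)))}
      = (\<lambda>(p, x). p(j := x)) ` (SIGMA p:?P. {x \<in> X. c x (p (\<phi> j))})"
    using PiE_insert_Sigma[of j ?I \<phi> T X c, OF j T] by simp
  have "(\<Sum>p | p \<in> (S \<union> insert j T \<rightarrow>\<^sub>E X) \<and> (\<forall>i\<in>insert j T. c (p i) (p (\<phi> i))). \<Prod>i\<in>S \<union> insert j T. w (p i))
      = (\<Sum>(p, x)\<in>(SIGMA p:?P. {x \<in> X. c x (p (\<phi> j))}). \<Prod>i\<in>insert j ?I. w ((p(j := x)) i))"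
    unfolding ins split
    by (subst sum.reindex[OF inj_on_fun_upd[OF j(1)]]) (simp add: case_prod_unfold)
  also have "\<dots> = (\<Sum>p\<in>?P. \<Sum>x | x \<in> X \<and> c x (p (\<phi> j)). \<Prod>i\<in>insert j ?I. w ((p(j := x)) i))"
    by (rule sum.Sigma[symmetric]) (use finP assms(1) in auto)
  also have "\<dots> = (\<Sum>p\<in>?P. (\<Sum>x | x \<in> X \<and> c x (p (\<phi> j)). w x) * (\<Prod>i\<in>?I. w (p i)))"
  proof (intro sum.cong refl)
    fix p
    have "(\<Prod>i\<in>insert j ?I. w ((p(j := x)) i)) = w x * (\<Prod>i\<in>?I. w (p i))" for x
    proof -
      have "(\<Prod>i\<in>?I. w ((p(j := x)) i)) = (\<Prod>i\<in>?I. w (p i))"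
        using j(1) by (intro prod.cong) auto
      then show ?thesis using fin j(1) by simp
    qed
    then show "(\<Sum>x | x \<in> X \<and> c x (p (\<phi> j)). \<Prod>i\<in>insert j ?I. w ((p(j := x)) i))
      = (\<Sum>x | x \<in> X \<and> c x (p (\<phi> j)). w x) * (\<Prod>i\<in>?I. w (p i))"
      by (simp add: sum_distrib_right)
  qed
  also have "\<dots> \<le> (\<Sum>p\<in>?P. K * (\<Prod>i\<in>?I. w (p i)))"
  proof (intro sum_mono mult_right_mono)
    fix p assume "p \<in> ?P"
    then have "p (\<phi> j) \<in> X" using j(2) by auto
    then show "(\<Sum>x | x \<in> X \<and> c x (p (\<phi> j)). w x) \<le> K" by (rule K)
  qed (use assms(2) in \<open>auto intro: prod_nonneg\<close>)
  also have "\<dots> = K * (\<Sum>p\<in>?P. \<Prod>i\<in>?I. w (p i))" by (simp add: sum_distrib_left)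
  also have "\<dots> \<le> K * (n ^ card S * K ^ card T)"
    using insert \<open>K \<ge> 0\<close> by (intro mult_left_mono) auto
  finally show ?case using insert by (simp add: mult_ac)
qed

text \<open>A tuple without isolated entries is described by a dominating set S of at most h
  positions and a map that attaches the others to S. There are at most 2^(2h) (2h)^(2h) such pairs,
  and each leaves a sum of at most n^|S| K^(2h - |S|), which is bounded by (n K)^h because K \<le>
  n.\<close>

lemma sum_prod_no_isolated_le:
  fixes w :: "'a \<Rightarrow> real"
  assumes X: "finite X" and w: "\<And>x. w x \<ge> 0" and sym: "\<And>x y. c x y \<Longrightarrow> c y x"
    and n: "(\<Sum>x\<in>X. w x) \<le> n" and K: "\<And>y. y \<in> X \<Longrightarrow> (\<Sum>x | x \<in> X \<and> c x y. w x) \<le> K"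
    and K0: "K \<ge> 0" and Kn: "K \<le> n"
  shows "(\<Sum>p | p \<in> ({..<2 * h} \<rightarrow>\<^sub>E X) \<and> (\<forall>i<2 * h. \<exists>j<2 * h. j \<noteq> i \<and> c (p i) (p j)). \<Prod>i<2 * h. w (p i))
    \<le> (2 * real (2 * h)) ^ (2 * h) * (n * K) ^ h"
proof -
  define V where "V = {..<2 * h}"
  have V: "finite V" "card V = 2 * h" by (auto simp: V_def)
  define Q where "Q = {(S, \<phi>). S \<in> Pow V \<and> \<phi> \<in> V \<rightarrow>\<^sub>E V \<and> 2 * card S \<le> card V \<and> (\<forall>j\<in>V - S. \<phi> j \<in> S)}"
  define A where "A = (\<lambda>(S, \<phi>). {p \<in> V \<rightarrow>\<^sub>E X. \<forall>j\<in>V - S. c (p j) (p (\<phi> j))})"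
  have Qsub: "Q \<subseteq> Pow V \<times> (V \<rightarrow>\<^sub>E V)" by (auto simp: Q_def)
  have finPV: "finite (Pow V \<times> (V \<rightarrow>\<^sub>E V))" using V by (intro finite_cartesian_product finite_PiE) auto
  have finQ: "finite Q" using finite_subset[OF Qsub finPV] .
  have "card Q \<le> card (Pow V \<times> (V \<rightarrow>\<^sub>E V))" by (rule card_mono[OF finPV Qsub])
  also have "\<dots> = 2 ^ (2 * h) * (2 * h) ^ (2 * h)"
    using V by (simp add: card_cartesian_product card_Pow card_PiE)
  also have "\<dots> = (2 * (2 * h)) ^ (2 * h)" by (simp only: power_mult_distrib)
  finally have cardQ: "real (card Q) \<le> (2 * real (2 * h)) ^ (2 * h)"
    by (metis (mono_tags, lifting) of_nat_le_iff of_nat_mult of_nat_numeral of_nat_power)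
  have finA: "finite (A s)" for s
    using finite_PiE[OF V(1), of "\<lambda>_. X"] X by (auto simp: A_def case_prod_unfold)
  have cover: "{p. p \<in> (V \<rightarrow>\<^sub>E X) \<and> (\<forall>i\<in>V. \<exists>j\<in>V. j \<noteq> i \<and> c (p i) (p j))} \<subseteq> (\<Union>s\<in>Q. A s)"
  proof
    fix p assume p: "p \<in> {p. p \<in> (V \<rightarrow>\<^sub>E X) \<and> (\<forall>i\<in>V. \<exists>j\<in>V. j \<noteq> i \<and> c (p i) (p j))}"
    then obtain S where S: "S \<subseteq> V" "2 * card S \<le> card V" "\<forall>v\<in>V - S. \<exists>u\<in>S. c (p v) (p u)"
      using small_dominating_set[OF V(1), of "\<lambda>i j. c (p i) (p j)"] sym by blast
    then obtain f where f: "\<forall>v\<in>V - S. f v \<in> S \<and> c (p v) (p (f v))" by metis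
    \<comment> \<open>The values on \<open>S\<close> are irrelevant; they and
      \<open>undefined\<close> outside \<open>V\<close> only serve to place \<phi> in the finite set
      of extensional functions that is counted.\<close>
    define \<phi> where "\<phi> v = (if v \<in> V - S then f v else if v \<in> V then v else undefined)" for v
    have "(S, \<phi>) \<in> Q" unfolding Q_def using S f by (auto simp: \<phi>_def PiE_def extensional_def)
    moreover have "p \<in> A (S, \<phi>)" using p f by (auto simp: A_def \<phi>_def)
    ultimately show "p \<in> (\<Union>s\<in>Q. A s)" by blast
  qed
  have each: "(\<Sum>p\<in>A s. \<Prod>i\<in>V. w (p i)) \<le> (n * K) ^ h" if s: "s \<in> Q" for s
  proof -
    obtain S \<phi> where S: "s = (S, \<phi>)" "S \<subseteq> V" "2 * card S \<le> 2 * h" "\<forall>j\<in>V - S. \<phi> j \<in> S"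
      using s V by (auto simp: Q_def)
    have fS: "finite S" "S \<union> (V - S) = V" using S V finite_subset by auto
    have cT: "card (V - S) = h + (h - card S)" using S V fS by (simp add: card_Diff_subset)
    have "(\<Sum>p\<in>A s. \<Prod>i\<in>V. w (p i)) \<le> n ^ card S * K ^ card (V - S)"
      using sum_prod_attached_le[of X w S "V - S" \<phi> n c K] X w fS V(1) S n K K0
      by (simp add: A_def)
    \<comment> \<open>The complement of \<open>S\<close> may exceed h by \<open>h - card S\<close>;
      that many factors K are traded for factors n.\<close>
    also have "\<dots> = (n ^ card S * K ^ h) * K ^ (h - card S)"
      by (simp add: cT power_add)
    also have "\<dots> \<le> (n ^ card S * K ^ h) * n ^ (h - card S)"
      using Kn K0 by (intro mult_left_mono power_mono) auto
    also have "\<dots> = n ^ (card S + (h - card S)) * K ^ h" by (simp add: power_add mult_ac)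
    also have "\<dots> = (n * K) ^ h" using S by (simp add: power_mult_distrib)
    finally show ?thesis .
  qed
  have "(\<Sum>p | p \<in> (V \<rightarrow>\<^sub>E X) \<and> (\<forall>i\<in>V. \<exists>j\<in>V. j \<noteq> i \<and> c (p i) (p j)). \<Prod>i\<in>V. w (p i))
      \<le> (\<Sum>p\<in>(\<Union>s\<in>Q. A s). \<Prod>i\<in>V. w (p i))"
    using cover finA finQ w by (intro sum_mono2) (auto intro: prod_nonneg)
  also have "\<dots> \<le> (\<Sum>s\<in>Q. \<Sum>p\<in>A s. \<Prod>i\<in>V. w (p i))"
    using finA finQ w by (intro sum_UN_le) (auto intro: prod_nonneg)
  also have "\<dots> \<le> (\<Sum>s\<in>Q. (n * K) ^ h)" by (intro sum_mono each)
  also have "\<dots> = real (card Q) * (n * K) ^ h" by simp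
  also have "\<dots> \<le> (2 * real (2 * h)) ^ (2 * h) * (n * K) ^ h"
    using cardQ K0 Kn by (intro mult_right_mono) auto
  finally show ?thesis by (simp add: V_def Ball_def Bex_def)
qed

subsection \<open>Moments of local observables\<close>

lemma observables_carrier: "h \<in> observables q n \<Lambda> \<Longrightarrow> h \<in> carrier_mat (q ^ n) (q ^ n)"
  by (auto simp: observables_def tensor_id_def)

section \<open>Ordered products of matrices and the expansion of powers of a sum\<close>

definition lprod :: "nat \<Rightarrow> complex mat list \<Rightarrow> complex mat" where
  "lprod N As = foldr (*) As (1\<^sub>m N)"

lemma lprod_simps [simp]: "lprod N [] = 1\<^sub>m N" "lprod N (A # As) = A * lprod N As"
  by (simp_all add: lprod_def)

lemma lprod_carrier: "set As \<subseteq> carrier_mat N N \<Longrightarrow> lprod N As \<in> carrier_mat N N"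
  by (induction As) (auto intro: mult_carrier_mat)

lemma lprod_append:
  assumes "set As \<subseteq> carrier_mat N N" "set Bs \<subseteq> carrier_mat N N"
  shows "lprod N (As @ Bs) = lprod N As * lprod N Bs"
  using assms(1)
proof (induction As)
  case Nil
  then show ?case using left_mult_one_mat[OF lprod_carrier[OF assms(2)]] by simp
next
  case (Cons A As)
  then have "A \<in> carrier_mat N N" "set As \<subseteq> carrier_mat N N" by auto
  then show ?case
    using Cons.IH assoc_mult_mat[of A N N "lprod N As" N "lprod N Bs" N] lprod_carrier assms(2) by simp
qed

text \<open>Brings an isolated factor to the front, where clustering applies to it against the
  product of the others. It has to commute only with the factors on its left.\<close>

lemma lprod_move_front:
  assumes As: "set As \<subseteq> carrier_mat N N" and Bs: "set Bs \<subseteq> carrier_mat N N" and A: "A \<in> carrier_mat N N"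
    and comm: "\<And>B. B \<in> set As \<Longrightarrow> B * A = A * B"
  shows "lprod N (As @ A # Bs) = A * lprod N (As @ Bs)"
  using As comm
proof (induction As)
  case (Cons B As)
  have c: "B \<in> carrier_mat N N" "lprod N (As @ Bs) \<in> carrier_mat N N"
    using Cons.prems Bs by (auto intro!: lprod_carrier)
  have "lprod N ((B # As) @ A # Bs) = B * (A * lprod N (As @ Bs))" using Cons by simp
  also have "\<dots> = (B * A) * lprod N (As @ Bs)" by (rule assoc_mult_mat[symmetric, OF c(1) A c(2)])
  also have "B * A = A * B" using Cons.prems by simp
  also have "(A * B) * lprod N (As @ Bs) = A * (B * lprod N (As @ Bs))"
    by (rule assoc_mult_mat[OF A c])
  finally show ?case by simp
qed simp

lemma op_norm_lprod:
  assumes "N > 0" "set As \<subseteq> carrier_mat N N"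
  shows "op_norm (lprod N As) \<le> prod_list (map op_norm As)"
  using assms(2)
proof (induction As)
  case (Cons A As)
  then have A: "A \<in> carrier_mat N N" "lprod N As \<in> carrier_mat N N" by (auto intro!: lprod_carrier)
  have "op_norm (A * lprod N As) \<le> op_norm A * op_norm (lprod N As)"
    by (rule op_norm_mult[OF A assms(1,1)])
  also have "\<dots> \<le> op_norm A * prod_list (map op_norm As)"
    using Cons op_norm_nonneg[OF A(1) assms(1)] by (intro mult_left_mono) auto
  finally show ?case by simp
qed (simp add: op_norm_one assms)

lemma lprod_acts_on:
  assumes "q > 0" "\<Lambda> \<subseteq> {1..n}" "set As \<subseteq> acts_on q n \<Lambda>"
  shows "lprod (q ^ n) As \<in> acts_on q n \<Lambda>"
  using assms(3) by (induction As) (auto intro: acts_on_one[OF assms(2)] acts_on_mult[OF assms(1,2)])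

text \<open>The noncommutative multinomial expansion, with one ordered product per tuple; stated for
  entries so that it is an identity between finite sums of numbers.\<close>

lemma pow_mat_expand:
  assumes X: "X \<in> carrier_mat N N" and S: "finite S" and a: "\<And>x. x \<in> S \<Longrightarrow> a x \<in> carrier_mat N N"
    and XS: "\<And>i j. i < N \<Longrightarrow> j < N \<Longrightarrow> X $$ (i, j) = (\<Sum>x\<in>S. a x $$ (i, j))"
    and ij: "i < N" "j < N"
  shows "(X ^\<^sub>m m) $$ (i, j) = (\<Sum>p\<in>{..<m} \<rightarrow>\<^sub>E S. lprod N (map (\<lambda>l. a (p l)) [0..<m]) $$ (i, j))"
  using ij
proof (induction m arbitrary: i j)
  case 0
  then show ?case using X by simp
next
  case (Suc m)
  let ?L = "\<lambda>p. lprod N (map (\<lambda>l. a (p l)) [0..<m])"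
  have Lc: "?L p \<in> carrier_mat N N" if "p \<in> {..<m} \<rightarrow>\<^sub>E S" for p
  proof (rule lprod_carrier, rule subsetI)
    fix Z assume "Z \<in> set (map (\<lambda>l. a (p l)) [0..<m])"
    then obtain l where "l < m" "Z = a (p l)" by auto
    then show "Z \<in> carrier_mat N N" using a[OF PiE_mem[OF that, of l]] by simp
  qed
  have step: "lprod N (map (\<lambda>l. a ((p(m := x)) l)) [0..<Suc m]) = ?L p * a x"
    if p: "p \<in> {..<m} \<rightarrow>\<^sub>E S" and x: "x \<in> S" for p x
  proof -
    have "map (\<lambda>l. a ((p(m := x)) l)) [0..<Suc m] = map (\<lambda>l. a (p l)) [0..<m] @ [a x]" by simp
    moreover have "set (map (\<lambda>l. a (p l)) [0..<m]) \<subseteq> carrier_mat N N"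
    proof
      fix Z assume "Z \<in> set (map (\<lambda>l. a (p l)) [0..<m])"
      then obtain l where "l < m" "Z = a (p l)" by auto
      then show "Z \<in> carrier_mat N N" using a[OF PiE_mem[OF p, of l]] by simp
    qed
    moreover have "set [a x] \<subseteq> carrier_mat N N" using a[OF x] by simp
    ultimately have "lprod N (map (\<lambda>l. a ((p(m := x)) l)) [0..<Suc m]) = ?L p * lprod N [a x]"
      by (simp only: lprod_append)
    then show ?thesis using right_mult_one_mat[OF a[OF x]] by simp
  qed
  have m: "m \<notin> {..<m}" by simp
  have "(X ^\<^sub>m Suc m) $$ (i, j) = (\<Sum>k<N. (X ^\<^sub>m m) $$ (i, k) * X $$ (k, j))"
    using index_mult_sum[OF pow_mat_carrier[OF X, of m] X Suc.prems] by simp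
  also have "\<dots> = (\<Sum>k<N. \<Sum>p\<in>{..<m} \<rightarrow>\<^sub>E S. \<Sum>x\<in>S. ?L p $$ (i, k) * a x $$ (k, j))"
    using Suc.prems by (intro sum.cong refl) (simp add: Suc.IH XS sum_product)
  also have "\<dots> = (\<Sum>p\<in>{..<m} \<rightarrow>\<^sub>E S. \<Sum>k<N. \<Sum>x\<in>S. ?L p $$ (i, k) * a x $$ (k, j))"
    by (rule sum.swap)
  also have "\<dots> = (\<Sum>p\<in>{..<m} \<rightarrow>\<^sub>E S. \<Sum>x\<in>S. \<Sum>k<N. ?L p $$ (i, k) * a x $$ (k, j))"
    by (intro sum.cong refl sum.swap)
  also have "\<dots> = (\<Sum>p\<in>{..<m} \<rightarrow>\<^sub>E S. \<Sum>x\<in>S. lprod N (map (\<lambda>l. a ((p(m := x)) l)) [0..<Suc m]) $$ (i, j))"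
  proof (intro sum.cong refl)
    fix p x assume px: "p \<in> {..<m} \<rightarrow>\<^sub>E S" "x \<in> S"
    show "(\<Sum>k<N. ?L p $$ (i, k) * a x $$ (k, j)) = lprod N (map (\<lambda>l. a ((p(m := x)) l)) [0..<Suc m]) $$ (i, j)"
      unfolding step[OF px] by (rule index_mult_sum[symmetric, OF Lc[OF px(1)] a[OF px(2)] Suc.prems])
  qed
  also have "\<dots> = (\<Sum>x\<in>S. \<Sum>p\<in>{..<m} \<rightarrow>\<^sub>E S. lprod N (map (\<lambda>l. a ((p(m := x)) l)) [0..<Suc m]) $$ (i, j))"
    by (rule sum.swap)
  also have "\<dots> = (\<Sum>(x, p)\<in>S \<times> ({..<m} \<rightarrow>\<^sub>E S). lprod N (map (\<lambda>l. a ((p(m := x)) l)) [0..<Suc m]) $$ (i, j))"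
    by (rule sum.cartesian_product)
  also have "\<dots> = (\<Sum>p\<in>(\<lambda>(x, p). p(m := x)) ` (S \<times> ({..<m} \<rightarrow>\<^sub>E S)). lprod N (map (\<lambda>l. a (p l)) [0..<Suc m]) $$ (i, j))"
    by (subst sum.reindex[OF inj_combinator[OF m]]) (simp add: case_prod_unfold)
  also have "(\<lambda>(x, p). p(m := x)) ` (S \<times> ({..<m} \<rightarrow>\<^sub>E S)) = {..<Suc m} \<rightarrow>\<^sub>E S"
    unfolding lessThan_Suc by (rule PiE_insert_eq[symmetric])
  finally show ?case .
qed

lemma tr_mult_sum:
  assumes W: "W \<in> carrier_mat N N" and Z: "Z \<in> carrier_mat N N"
    and z: "\<And>x. x \<in> S \<Longrightarrow> z x \<in> carrier_mat N N"
    and ZS: "\<And>i j. i < N \<Longrightarrow> j < N \<Longrightarrow> Z $$ (i, j) = (\<Sum>x\<in>S. z x $$ (i, j))"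
  shows "tr (W * Z) = (\<Sum>x\<in>S. tr (W * z x))"
proof -
  have "tr (W * Z) = (\<Sum>i<N. \<Sum>k<N. \<Sum>x\<in>S. W $$ (i, k) * z x $$ (k, i))"
    unfolding tr_mult[OF W Z] by (intro sum.cong refl) (simp add: ZS sum_distrib_left)
  also have "\<dots> = (\<Sum>i<N. \<Sum>x\<in>S. \<Sum>k<N. W $$ (i, k) * z x $$ (k, i))"
    by (intro sum.cong refl sum.swap)
  also have "\<dots> = (\<Sum>x\<in>S. \<Sum>i<N. \<Sum>k<N. W $$ (i, k) * z x $$ (k, i))"
    by (rule sum.swap)
  also have "\<dots> = (\<Sum>x\<in>S. tr (W * z x))"
    by (intro sum.cong refl tr_mult[symmetric, OF W z])
  finally show ?thesis .
qed

lemma tr_mult_add: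
  assumes "W \<in> carrier_mat N N" "X \<in> carrier_mat N N" "Y \<in> carrier_mat N N"
  shows "tr (W * (X + Y)) = tr (W * X) + tr (W * Y)"
  unfolding tr_mult[OF assms(1) add_carrier_mat[OF assms(3)]] tr_mult[OF assms(1,2)] tr_mult[OF assms(1,3)]
    sum.distrib[symmetric] using assms by (intro sum.cong refl) (simp add: distrib_left)

lemma tr_mult_smult:
  assumes "W \<in> carrier_mat N N" "X \<in> carrier_mat N N"
  shows "tr (W * (c \<cdot>\<^sub>m X)) = c * tr (W * X)"
  unfolding tr_mult[OF assms(1) smult_carrier_mat[OF assms(2)]] tr_mult[OF assms]
    sum_distrib_left using assms by (intro sum.cong refl) simp

lemma prod_list_map_upt: "prod_list (map f [0..<m]) = (\<Prod>i<m. f i :: real)"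
  by (induction m) (simp_all add: lessThan_Suc mult.commute)

section \<open>Covariances and products of centred observables in a clustering state\<close>

locale clustering_state = diagonal_state "q ^ n" U p for q n :: nat and U p +
  fixes D :: "nat \<Rightarrow> nat \<Rightarrow> real" and \<xi> C :: real
  assumes q_pos: "q > 0" and metric: "Metric_space {1..n} D"
    and clustering: "has_correlation_length q n D state \<xi> C"
    and xi_pos: "\<xi> > 0" and C_pos: "C > 0"
begin

text \<open>Clustering is available for self-adjoint observables only, but a product of observables
  is in general not self-adjoint. Its real and imaginary parts are, on the same spins and without
  increase of the norm.\<close>

lemma self_adjoint_parts:
  assumes B: "B \<in> acts_on q n \<Lambda>" and sub: "\<Lambda> \<subseteq> {1..n}"
  shows "\<exists>B1\<in>observables q n \<Lambda>. \<exists>B2\<in>observables q n \<Lambda>.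
    B = B1 + \<i> \<cdot>\<^sub>m B2 \<and> op_norm B1 \<le> op_norm B \<and> op_norm B2 \<le> op_norm B"
proof -
  let ?N = "q ^ n"
  have Bc: "B \<in> carrier_mat ?N ?N" by (rule acts_onD(1)[OF B])
  \<comment> \<open>One computation for both parts: c = 1/2, e = 1 gives the real part, c = -\<i>/2,
    e = -1 the imaginary one. The equations for the conjugates make the result self-adjoint, the
    moduli keep the norm below that of \<open>B\<close>.\<close>
  have part: "c \<cdot>\<^sub>m (B + e \<cdot>\<^sub>m mat_adjoint B) \<in> observables q n \<Lambda> \<and> op_norm (c \<cdot>\<^sub>m (B + e \<cdot>\<^sub>m mat_adjoint B)) \<le> op_norm B"
    if ce: "cmod c = 1 / 2" "cmod e = 1" "cnj c = c * e" "cnj e = e" "e * e = 1" for c e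
  proof
    let ?B = "c \<cdot>\<^sub>m (B + e \<cdot>\<^sub>m mat_adjoint B)"
    have ac: "?B \<in> acts_on q n \<Lambda>" by (intro acts_on_smult acts_on_add acts_on_adjoint B)
    have sa: "?B \<in> self_adjoint ?N"
      unfolding self_adjoint_iff
    proof (intro conjI allI impI)
      fix i j assume ij: "i < ?N" "j < ?N"
      have "?B $$ (i, j) = c * B $$ (i, j) + c * e * cnj (B $$ (j, i))"
        "?B $$ (j, i) = c * B $$ (j, i) + c * e * cnj (B $$ (i, j))"
        using ij Bc by (simp_all add: distrib_left)
      moreover have "c * e * e = c" using ce(5) by (simp add: mult.assoc)
      ultimately show "?B $$ (i, j) = cnj (?B $$ (j, i))" using ce(3,4)
        by (simp add: add.commute)
    qed (use acts_onD(1)[OF ac] in simp)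
    show "?B \<in> observables q n \<Lambda>" by (rule acts_on_observables[OF sub q_pos ac sa])
    have "op_norm ?B \<le> cmod c * op_norm (B + e \<cdot>\<^sub>m mat_adjoint B)"
      by (rule op_norm_smult_le[of _ ?N ?N]) (use Bc dim_pos in auto)
    also have "op_norm (B + e \<cdot>\<^sub>m mat_adjoint B) \<le> op_norm B + op_norm (e \<cdot>\<^sub>m mat_adjoint B)"
      by (rule op_norm_add[of _ ?N ?N]) (use Bc dim_pos in auto)
    also have "op_norm (e \<cdot>\<^sub>m mat_adjoint B) \<le> cmod e * op_norm (mat_adjoint B)"
      by (rule op_norm_smult_le[of _ ?N ?N]) (use Bc dim_pos in auto)
    also have "op_norm (mat_adjoint B) \<le> op_norm B" by (rule op_norm_adjoint_le[OF Bc dim_pos])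
    finally show "op_norm ?B \<le> op_norm B" using ce by simp
  qed
  let ?B1 = "(1 / 2) \<cdot>\<^sub>m (B + 1 \<cdot>\<^sub>m mat_adjoint B)"
  let ?B2 = "(- \<i> / 2) \<cdot>\<^sub>m (B + (-1) \<cdot>\<^sub>m mat_adjoint B)"
  have "B = ?B1 + \<i> \<cdot>\<^sub>m ?B2"
    using Bc by (intro eq_matI) (auto simp: field_simps)
  moreover have "?B1 \<in> observables q n \<Lambda> \<and> op_norm ?B1 \<le> op_norm B" by (rule part) auto
  moreover have "?B2 \<in> observables q n \<Lambda> \<and> op_norm ?B2 \<le> op_norm B"
    by (rule part) (auto simp: norm_divide norm_mult)
  ultimately show ?thesis by blast
qed

text \<open>The covariance is linear in \<open>B\<close>, so clustering is applied to the two
  self-adjoint parts of \<open>B\<close> separately; this costs the factor 2.\<close>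

lemma covariance_le:
  assumes L: "\<Lambda>1 \<subseteq> {1..n}" "\<Lambda>2 \<subseteq> {1..n}" "\<Lambda>1 \<noteq> {}" "\<Lambda>2 \<noteq> {}" "\<Lambda>1 \<inter> \<Lambda>2 = {}"
    and far: "\<And>x y. x \<in> \<Lambda>1 \<Longrightarrow> y \<in> \<Lambda>2 \<Longrightarrow> r \<le> D x y"
    and h: "h \<in> observables q n \<Lambda>1" and B: "B \<in> acts_on q n \<Lambda>2"
  shows "cmod (tr (state * (h * B)) - tr (state * h) * tr (state * B))
    \<le> 2 * C * op_norm h * op_norm B * exp (- r / \<xi>)"
proof -
  let ?N = "q ^ n"
  have hc: "h \<in> carrier_mat ?N ?N" by (rule observables_carrier[OF h])
  have fin: "finite \<Lambda>1" "finite \<Lambda>2" using L(1,2) finite_subset by blast+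
  let ?F = "\<lambda>B. tr (state * (h * B)) - tr (state * h) * tr (state * B)"
  have "{D x y |x y. x \<in> \<Lambda>1 \<and> y \<in> \<Lambda>2} = (\<lambda>(x, y). D x y) ` (\<Lambda>1 \<times> \<Lambda>2)" by auto
  then have "finite {D x y |x y. x \<in> \<Lambda>1 \<and> y \<in> \<Lambda>2}" using fin by simp
  then have "r \<le> region_dist D \<Lambda>1 \<Lambda>2"
    unfolding region_dist_def using L(3,4) far by (subst Min_ge_iff) auto
  then have ex: "exp (- region_dist D \<Lambda>1 \<Lambda>2 / \<xi>) \<le> exp (- r / \<xi>)"
    using xi_pos by (simp add: divide_right_mono)
  have F: "cmod (?F B') \<le> C * op_norm h * op_norm B * exp (- r / \<xi>)"
    if B': "B' \<in> observables q n \<Lambda>2" "op_norm B' \<le> op_norm B" for B'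
  proof -
    have "B' \<in> carrier_mat ?N ?N" by (rule observables_carrier[OF B'(1)])
    then have nn: "op_norm h \<ge> 0" "op_norm B' \<ge> 0" using op_norm_nonneg[OF _ dim_pos] hc by blast+
    have "cmod (?F B') \<le> C * op_norm h * op_norm B' * exp (- region_dist D \<Lambda>1 \<Lambda>2 / \<xi>)"
      using clustering L h B'(1) unfolding has_correlation_length_def by blast
    also have "\<dots> \<le> C * op_norm h * op_norm B * exp (- r / \<xi>)"
      using nn B'(2) C_pos ex by (intro mult_mono mult_nonneg_nonneg) auto
    finally show ?thesis .
  qed
  obtain B1 B2 where B12: "B1 \<in> observables q n \<Lambda>2" "B2 \<in> observables q n \<Lambda>2" "B = B1 + \<i> \<cdot>\<^sub>m B2"
    "op_norm B1 \<le> op_norm B" "op_norm B2 \<le> op_norm B" using self_adjoint_parts[OF B L(2)] by blast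
  have c: "B1 \<in> carrier_mat ?N ?N" "B2 \<in> carrier_mat ?N ?N"
    using observables_carrier B12(1,2) by blast+
  have hB: "h * B = h * B1 + \<i> \<cdot>\<^sub>m (h * B2)"
    unfolding B12(3) using mult_add_distrib_mat[OF hc c(1), of "\<i> \<cdot>\<^sub>m B2"] c mult_smult_distrib[OF hc c(2)] by simp
  have "tr (state * (h * B)) = tr (state * (h * B1)) + \<i> * tr (state * (h * B2))"
    unfolding hB using c hc by (simp add: tr_mult_add[OF state_carrier] tr_mult_smult[OF state_carrier] mult_carrier_mat[of _ ?N ?N _ ?N])
  moreover have "tr (state * B) = tr (state * B1) + \<i> * tr (state * B2)"
    unfolding B12(3) using c by (simp add: tr_mult_add[OF state_carrier] tr_mult_smult[OF state_carrier])
  ultimately have "?F B = ?F B1 + \<i> * ?F B2" by (simp add: algebra_simps)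
  then have "cmod (?F B) \<le> cmod (?F B1) + cmod (?F B2)"
    by (metis norm_ii norm_mult norm_triangle_ineq mult_1)
  also have "\<dots> \<le> C * op_norm h * op_norm B * exp (- r / \<xi>) + C * op_norm h * op_norm B * exp (- r / \<xi>)"
    by (rule add_mono[OF F[OF B12(1,4)] F[OF B12(2,5)]])
  finally show ?thesis by (simp add: mult_ac)
qed

definition centered :: "complex mat \<Rightarrow> complex mat" where
  "centered h = h + (- tr (state * h)) \<cdot>\<^sub>m 1\<^sub>m (q ^ n)"

lemma centered_carrier: "h \<in> carrier_mat (q ^ n) (q ^ n) \<Longrightarrow> centered h \<in> carrier_mat (q ^ n) (q ^ n)"
  by (simp add: centered_def)

lemma centered_acts_on:
  "\<Lambda> \<subseteq> {1..n} \<Longrightarrow> h \<in> acts_on q n \<Lambda> \<Longrightarrow> centered h \<in> acts_on q n \<Lambda>"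
  unfolding centered_def by (intro acts_on_add acts_on_smult acts_on_one)

lemma op_norm_centered_le:
  assumes "h \<in> carrier_mat (q ^ n) (q ^ n)"
  shows "op_norm (centered h) \<le> 2 * op_norm h"
proof -
  let ?N = "q ^ n"
  have "op_norm (centered h) \<le> op_norm h + op_norm ((- tr (state * h)) \<cdot>\<^sub>m 1\<^sub>m ?N)"
    unfolding centered_def by (rule op_norm_add[of _ ?N ?N]) (use assms dim_pos in auto)
  also have "op_norm ((- tr (state * h)) \<cdot>\<^sub>m 1\<^sub>m ?N) \<le> cmod (- tr (state * h)) * op_norm (1\<^sub>m ?N)"
    by (rule op_norm_smult_le[of _ ?N ?N]) (use dim_pos in auto)
  also have "\<dots> \<le> cmod (tr (state * h)) * 1"
    using op_norm_one[OF dim_pos] by (simp add: mult_left_le)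
  also have "\<dots> \<le> op_norm h" using expectation_le_op_norm[OF assms] by simp
  finally show ?thesis by simp
qed

text \<open>Centring one factor turns an expectation into a covariance, the quantity that clustering
  bounds.\<close>

lemma tr_centered_mult:
  assumes h: "h \<in> carrier_mat (q ^ n) (q ^ n)" and B: "B \<in> carrier_mat (q ^ n) (q ^ n)"
  shows "tr (state * (centered h * B)) = tr (state * (h * B)) - tr (state * h) * tr (state * B)"
proof -
  let ?N = "q ^ n"
  have "centered h * B = h * B + (- tr (state * h)) \<cdot>\<^sub>m B"
    unfolding centered_def using h B
    by (simp add: add_mult_distrib_mat[of _ ?N ?N _ _ ?N] mult_smult_assoc_mat[of _ ?N ?N _ ?N])
  then show ?thesis using h B
    by (simp add: tr_mult_add[OF state_carrier] tr_mult_smult[OF state_carrier] mult_carrier_mat[of _ ?N ?N _ ?N])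
qed

text \<open>The isolated factor has support disjoint from all the others, hence commutes with them
  and can be moved to the front. What remains is its covariance with the product of the rest, an
  operator on the union of their supports.\<close>

lemma isolated_factor_le:
  fixes m :: nat
  assumes L: "\<And>l. l < m \<Longrightarrow> \<Lambda> l \<subseteq> {1..n} \<and> \<Lambda> l \<noteq> {}" and h: "\<And>l. l < m \<Longrightarrow> h l \<in> observables q n (\<Lambda> l)"
    and i: "i < m" and m: "m \<ge> 2" and "r \<ge> 0"
    and iso: "\<And>j x y. j < m \<Longrightarrow> j \<noteq> i \<Longrightarrow> x \<in> \<Lambda> i \<Longrightarrow> y \<in> \<Lambda> j \<Longrightarrow> r < D x y"
  shows "cmod (tr (state * lprod (q ^ n) (map (\<lambda>l. centered (h l)) [0..<m])))
    \<le> C * exp (- r / \<xi>) * (\<Prod>l<m. 2 * op_norm (h l))"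
proof -
  let ?N = "q ^ n"
  define rest where "rest = [0..<i] @ [Suc i..<m]"
  define \<Lambda>2 where "\<Lambda>2 = (\<Union>l\<in>set rest. \<Lambda> l)"
  have rest: "l < m \<and> l \<noteq> i" if "l \<in> set rest" for l using that i by (auto simp: rest_def)
  have split: "[0..<m] = [0..<i] @ i # [Suc i..<m]"
    using upt_add_eq_append[of 0 i "m - i"] upt_conv_Cons[OF i] i by simp
  have ha: "h l \<in> acts_on q n (\<Lambda> l)" if "l < m" for l
    using observables_acts_on(1)[OF _ q_pos h[OF that]] L[OF that] by blast
  have hc: "h l \<in> carrier_mat ?N ?N" if "l < m" for l by (rule acts_onD(1)[OF ha[OF that]])
  have nn: "op_norm (h l) \<ge> 0" if "l < m" for l by (rule op_norm_nonneg[OF hc[OF that] dim_pos])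
  have ca: "centered (h l) \<in> acts_on q n (\<Lambda> l)" if "l < m" for l
    using centered_acts_on ha L that by blast
  have cc: "centered (h l) \<in> carrier_mat ?N ?N" if "l < m" for l by (rule acts_onD(1)[OF ca[OF that]])
  \<comment> \<open>Disjointness comes from the distance: at a common spin the distance is 0,
    against the strict bound r < D x y with r \<ge> 0.\<close>
  have disj: "\<Lambda> i \<inter> \<Lambda> l = {}" if "l < m" "l \<noteq> i" for l
  proof (rule ccontr)
    assume "\<Lambda> i \<inter> \<Lambda> l \<noteq> {}"
    then obtain x where x: "x \<in> \<Lambda> i" "x \<in> \<Lambda> l" by blast
    then have "D x x = 0" using Metric_space.mdist_zero[OF metric] L[OF i] by blast
    then show False using iso[OF that x] \<open>r \<ge> 0\<close> by simp
  qed
  define B where "B = lprod ?N (map (\<lambda>l. centered (h l)) rest)"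
  have L2: "\<Lambda>2 \<subseteq> {1..n}" using L rest by (fastforce simp: \<Lambda>2_def)
  have "set (map (\<lambda>l. centered (h l)) rest) \<subseteq> acts_on q n \<Lambda>2"
  proof
    fix X assume "X \<in> set (map (\<lambda>l. centered (h l)) rest)"
    then obtain l where l: "l \<in> set rest" "X = centered (h l)" by auto
    then show "X \<in> acts_on q n \<Lambda>2"
      using acts_on_mono[OF _ L2 ca[of l]] rest[OF l(1)] by (auto simp: \<Lambda>2_def)
  qed
  then have B: "B \<in> acts_on q n \<Lambda>2" unfolding B_def by (rule lprod_acts_on[OF q_pos L2])
  have "\<Lambda>2 \<noteq> {}"
  proof -
    \<comment> \<open>Some position other than \<open>i\<close>; it exists because m \<ge> 2, and it
      makes the second region nonempty, as the definition of the correlation length demands.\<close>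
    define l where "l = (if i = 0 then 1 else 0 :: nat)"
    have "l \<in> set rest" using i m by (auto simp: rest_def l_def)
    then show ?thesis using L[of l] rest[of l] by (auto simp: \<Lambda>2_def)
  qed
  moreover have "\<Lambda> i \<inter> \<Lambda>2 = {}" using disj rest by (fastforce simp: \<Lambda>2_def)
  moreover have "r \<le> D x y" if "x \<in> \<Lambda> i" "y \<in> \<Lambda>2" for x y
    using that iso rest by (fastforce simp: \<Lambda>2_def less_imp_le)
  ultimately have cov: "cmod (tr (state * (h i * B)) - tr (state * h i) * tr (state * B))
      \<le> 2 * C * op_norm (h i) * op_norm B * exp (- r / \<xi>)"
    using L[OF i] L2 h[OF i] B by (intro covariance_le) auto
  have "lprod ?N (map (\<lambda>l. centered (h l)) [0..<m]) = centered (h i) * B"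
    unfolding split B_def rest_def map_append list.map
  proof (rule lprod_move_front)
    show "centered (h i) \<in> carrier_mat ?N ?N" by (rule cc[OF i])
    show "set (map (\<lambda>l. centered (h l)) [0..<i]) \<subseteq> carrier_mat ?N ?N"
      "set (map (\<lambda>l. centered (h l)) [Suc i..<m]) \<subseteq> carrier_mat ?N ?N"
      using cc i by auto
    fix X assume "X \<in> set (map (\<lambda>l. centered (h l)) [0..<i])"
    then obtain l where l: "l < i" "X = centered (h l)" by auto
    have "l < m" "l \<noteq> i" using l i by auto
    then show "X * centered (h i) = centered (h i) * X"
      unfolding l(2) using disj[of l] L i by (intro acts_on_commute[OF q_pos _ _ _ ca ca]) auto
  qed
  then have "cmod (tr (state * lprod ?N (map (\<lambda>l. centered (h l)) [0..<m])))
      \<le> 2 * C * op_norm (h i) * op_norm B * exp (- r / \<xi>)"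
    using cov tr_centered_mult[OF hc[OF i] acts_onD(1)[OF B]] by simp
  also have "\<dots> \<le> 2 * C * op_norm (h i) * prod_list (map (\<lambda>l. 2 * op_norm (h l)) rest) * exp (- r / \<xi>)"
  proof (intro mult_right_mono mult_left_mono)
    have "op_norm B \<le> prod_list (map op_norm (map (\<lambda>l. centered (h l)) rest))"
      unfolding B_def by (rule op_norm_lprod[OF dim_pos]) (use cc rest in auto)
    also have "\<dots> \<le> prod_list (map (\<lambda>l. 2 * op_norm (h l)) rest)"
    proof -
      have "0 \<le> prod_list (map op_norm (map (\<lambda>l. centered (h l)) ls)) \<and>
        prod_list (map op_norm (map (\<lambda>l. centered (h l)) ls)) \<le> prod_list (map (\<lambda>l. 2 * op_norm (h l)) ls)"
        if "\<forall>l\<in>set ls. l < m" for ls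
        using that
      proof (induction ls)
        case (Cons l ls)
        then have "op_norm (centered (h l)) \<ge> 0" "op_norm (centered (h l)) \<le> 2 * op_norm (h l)"
          using op_norm_nonneg[OF cc dim_pos] op_norm_centered_le[OF hc] by auto
        then show ?case using Cons by (auto intro!: mult_mono)
      qed simp
      then show ?thesis using rest by blast
    qed
    finally show "op_norm B \<le> prod_list (map (\<lambda>l. 2 * op_norm (h l)) rest)" .
  qed (use C_pos nn[OF i] in auto)
  \<comment> \<open>The factor 2 of \<open>covariance_le\<close> serves as the one that the isolated
    position lacks, so the product runs over all positions and only C is left.\<close>
  also have "\<dots> = C * exp (- r / \<xi>) * prod_list (map (\<lambda>l. 2 * op_norm (h l)) [0..<m])"
    unfolding split rest_def by simp
  finally show ?thesis unfolding prod_list_map_upt .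
qed

lemma product_expectation_le:
  assumes h: "\<And>l. l < m \<Longrightarrow> h l \<in> carrier_mat (q ^ n) (q ^ n)"
  shows "cmod (tr (state * lprod (q ^ n) (map (\<lambda>l. centered (h l)) [0..<m]))) \<le> (\<Prod>l<m. 2 * op_norm (h l))"
proof -
  let ?N = "q ^ n"
  have cc: "centered (h l) \<in> carrier_mat ?N ?N" if "l < m" for l by (rule centered_carrier[OF h[OF that]])
  then have sub: "set (map (\<lambda>l. centered (h l)) [0..<m]) \<subseteq> carrier_mat ?N ?N" by auto
  have "cmod (tr (state * lprod ?N (map (\<lambda>l. centered (h l)) [0..<m]))) \<le> op_norm (lprod ?N (map (\<lambda>l. centered (h l)) [0..<m]))"
    by (rule expectation_le_op_norm[OF lprod_carrier[OF sub]])
  also have "\<dots> \<le> prod_list (map op_norm (map (\<lambda>l. centered (h l)) [0..<m]))"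
    by (rule op_norm_lprod[OF dim_pos sub])
  also have "\<dots> = (\<Prod>l<m. op_norm (centered (h l)))"
    by (simp only: map_map o_def prod_list_map_upt)
  also have "\<dots> \<le> (\<Prod>l<m. 2 * op_norm (h l))"
    using op_norm_nonneg[OF cc dim_pos] op_norm_centered_le[OF h] by (intro prod_mono) auto
  finally show ?thesis .
qed

end

section \<open>The moment bound for sums of centred local observables\<close>

context clustering_state
begin

definition mat_sum :: "nat set set \<Rightarrow> (nat set \<Rightarrow> complex mat) \<Rightarrow> complex mat" where
  "mat_sum S g = mat (q ^ n) (q ^ n) (\<lambda>(i, j). \<Sum>\<Lambda>\<in>S. g \<Lambda> $$ (i, j))"

lemma mat_sum_carrier: "mat_sum S g \<in> carrier_mat (q ^ n) (q ^ n)"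
  by (simp add: mat_sum_def)

lemma mat_sum_self_adjoint:
  assumes "\<And>\<Lambda>. \<Lambda> \<in> S \<Longrightarrow> g \<Lambda> \<in> self_adjoint (q ^ n)"
  shows "mat_sum S g \<in> self_adjoint (q ^ n)"
  unfolding self_adjoint_iff
proof (intro conjI allI impI mat_sum_carrier)
  fix i j assume ij: "i < q ^ n" "j < q ^ n"
  have "(\<Sum>\<Lambda>\<in>S. g \<Lambda> $$ (i, j)) = (\<Sum>\<Lambda>\<in>S. cnj (g \<Lambda> $$ (j, i)))"
    using assms ij unfolding self_adjoint_iff by (intro sum.cong) blast+
  then show "mat_sum S g $$ (i, j) = cnj (mat_sum S g $$ (j, i))"
    using ij by (simp add: mat_sum_def)
qed

text \<open>Double counting of the pairs of a set and one of its spins. It bounds the total weight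
  of the nonempty sets by n, and later that of the sets with more than L spins by n / L.\<close>

lemma sum_local_le:
  assumes S: "\<And>\<Lambda>. \<Lambda> \<in> S \<Longrightarrow> \<Lambda> \<subseteq> {1..n} \<and> \<Lambda> \<noteq> {}"
    and w: "\<And>\<Lambda>. w \<Lambda> \<ge> (0::real)"
    and loc: "\<And>x. x \<in> {1..n} \<Longrightarrow> (\<Sum>\<Lambda> | \<Lambda> \<in> S \<and> x \<in> \<Lambda>. w \<Lambda>) \<le> 1"
  shows "(\<Sum>\<Lambda>\<in>S. real (card \<Lambda>) * w \<Lambda>) \<le> real n"
proof -
  have "S \<subseteq> Pow {1..n}" using S by auto
  then have fin: "finite S" using finite_subset by blast
  have "(\<Sum>\<Lambda>\<in>S. real (card \<Lambda>) * w \<Lambda>) = (\<Sum>\<Lambda>\<in>S. \<Sum>x | x \<in> {1..n} \<and> x \<in> \<Lambda>. w \<Lambda>)"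
  proof (intro sum.cong refl)
    fix \<Lambda> assume "\<Lambda> \<in> S"
    then have "{x. x \<in> {1..n} \<and> x \<in> \<Lambda>} = \<Lambda>" using S by blast
    then show "real (card \<Lambda>) * w \<Lambda> = (\<Sum>x | x \<in> {1..n} \<and> x \<in> \<Lambda>. w \<Lambda>)" by simp
  qed
  also have "\<dots> = (\<Sum>x\<in>{1..n}. \<Sum>\<Lambda> | \<Lambda> \<in> S \<and> x \<in> \<Lambda>. w \<Lambda>)"
    by (rule sum.swap_restrict) (use fin in auto)
  also have "\<dots> \<le> (\<Sum>x\<in>{1..n}. 1)" by (intro sum_mono loc)
  finally show ?thesis by simp
qed

text \<open>The first summand comes from the products in which every factor is close to another one,
  the second from those with an isolated factor. Centring at most doubles norms, so the weights in
  the combinatorial estimate are 2 |g|.\<close>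

theorem moment_bound:
  fixes g :: "nat set \<Rightarrow> complex mat" and h L :: nat and b r :: real
  defines "S \<equiv> {\<Lambda>. \<Lambda> \<subseteq> {1..n} \<and> \<Lambda> \<noteq> {} \<and> card \<Lambda> \<le> L}"
  assumes g: "\<And>\<Lambda>. \<Lambda> \<in> S \<Longrightarrow> g \<Lambda> \<in> observables q n \<Lambda>"
    and loc: "\<And>x. x \<in> {1..n} \<Longrightarrow> (\<Sum>\<Lambda> | \<Lambda> \<in> S \<and> x \<in> \<Lambda>. op_norm (g \<Lambda>)) \<le> 1"
    and ball: "\<And>v. v \<in> {1..n} \<Longrightarrow> real (card (Metric_space.mcball {1..n} D v r)) \<le> b"
    and r: "r \<ge> 0" and b: "b \<ge> 0" and Kn: "real L * b \<le> real n" and h: "h \<ge> 1"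
  shows "cmod (tr (state * (mat_sum S (\<lambda>\<Lambda>. centered (g \<Lambda>))) ^\<^sub>m (2 * h)))
    \<le> (4 * real (2 * h)) ^ (2 * h) * (real n * (real L * b)) ^ h + C * exp (- r / \<xi>) * (2 * real n) ^ (2 * h)"
proof -
  let ?N = "q ^ n"
  interpret ms: Metric_space "{1..n}" D by (rule metric)
  \<comment> \<open>Extended by 0 outside \<open>S\<close>, since the combinatorial lemmas ask for
    nonnegative weights everywhere.\<close>
  define w where "w \<Lambda> = (if \<Lambda> \<in> S then op_norm (g \<Lambda>) else 0)" for \<Lambda>
  define c where "c \<Lambda> \<Lambda>' \<longleftrightarrow> (\<exists>x\<in>\<Lambda>. \<exists>y\<in>\<Lambda>'. D x y \<le> r)" for \<Lambda> \<Lambda>'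
  have S: "\<Lambda> \<subseteq> {1..n} \<and> \<Lambda> \<noteq> {}" "card \<Lambda> \<le> L" if "\<Lambda> \<in> S" for \<Lambda> using that by (auto simp: S_def)
  have "S \<subseteq> Pow {1..n}" by (auto simp: S_def)
  then have finS: "finite S" using finite_subset by blast
  have gc: "g \<Lambda> \<in> carrier_mat ?N ?N" if "\<Lambda> \<in> S" for \<Lambda> by (rule observables_carrier[OF g[OF that]])
  have cc: "centered (g \<Lambda>) \<in> carrier_mat ?N ?N" if "\<Lambda> \<in> S" for \<Lambda> by (rule centered_carrier[OF gc[OF that]])
  have w: "w \<Lambda> \<ge> 0" for \<Lambda> using op_norm_nonneg[OF gc dim_pos] by (simp add: w_def)
  have locw: "(\<Sum>\<Lambda> | \<Lambda> \<in> S \<and> x \<in> \<Lambda>. w \<Lambda>) \<le> 1" if "x \<in> {1..n}" for x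
    using loc[OF that] by (simp add: w_def)
  have "(\<Sum>\<Lambda>\<in>S. w \<Lambda>) \<le> (\<Sum>\<Lambda>\<in>S. real (card \<Lambda>) * w \<Lambda>)"
  proof (rule sum_mono)
    fix \<Lambda> assume "\<Lambda> \<in> S"
    then have "finite \<Lambda>" "\<Lambda> \<noteq> {}" using S finite_subset[of \<Lambda> "{1..n}"] by auto
    then have "real (card \<Lambda>) \<ge> 1" by (simp add: Suc_le_eq card_gt_0_iff)
    then show "w \<Lambda> \<le> real (card \<Lambda>) * w \<Lambda>" using w[of \<Lambda>] by (simp add: mult_le_cancel_right1)
  qed
  also have "\<dots> \<le> real n" using S w locw by (intro sum_local_le) auto
  finally have sumw: "(\<Sum>\<Lambda>\<in>S. w \<Lambda>) \<le> real n" .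
  \<comment> \<open>A set close to \<Lambda>' contains a spin from the union \<open>Q\<close> of the
    r-balls around the at most L spins of \<Lambda>'. \<open>Q\<close> has at most L b spins, and
    the sets through each of them weigh at most 1.\<close>
  have K: "(\<Sum>\<Lambda> | \<Lambda> \<in> S \<and> c \<Lambda> \<Lambda>'. w \<Lambda>) \<le> real L * b" if L': "\<Lambda>' \<in> S" for \<Lambda>'
  proof -
    have fin': "finite \<Lambda>'" "\<Lambda>' \<subseteq> {1..n}" using S[OF L'] finite_subset[of \<Lambda>' "{1..n}"] by auto
    define Q where "Q = (\<Union>y\<in>\<Lambda>'. ms.mcball y r)"
    have Q: "Q \<subseteq> {1..n}" unfolding Q_def using ms.mcball_subset_mspace by blast
    have "real (card Q) \<le> (\<Sum>y\<in>\<Lambda>'. real (card (ms.mcball y r)))"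
      unfolding Q_def using card_UN_le[OF fin'(1), of "\<lambda>y. ms.mcball y r"]
      by (metis of_nat_le_iff of_nat_sum)
    also have "\<dots> \<le> (\<Sum>y\<in>\<Lambda>'. b)" using fin' by (intro sum_mono ball) auto
    also have "\<dots> \<le> real L * b" using S(2)[OF L'] b by (simp add: mult_right_mono)
    finally have cardQ: "real (card Q) \<le> real L * b" .
    have "{\<Lambda>. \<Lambda> \<in> S \<and> c \<Lambda> \<Lambda>'} \<subseteq> (\<Union>x\<in>Q. {\<Lambda>. \<Lambda> \<in> S \<and> x \<in> \<Lambda>})"
    proof
      fix \<Lambda> assume "\<Lambda> \<in> {\<Lambda>. \<Lambda> \<in> S \<and> c \<Lambda> \<Lambda>'}"
      then obtain x y where xy: "\<Lambda> \<in> S" "x \<in> \<Lambda>" "y \<in> \<Lambda>'" "D x y \<le> r" by (auto simp: c_def)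
      then have "x \<in> {1..n}" "y \<in> {1..n}" using S(1)[OF xy(1)] fin' by auto
      then have "x \<in> ms.mcball y r" using xy(4) ms.commute[of x y] unfolding ms.in_mcball by simp
      then show "\<Lambda> \<in> (\<Union>x\<in>Q. {\<Lambda>. \<Lambda> \<in> S \<and> x \<in> \<Lambda>})" using xy by (auto simp: Q_def)
    qed
    then have "(\<Sum>\<Lambda> | \<Lambda> \<in> S \<and> c \<Lambda> \<Lambda>'. w \<Lambda>) \<le> (\<Sum>\<Lambda>\<in>(\<Union>x\<in>Q. {\<Lambda>. \<Lambda> \<in> S \<and> x \<in> \<Lambda>}). w \<Lambda>)"
      using finS w Q finite_subset[OF Q] by (intro sum_mono2) auto
    also have "\<dots> \<le> (\<Sum>x\<in>Q. \<Sum>\<Lambda> | \<Lambda> \<in> S \<and> x \<in> \<Lambda>. w \<Lambda>)"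
      using finS w finite_subset[OF Q] by (intro sum_UN_le) auto
    also have "\<dots> \<le> (\<Sum>x\<in>Q. 1)" using Q by (intro sum_mono locw) auto
    finally show ?thesis using cardQ by simp
  qed
  define m where "m = 2 * h"
  define t where "t \<tau> = tr (state * lprod ?N (map (\<lambda>l. centered (g (\<tau> l))) [0..<m]))" for \<tau> :: "nat \<Rightarrow> nat set"
  define X where "X = mat_sum S (\<lambda>\<Lambda>. centered (g \<Lambda>))"
  have Xc: "X \<in> carrier_mat ?N ?N" by (simp add: X_def mat_sum_carrier)
  have "(X ^\<^sub>m m) $$ (i, j) = (\<Sum>\<tau>\<in>{..<m} \<rightarrow>\<^sub>E S. lprod ?N (map (\<lambda>l. centered (g (\<tau> l))) [0..<m]) $$ (i, j))"
    if "i < ?N" "j < ?N" for i j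
    by (rule pow_mat_expand[OF Xc finS cc _ that]) (simp_all add: X_def mat_sum_def)
  then have "tr (state * X ^\<^sub>m m) = (\<Sum>\<tau>\<in>{..<m} \<rightarrow>\<^sub>E S. t \<tau>)"
    unfolding t_def
  proof (intro tr_mult_sum[OF state_carrier pow_mat_carrier[OF Xc]])
    fix \<tau> assume \<tau>: "\<tau> \<in> {..<m} \<rightarrow>\<^sub>E S"
    show "lprod ?N (map (\<lambda>l. centered (g (\<tau> l))) [0..<m]) \<in> carrier_mat ?N ?N"
    proof (rule lprod_carrier, rule subsetI)
      fix Z assume "Z \<in> set (map (\<lambda>l. centered (g (\<tau> l))) [0..<m])"
      then obtain l where "l < m" "Z = centered (g (\<tau> l))" by auto
      then show "Z \<in> carrier_mat ?N ?N" using cc[OF PiE_mem[OF \<tau>, of l]] by simp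
    qed
  qed
  then have "cmod (tr (state * X ^\<^sub>m m)) \<le> (\<Sum>\<tau>\<in>{..<m} \<rightarrow>\<^sub>E S. cmod (t \<tau>))"
    by (simp add: norm_sum)
  \<comment> \<open>Tuples without an isolated entry get the trivial norm bound. The clustering term
    is charged to every tuple, so that its sum over all tuples factorizes.\<close>
  also have "\<dots> \<le> (\<Sum>\<tau>\<in>{..<m} \<rightarrow>\<^sub>E S. (if \<forall>i<m. \<exists>j<m. j \<noteq> i \<and> c (\<tau> i) (\<tau> j) then \<Prod>l<m. 2 * w (\<tau> l) else 0)
      + C * exp (- r / \<xi>) * (\<Prod>l<m. 2 * w (\<tau> l)))"
  proof (rule sum_mono)
    fix \<tau> assume \<tau>: "\<tau> \<in> {..<m} \<rightarrow>\<^sub>E S"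
    have pS: "\<tau> l \<in> S" if "l < m" for l using PiE_mem[OF \<tau>] that by simp
    have pw: "(\<Prod>l<m. 2 * op_norm (g (\<tau> l))) = (\<Prod>l<m. 2 * w (\<tau> l))"
      by (intro prod.cong) (auto simp: w_def pS)
    have nn: "(\<Prod>l<m. 2 * w (\<tau> l)) \<ge> 0" by (intro prod_nonneg) (simp add: w)
    show "cmod (t \<tau>) \<le> (if \<forall>i<m. \<exists>j<m. j \<noteq> i \<and> c (\<tau> i) (\<tau> j) then \<Prod>l<m. 2 * w (\<tau> l) else 0)
      + C * exp (- r / \<xi>) * (\<Prod>l<m. 2 * w (\<tau> l))"
    proof (cases "\<forall>i<m. \<exists>j<m. j \<noteq> i \<and> c (\<tau> i) (\<tau> j)")
      case True
      have "cmod (t \<tau>) \<le> (\<Prod>l<m. 2 * w (\<tau> l))"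
        unfolding t_def pw[symmetric] using gc pS by (intro product_expectation_le) auto
      moreover have "0 \<le> C * exp (- r / \<xi>) * (\<Prod>l<m. 2 * w (\<tau> l))" using nn C_pos by simp
      ultimately show ?thesis unfolding if_P[OF True] by linarith
    next
      case False
      then obtain i where i: "i < m" "\<And>j. j < m \<Longrightarrow> j \<noteq> i \<Longrightarrow> \<not> c (\<tau> i) (\<tau> j)" by blast
      have "cmod (t \<tau>) \<le> C * exp (- r / \<xi>) * (\<Prod>l<m. 2 * w (\<tau> l))"
        unfolding t_def pw[symmetric]
      proof (rule isolated_factor_le[where \<Lambda> = \<tau> and i = i and r = r])
        show "2 \<le> m" using h by (simp add: m_def)
        fix j x y assume "j < m" "j \<noteq> i" "x \<in> \<tau> i" "y \<in> \<tau> j"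
        then show "r < D x y" using i(2)[of j] by (force simp: c_def not_le)
      qed (use pS S(1) g i(1) r in auto)
      then show ?thesis by (simp only: if_not_P[OF False] add_0)
    qed
  qed
  also have "\<dots> = (\<Sum>\<tau> | \<tau> \<in> ({..<m} \<rightarrow>\<^sub>E S) \<and> (\<forall>i<m. \<exists>j<m. j \<noteq> i \<and> c (\<tau> i) (\<tau> j)). \<Prod>l<m. 2 * w (\<tau> l))
      + C * exp (- r / \<xi>) * (\<Sum>\<tau>\<in>{..<m} \<rightarrow>\<^sub>E S. \<Prod>l<m. 2 * w (\<tau> l))"
    unfolding sum.distrib sum_distrib_left[symmetric]
    using finite_PiE[of "{..<m}" "\<lambda>_. S"] finS by (subst sum.inter_filter[symmetric]) auto
  also have "\<dots> \<le> (4 * real m) ^ m * (real n * (real L * b)) ^ h + C * exp (- r / \<xi>) * (2 * real n) ^ m"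
  proof (rule add_mono)
    \<comment> \<open>One factor 2^m belongs to the count of dominating sets, the other to the
      doubled weights.\<close>
    have four: "(4 * real m) ^ m = (2 * real m) ^ m * 2 ^ m"
      unfolding power_mult_distrib[symmetric] by (rule arg_cong) simp
    have "(\<Sum>\<tau> | \<tau> \<in> ({..<m} \<rightarrow>\<^sub>E S) \<and> (\<forall>i<m. \<exists>j<m. j \<noteq> i \<and> c (\<tau> i) (\<tau> j)). \<Prod>l<m. 2 * w (\<tau> l))
        \<le> (2 * real m) ^ m * ((2 * real n) * (2 * (real L * b))) ^ h"
      unfolding m_def
    proof (rule sum_prod_no_isolated_le[OF finS])
      show "c y x" if "c x y" for x y using that unfolding c_def by (metis ms.commute)
      show "(\<Sum>x\<in>S. 2 * w x) \<le> 2 * real n" using sumw by (simp flip: sum_distrib_left)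
      show "(\<Sum>x | x \<in> S \<and> c x y. 2 * w x) \<le> 2 * (real L * b)" if "y \<in> S" for y
        using K[OF that] by (simp flip: sum_distrib_left)
    qed (use w b Kn in auto)
    also have "((2 * real n) * (2 * (real L * b))) ^ h = 2 ^ m * (real n * (real L * b)) ^ h"
      unfolding m_def by (simp add: power_mult_distrib power_mult power2_eq_square)
    finally show "(\<Sum>\<tau> | \<tau> \<in> ({..<m} \<rightarrow>\<^sub>E S) \<and> (\<forall>i<m. \<exists>j<m. j \<noteq> i \<and> c (\<tau> i) (\<tau> j)). \<Prod>l<m. 2 * w (\<tau> l))
        \<le> (4 * real m) ^ m * (real n * (real L * b)) ^ h"
      by (simp only: four mult.assoc)
    have "(\<Sum>\<tau>\<in>{..<m} \<rightarrow>\<^sub>E S. \<Prod>l<m. 2 * w (\<tau> l)) = (\<Prod>l<m. \<Sum>\<Lambda>\<in>S. 2 * w \<Lambda>)"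
      by (rule prod_sum_PiE[symmetric]) (use finS in auto)
    also have "\<dots> \<le> (2 * real n) ^ m"
      using sumw w by (simp add: power_mono sum_nonneg flip: sum_distrib_left)
    finally show "C * exp (- r / \<xi>) * (\<Sum>\<tau>\<in>{..<m} \<rightarrow>\<^sub>E S. \<Prod>l<m. 2 * w (\<tau> l))
        \<le> C * exp (- r / \<xi>) * (2 * real n) ^ m" using C_pos by (intro mult_left_mono) auto
  qed
  finally show ?thesis unfolding X_def m_def .
qed

end

subsection \<open>Equivalence of ensembles\<close>

text \<open>The term of the empty set is a scalar, on which two states of trace one agree.\<close>

lemma acts_on_empty:
  assumes "X \<in> acts_on q n {}"
  shows "X = X $$ (0, 0) \<cdot>\<^sub>m 1\<^sub>m (q ^ n)"
proof (rule eq_matI)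
  note X = acts_onD[OF assms]
  fix i j assume "i < dim_row (X $$ (0, 0) \<cdot>\<^sub>m 1\<^sub>m (q ^ n))" "j < dim_col (X $$ (0, 0) \<cdot>\<^sub>m 1\<^sub>m (q ^ n))"
  then have ij: "i < q ^ n" "j < q ^ n" by auto
  show "X $$ (i, j) = (X $$ (0, 0) \<cdot>\<^sub>m 1\<^sub>m (q ^ n)) $$ (i, j)"
  proof (cases "i = j")
    case True
    have pos: "0 < q ^ n" using ij by linarith
    have "X $$ (i, i) = X $$ (0, 0)" by (rule X(3)[OF ij(1,1) pos pos]) (auto simp: agree_def)
    then show ?thesis using True ij by simp
  next
    case False
    then have "\<not> agree q ({1..n} - {}) i j"
      using spin_inject[OF ij] unfolding agree_def Diff_empty by blast
    then show ?thesis using False ij X(2)[OF ij] by simp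
  qed
qed (use acts_onD(1)[OF assms] in auto)

lemma tr_diff_mult:
  assumes "V \<in> carrier_mat N N" "W \<in> carrier_mat N N" "X \<in> carrier_mat N N"
  shows "tr ((V - W) * X) = tr (V * X) - tr (W * X)"
  unfolding tr_mult[OF minus_carrier_mat[OF assms(2)] assms(3), of V] tr_mult[OF assms(1,3)] tr_mult[OF assms(2,3)]
    sum_subtractf[symmetric]
  using assms by (intro sum.cong refl) (simp add: left_diff_distrib)

text \<open>All parameters for one fixed n. The order of the moment is m = \<open>2 ^ Suc s\<close>,
  the domination constant is at most e^m, and the radius is \<xi> m R. After the change of state
  \<open>eps_ball\<close> reduces the products of close factors to (\<epsilon> n)^m, and
  \<open>eps_tail\<close> does the same for those with an isolated factor.\<close>

locale dominated_clustering_state = clustering_state q n U p D \<xi> C + Q: diagonal_state "q ^ n" U p'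
  for q n U p D \<xi> C p' +
  fixes s :: nat and R b \<epsilon> :: real and L :: nat
  assumes dominated: "k < q ^ n \<Longrightarrow> p' k \<le> exp (2 ^ Suc s) * p k"
    and ball_le: "v \<in> {1..n} \<Longrightarrow> real (card (Metric_space.mcball {1..n} D v (\<xi> * 2 ^ Suc s * R))) \<le> b"
    and b_nonneg: "b \<ge> 0" and R_nonneg: "R \<ge> 0" and eps: "\<epsilon> > 0" "\<epsilon> \<le> 1"
    and eps_ball: "(4 * exp 1 * 2 ^ Suc s)\<^sup>2 * (real L * b) \<le> \<epsilon>\<^sup>2 * real n"
    and eps_tail: "2 * exp 1 * (C + 1) * exp (- R) \<le> \<epsilon>"
    and L_pos: "L \<ge> 1" and n_pos: "n \<ge> 1"
begin

text \<open>Everything is an m-th power up to constants: the m-th power of the deviation is at most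
  2 (\<epsilon> n)^m, hence at most (2 \<epsilon> n)^m, and the roots are compared by
  contradiction.\<close>

lemma local_deviation_le:
  fixes g :: "nat set \<Rightarrow> complex mat"
  defines "S \<equiv> {\<Lambda>. \<Lambda> \<subseteq> {1..n} \<and> \<Lambda> \<noteq> {} \<and> card \<Lambda> \<le> L}"
  assumes g: "\<And>\<Lambda>. \<Lambda> \<in> S \<Longrightarrow> g \<Lambda> \<in> observables q n \<Lambda>"
    and loc: "\<And>x. x \<in> {1..n} \<Longrightarrow> (\<Sum>\<Lambda> | \<Lambda> \<in> S \<and> x \<in> \<Lambda>. op_norm (g \<Lambda>)) \<le> 1"
  shows "\<bar>Re (tr (Q.state * mat_sum S (\<lambda>\<Lambda>. centered (g \<Lambda>))))\<bar> \<le> 2 * \<epsilon> * real n"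
proof (rule ccontr)
  define h m where "h = (2::nat) ^ s" and "m = (2::nat) ^ Suc s"
  have hm: "m = 2 * h" "h \<ge> 1" "m \<ge> 1" by (simp_all add: h_def m_def)
  have mr: "(2::real) ^ Suc s = real m" by (simp add: m_def)
  define X where "X = mat_sum S (\<lambda>\<Lambda>. centered (g \<Lambda>))"
  define r where "r = \<xi> * real m * R"
  define K where "K = real L * b"
  define e where "e = exp (1::real)"
  have K0: "K \<ge> 0" using b_nonneg by (simp add: K_def)
  have e: "e \<ge> 1" "exp (real m) = e ^ m" by (simp_all add: e_def exp_of_nat_mult[symmetric])
  have eK: "(4 * e * real m)\<^sup>2 * K \<le> \<epsilon>\<^sup>2 * real n" using eps_ball by (simp only: mr K_def e_def)
  have "K \<le> real n"
  proof -
    have "1 * 1 \<le> e * real m" by (rule mult_mono) (use e hm in auto)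
    then have "1\<^sup>2 \<le> (4 * e * real m)\<^sup>2" by (intro power_mono) auto
    then have "K \<le> (4 * e * real m)\<^sup>2 * K" using K0 by (simp add: mult_le_cancel_right1)
    also have "\<dots> \<le> 1 * real n" using eK eps
      by (meson mult_right_mono of_nat_0_le_iff order_trans power_le_one less_imp_le)
    finally show ?thesis by simp
  qed
  have Sg: "centered (g \<Lambda>) \<in> self_adjoint (q ^ n)" if L: "\<Lambda> \<in> S" for \<Lambda>
  proof -
    have sa: "g \<Lambda> \<in> self_adjoint (q ^ n)"
      using observables_acts_on(2)[OF _ q_pos g[OF L]] L by (auto simp: S_def)
    have real: "cnj (tr (state * g \<Lambda>)) = tr (state * g \<Lambda>)" unfolding tr_self_adjoint[OF sa] by simp
    show ?thesis
      unfolding self_adjoint_iff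
    proof (intro conjI allI impI)
      fix i j assume ij: "i < q ^ n" "j < q ^ n"
      have "g \<Lambda> $$ (i, j) = cnj (g \<Lambda> $$ (j, i))" using sa ij unfolding self_adjoint_iff by blast
      then show "centered (g \<Lambda>) $$ (i, j) = cnj (centered (g \<Lambda>) $$ (j, i))"
        using ij by (simp add: centered_def real)
    qed (use centered_carrier[OF observables_carrier[OF g[OF L]]] in simp)
  qed
  have Xsa: "X \<in> self_adjoint (q ^ n)" unfolding X_def by (rule mat_sum_self_adjoint[OF Sg])
  define T where "T = \<bar>Re (tr (Q.state * X))\<bar>"
  have dp: "diagonal_state (q ^ n) U p" by unfold_locales
  have dq: "diagonal_state (q ^ n) U p'" by unfold_locales
  \<comment> \<open>The change of state: the microcanonical deviation is now bounded by a Gibbs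
    moment, to which clustering applies.\<close>
  have "T ^ m \<le> exp (2 ^ Suc s) * cmod (tr (state * X ^\<^sub>m m))"
    unfolding T_def m_def by (rule dominated_state_moment[OF dp dq dominated Xsa])
  also have "exp (2 ^ Suc s) = e ^ m" unfolding mr e(2) ..
  also have "e ^ m * cmod (tr (state * X ^\<^sub>m m))
      \<le> e ^ m * ((4 * real m) ^ m * (real n * K) ^ h + C * exp (- r / \<xi>) * (2 * real n) ^ m)"
  proof (rule mult_left_mono)
    show "cmod (tr (state * X ^\<^sub>m m)) \<le> (4 * real m) ^ m * (real n * K) ^ h + C * exp (- r / \<xi>) * (2 * real n) ^ m"
      unfolding X_def hm(1) S_def K_def
    proof (rule moment_bound)
      show "real (card (Metric_space.mcball {1..n} D v r)) \<le> b" if "v \<in> {1..n}" for v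
        using ball_le[OF that] unfolding mr r_def .
      show "r \<ge> 0" using xi_pos R_nonneg by (simp add: r_def)
      show "real L * b \<le> real n" using \<open>K \<le> real n\<close> by (simp add: K_def)
    qed (use g loc b_nonneg hm(2) in \<open>auto simp: S_def\<close>)
  qed (use e in auto)
  also have "\<dots> = ((4 * e * real m)\<^sup>2 * K * real n) ^ h + C * (2 * e * exp (- R) * real n) ^ m"
  proof -
    \<comment> \<open>The radius was taken proportional to m exactly for this: the tail becomes an
      m-th power and can be joined with the other factors.\<close>
    have "exp (- r / \<xi>) = exp (- R) ^ m"
      using xi_pos by (simp add: r_def exp_of_nat_mult[symmetric] mult_ac)
    moreover have "e ^ m * ((4 * real m) ^ m * (real n * K) ^ h) = ((4 * e * real m)\<^sup>2 * K * real n) ^ h"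
    proof -
      have pw: "y ^ m = (y\<^sup>2) ^ h" for y :: real by (simp add: hm(1) power_mult)
      have "e ^ m * ((4 * real m) ^ m * (real n * K) ^ h) = (4 * e * real m) ^ m * (real n * K) ^ h"
        by (simp only: power_mult_distrib mult_ac)
      also have "\<dots> = ((4 * e * real m)\<^sup>2 * K * real n) ^ h"
        unfolding pw by (simp only: power_mult_distrib mult_ac)
      finally show ?thesis .
    qed
    moreover have "e ^ m * (C * exp (- R) ^ m * (2 * real n) ^ m) = C * (2 * e * exp (- R) * real n) ^ m"
      by (simp only: power_mult_distrib mult_ac)
    ultimately show ?thesis by (simp only: distrib_left)
  qed
  also have "\<dots> \<le> (\<epsilon> * real n) ^ m + (\<epsilon> * real n) ^ m"
  proof (rule add_mono)
    have "((4 * e * real m)\<^sup>2 * K * real n) ^ h \<le> (\<epsilon>\<^sup>2 * real n * real n) ^ h"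
      using eK K0 by (intro power_mono mult_right_mono) auto
    also have "\<dots> = (\<epsilon> * real n) ^ m"
      unfolding hm(1) by (simp add: power_mult_distrib power_mult power2_eq_square)
    finally show "((4 * e * real m)\<^sup>2 * K * real n) ^ h \<le> (\<epsilon> * real n) ^ m" .
    \<comment> \<open>The constant C is moved into the m-th power, which explains the factor C + 1
      in \<open>eps_tail\<close>.\<close>
    have "C * (2 * e * exp (- R) * real n) ^ m \<le> (C + 1) ^ m * (2 * e * exp (- R) * real n) ^ m"
    proof (rule mult_right_mono)
      have "C + 1 \<le> (C + 1) ^ m" using C_pos hm(3) by (intro self_le_power) auto
      then show "C \<le> (C + 1) ^ m" by simp
    qed (use e in auto)
    also have "\<dots> = (2 * e * (C + 1) * exp (- R) * real n) ^ m"
      by (simp only: power_mult_distrib mult_ac)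
    also have "\<dots> \<le> (\<epsilon> * real n) ^ m"
      using eps_tail e C_pos by (intro power_mono mult_right_mono) (auto simp: e_def)
    finally show "C * (2 * e * exp (- R) * real n) ^ m \<le> (\<epsilon> * real n) ^ m" .
  qed
  also have "\<dots> = 2 * (\<epsilon> * real n) ^ m" by simp
  also have "\<dots> \<le> 2 ^ m * (\<epsilon> * real n) ^ m"
    using hm(3) eps self_le_power[of "2::real" m] by (intro mult_right_mono) auto
  also have "\<dots> = (2 * \<epsilon> * real n) ^ m" by (simp only: power_mult_distrib mult_ac)
  finally have le: "T ^ m \<le> (2 * \<epsilon> * real n) ^ m" .
  assume "\<not> \<bar>Re (tr (Q.state * mat_sum S (\<lambda>\<Lambda>. centered (g \<Lambda>))))\<bar> \<le> 2 * \<epsilon> * real n"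
  then have "2 * \<epsilon> * real n < T" unfolding T_def X_def by simp
  then have "(2 * \<epsilon> * real n) ^ m < T ^ m"
    using eps hm(3) by (intro power_strict_mono) auto
  then show False using le by simp
qed

text \<open>The decomposition is split by the size of the sets: the empty set contributes nothing,
  sizes from 1 to L fall under \<open>local_deviation_le\<close>, and larger sets are so few in
  weight that the norm bound suffices.\<close>

lemma expectation_diff_le:
  assumes dec: "decomposes q n {\<Lambda>. \<Lambda> \<subseteq> {1..n}} g G"
    and loc: "\<And>x. x \<in> {1..n} \<Longrightarrow> (\<Sum>\<Lambda> | \<Lambda> \<subseteq> {1..n} \<and> x \<in> \<Lambda>. op_norm (g \<Lambda>)) \<le> 1"
  shows "\<bar>Re (tr ((Q.state - state) * G))\<bar> \<le> (2 * \<epsilon> + 2 / real L) * real n"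
proof -
  let ?N = "q ^ n"
  define All where "All = {\<Lambda>. \<Lambda> \<subseteq> {1..n}}"
  define S where "S = {\<Lambda>. \<Lambda> \<subseteq> {1..n} \<and> \<Lambda> \<noteq> {} \<and> card \<Lambda> \<le> L}"
  define B where "B = {\<Lambda>. \<Lambda> \<subseteq> {1..n} \<and> L < card \<Lambda>}"
  have obs: "g \<Lambda> \<in> observables q n \<Lambda>" if "\<Lambda> \<in> All" for \<Lambda>
    using dec that by (auto simp: decomposes_def All_def)
  have gc: "g \<Lambda> \<in> carrier_mat ?N ?N" if "\<Lambda> \<in> All" for \<Lambda> by (rule observables_carrier[OF obs[OF that]])
  have G: "G = mat_sum All g" using dec by (simp add: decomposes_def mat_sum_def All_def)
  have sub: "S \<subseteq> All" "B \<subseteq> All" by (auto simp: All_def S_def B_def)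
  have fin: "finite All" by (simp add: All_def)
  then have finSB: "finite S" "finite B" using sub finite_subset by blast+
  have onn: "op_norm (g \<Lambda>) \<ge> 0" if "\<Lambda> \<in> All" for \<Lambda> by (rule op_norm_nonneg[OF gc[OF that] dim_pos])
  define f where "f \<Lambda> = Re (tr (Q.state * g \<Lambda>) - tr (state * g \<Lambda>))" for \<Lambda>
  have Wsum: "tr (W * mat_sum A g') = (\<Sum>\<Lambda>\<in>A. tr (W * g' \<Lambda>))"
    if "W \<in> carrier_mat ?N ?N" "\<And>\<Lambda>. \<Lambda> \<in> A \<Longrightarrow> g' \<Lambda> \<in> carrier_mat ?N ?N" for W A g'
    by (rule tr_mult_sum[OF that(1) mat_sum_carrier that(2)]) (simp_all add: mat_sum_def)
  have "Re (tr ((Q.state - state) * G)) = (\<Sum>\<Lambda>\<in>All. f \<Lambda>)"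
    unfolding G tr_diff_mult[OF Q.state_carrier state_carrier mat_sum_carrier]
    by (simp add: Wsum[OF Q.state_carrier gc] Wsum[OF state_carrier gc] f_def sum_subtractf)
  also have "\<dots> = (\<Sum>\<Lambda>\<in>{{}} \<union> (S \<union> B). f \<Lambda>)"
    by (intro sum.cong refl) (auto simp: All_def S_def B_def)
  also have "\<dots> = f {} + (\<Sum>\<Lambda>\<in>S \<union> B. f \<Lambda>)"
    using finSB by (subst sum.union_disjoint) (auto simp: S_def B_def)
  also have "(\<Sum>\<Lambda>\<in>S \<union> B. f \<Lambda>) = (\<Sum>\<Lambda>\<in>S. f \<Lambda>) + (\<Sum>\<Lambda>\<in>B. f \<Lambda>)"
    using finSB by (intro sum.union_disjoint) (auto simp: S_def B_def)
  also have "f {} = 0"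
  proof -
    have "g {} \<in> acts_on q n {}" using observables_acts_on(1)[OF _ q_pos obs[of "{}"]] by (simp add: All_def)
    then have e: "g {} = g {} $$ (0, 0) \<cdot>\<^sub>m 1\<^sub>m ?N" by (rule acts_on_empty)
    have "tr (W * g {}) = g {} $$ (0, 0) * tr W" if "W \<in> carrier_mat ?N ?N" for W
      by (subst e) (use that in \<open>simp add: tr_mult_smult[OF that]\<close>)
    then show ?thesis using tr_state Q.tr_state state_carrier Q.state_carrier by (simp add: f_def)
  qed
  \<comment> \<open>Centring with respect to the Gibbs state absorbs the subtracted expectations,
    because the microcanonical state has trace one: a difference of two states becomes one
    expectation.\<close>
  also have "(\<Sum>\<Lambda>\<in>S. f \<Lambda>) = Re (tr (Q.state * mat_sum S (\<lambda>\<Lambda>. centered (g \<Lambda>))))"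
  proof -
    have cen: "tr (Q.state * centered (g \<Lambda>)) = tr (Q.state * g \<Lambda>) - tr (state * g \<Lambda>)" if "\<Lambda> \<in> S" for \<Lambda>
    proof -
      have "g \<Lambda> \<in> carrier_mat ?N ?N" using gc sub that by blast
      then show ?thesis
        unfolding centered_def using Q.state_carrier Q.tr_state
        by (simp add: tr_mult_add[OF Q.state_carrier] tr_mult_smult[OF Q.state_carrier])
    qed
    have "tr (Q.state * mat_sum S (\<lambda>\<Lambda>. centered (g \<Lambda>))) = (\<Sum>\<Lambda>\<in>S. tr (Q.state * centered (g \<Lambda>)))"
      by (rule Wsum[OF Q.state_carrier]) (use gc sub in \<open>auto intro: centered_carrier\<close>)
    then show ?thesis by (simp add: cen f_def)
  qed
  finally have eq: "Re (tr ((Q.state - state) * G))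
      = Re (tr (Q.state * mat_sum S (\<lambda>\<Lambda>. centered (g \<Lambda>)))) + (\<Sum>\<Lambda>\<in>B. f \<Lambda>)" by simp
  have locA: "(\<Sum>\<Lambda> | \<Lambda> \<in> A \<and> x \<in> \<Lambda>. op_norm (g \<Lambda>)) \<le> 1" if "A \<subseteq> All" "x \<in> {1..n}" for A x
  proof -
    have "(\<Sum>\<Lambda> | \<Lambda> \<in> A \<and> x \<in> \<Lambda>. op_norm (g \<Lambda>)) \<le> (\<Sum>\<Lambda> | \<Lambda> \<subseteq> {1..n} \<and> x \<in> \<Lambda>. op_norm (g \<Lambda>))"
      using that(1) fin onn by (intro sum_mono2) (auto simp: All_def)
    then show ?thesis using loc[OF that(2)] by linarith
  qed
  have small: "\<bar>Re (tr (Q.state * mat_sum S (\<lambda>\<Lambda>. centered (g \<Lambda>))))\<bar> \<le> 2 * \<epsilon> * real n"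
    unfolding S_def
  proof (rule local_deviation_le, unfold S_def[symmetric])
    show "g \<Lambda> \<in> observables q n \<Lambda>" if "\<Lambda> \<in> S" for \<Lambda> by (rule obs[OF subsetD[OF sub(1) that]])
    show "(\<Sum>\<Lambda> | \<Lambda> \<in> S \<and> x \<in> \<Lambda>. op_norm (g \<Lambda>)) \<le> 1" if "x \<in> {1..n}" for x
      by (rule locA[OF sub(1) that])
  qed
  define w where "w \<Lambda> = (if \<Lambda> \<in> All then op_norm (g \<Lambda>) else 0)" for \<Lambda>
  have "\<bar>\<Sum>\<Lambda>\<in>B. f \<Lambda>\<bar> \<le> (\<Sum>\<Lambda>\<in>B. \<bar>f \<Lambda>\<bar>)" by (rule sum_abs)
  also have "\<dots> \<le> (\<Sum>\<Lambda>\<in>B. 2 * w \<Lambda>)"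
  proof (rule sum_mono)
    fix \<Lambda> assume "\<Lambda> \<in> B"
    then have L: "\<Lambda> \<in> All" using sub by blast
    have "\<bar>f \<Lambda>\<bar> \<le> cmod (tr (Q.state * g \<Lambda>) - tr (state * g \<Lambda>))"
      unfolding f_def by (rule abs_Re_le_cmod)
    also have "\<dots> \<le> cmod (tr (Q.state * g \<Lambda>)) + cmod (tr (state * g \<Lambda>))" by (rule norm_triangle_ineq4)
    also have "\<dots> \<le> op_norm (g \<Lambda>) + op_norm (g \<Lambda>)"
      by (rule add_mono[OF Q.expectation_le_op_norm[OF gc[OF L]] expectation_le_op_norm[OF gc[OF L]]])
    finally show "\<bar>f \<Lambda>\<bar> \<le> 2 * w \<Lambda>" using L by (simp add: w_def)
  qed
  \<comment> \<open>Each of these sets has more than L spins, so weighting by the size and dividing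
    by L only increases the sum; the weighted sum is at most n by double counting.\<close>
  also have "\<dots> \<le> (\<Sum>\<Lambda>\<in>B. 2 / real L * (real (card \<Lambda>) * w \<Lambda>))"
  proof (rule sum_mono)
    fix \<Lambda> assume L: "\<Lambda> \<in> B"
    have "w \<Lambda> \<ge> 0" using onn by (simp add: w_def)
    then have "real L * w \<Lambda> \<le> real (card \<Lambda>) * w \<Lambda>" using L by (intro mult_right_mono) (auto simp: B_def)
    then show "2 * w \<Lambda> \<le> 2 / real L * (real (card \<Lambda>) * w \<Lambda>)"
      using L_pos by (simp add: field_simps)
  qed
  also have "\<dots> = 2 / real L * (\<Sum>\<Lambda>\<in>B. real (card \<Lambda>) * w \<Lambda>)" by (simp add: sum_distrib_left)
  also have "\<dots> \<le> 2 / real L * real n"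
  proof (rule mult_left_mono)
    show "(\<Sum>\<Lambda>\<in>B. real (card \<Lambda>) * w \<Lambda>) \<le> real n"
    proof (rule sum_local_le[where w = w and S = B])
      fix x assume x: "x \<in> {1..n}"
      have "(\<Sum>\<Lambda> | \<Lambda> \<in> B \<and> x \<in> \<Lambda>. w \<Lambda>) = (\<Sum>\<Lambda> | \<Lambda> \<in> B \<and> x \<in> \<Lambda>. op_norm (g \<Lambda>))"
        using sub by (intro sum.cong) (auto simp: w_def)
      then show "(\<Sum>\<Lambda> | \<Lambda> \<in> B \<and> x \<in> \<Lambda>. w \<Lambda>) \<le> 1" using locA[OF sub(2) x] by simp
    qed (use onn in \<open>auto simp: B_def w_def\<close>)
  qed simp
  finally show ?thesis using small unfolding eq by (simp add: distrib_right)
qed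

text \<open>Passes from suprema and infima over real sets to actual decompositions; these sets must
  therefore be shown nonempty and, for the infimum, bounded below.\<close>

lemma W1_loc_dist_le: "\<bar>W1_loc_dist q n k Q.state state\<bar> \<le> (2 * \<epsilon> + 2 / real L) * real n"
proof -
  let ?N = "q ^ n" and ?All = "{\<Lambda>. \<Lambda> \<subseteq> {1..n}}"
  let ?val = "\<lambda>g. Max ((\<lambda>x. \<Sum>\<Lambda> | \<Lambda> \<subseteq> {1..n} \<and> x \<in> \<Lambda>. op_norm (g \<Lambda>)) ` {1..n})"
  have zero_obs: "0\<^sub>m ?N ?N \<in> observables q n \<Lambda>" if "\<Lambda> \<subseteq> {1..n}" for \<Lambda>
    using that q_pos by (intro acts_on_observables acts_onI) (auto simp: self_adjoint_iff)
  have op0: "op_norm (0\<^sub>m ?N ?N) = 0"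
  proof (rule antisym)
    have z: "vnorm (0\<^sub>v ?N) = 0" using vnorm_eq_0[of "0\<^sub>v ?N" ?N] by simp
    show "op_norm (0\<^sub>m ?N ?N) \<le> 0"
    proof (rule op_norm_le[OF zero_carrier_mat dim_pos])
      fix v :: "complex vec" assume "v \<in> carrier_vec ?N"
      then have "0\<^sub>m ?N ?N *\<^sub>v v = 0\<^sub>v ?N" by (intro eq_vecI) auto
      then show "vnorm (0\<^sub>m ?N ?N *\<^sub>v v) \<le> 0" using z by simp
    qed
    show "0 \<le> op_norm (0\<^sub>m ?N ?N)" by (rule op_norm_nonneg[of _ ?N ?N]) (use dim_pos in auto)
  qed
  have le_val: "(\<Sum>\<Lambda> | \<Lambda> \<subseteq> {1..n} \<and> x \<in> \<Lambda>. op_norm (g \<Lambda>)) \<le> ?val g" if "x \<in> {1..n}" for x g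
    using that by (intro Max_ge) auto
  have val_nonneg: "0 \<le> ?val g" if "decomposes q n ?All g G" for g G
  proof -
    have "g \<Lambda> \<in> carrier_mat ?N ?N" if "\<Lambda> \<subseteq> {1..n}" for \<Lambda>
      using \<open>decomposes q n ?All g G\<close> that by (intro observables_carrier[of _ q n \<Lambda>]) (auto simp: decomposes_def)
    then have "0 \<le> (\<Sum>\<Lambda> | \<Lambda> \<subseteq> {1..n} \<and> 1 \<in> \<Lambda>. op_norm (g \<Lambda>))"
      by (intro sum_nonneg) (use op_norm_nonneg[OF _ dim_pos] in blast)
    also have "\<dots> \<le> ?val g" by (rule le_val) (use n_pos in simp)
    finally show ?thesis .
  qed
  let ?V = "\<lambda>G. {?val g | g. decomposes q n ?All g G}"
  have bdd: "bdd_below (?V G)" for G using val_nonneg by (intro bdd_belowI[of _ 0]) blast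
  have bound: "\<bar>Re (tr ((Q.state - state) * G))\<bar> \<le> (2 * \<epsilon> + 2 / real L) * real n"
    if G: "G \<in> k_local q n k" "local_norm q n G \<le> 1" for G
  proof -
    obtain g0 where g0: "decomposes q n {\<Lambda>. \<Lambda> \<subseteq> {1..n} \<and> card \<Lambda> \<le> k} g0 G"
      using G(1) by (auto simp: k_local_def)
    \<comment> \<open>Extending a k-local decomposition by zero shows that the set under the infimum
      is nonempty, without which \<open>local_norm\<close> would say nothing about
      \<open>G\<close>.\<close>
    define g1 where "g1 \<Lambda> = (if card \<Lambda> \<le> k then g0 \<Lambda> else 0\<^sub>m ?N ?N)" for \<Lambda>
    have "(\<Sum>\<Lambda> | \<Lambda> \<subseteq> {1..n} \<and> card \<Lambda> \<le> k. g0 \<Lambda> $$ (i, j)) = (\<Sum>\<Lambda> | \<Lambda> \<subseteq> {1..n}. g1 \<Lambda> $$ (i, j))"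
      if "i < ?N" "j < ?N" for i j
      using that by (intro sum.mono_neutral_cong_left) (auto simp: g1_def)
    then have "decomposes q n ?All g1 G"
      using g0 zero_obs unfolding decomposes_def by (auto simp: g1_def intro!: eq_matI)
    then have "?V G \<noteq> {}" by blast
    \<comment> \<open>The factor 2 in \<open>local_norm\<close> gives an infimum of at most 1/2, so
      some decomposition has value strictly below 1.\<close>
    moreover have "Inf (?V G) < 1" using G(2) unfolding local_norm_def by simp
    ultimately obtain g where g: "decomposes q n ?All g G" "?val g < 1"
      using cInf_lessD[of "?V G" 1] by blast
    show ?thesis
      by (rule expectation_diff_le[OF g(1)]) (use le_val[of _ g] g(2) in force)
  qed
  have "0\<^sub>m ?N ?N \<in> k_local q n k"
    unfolding k_local_def
  proof (intro CollectI conjI exI[of _ "\<lambda>_. 0\<^sub>m ?N ?N"])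
    show "decomposes q n {\<Lambda>. \<Lambda> \<subseteq> {1..n} \<and> card \<Lambda> \<le> k} (\<lambda>_. 0\<^sub>m ?N ?N) (0\<^sub>m ?N ?N)"
      using zero_obs by (auto simp: decomposes_def intro!: eq_matI)
  qed (auto simp: self_adjoint_iff)
  moreover have "local_norm q n (0\<^sub>m ?N ?N) \<le> 1"
  proof -
    have d0: "decomposes q n ?All (\<lambda>_. 0\<^sub>m ?N ?N) (0\<^sub>m ?N ?N)"
      using zero_obs by (auto simp: decomposes_def intro!: eq_matI)
    have "?val (\<lambda>_. 0\<^sub>m ?N ?N) = Max ((\<lambda>x. 0) ` {1..n})" unfolding op0 by simp
    also have "\<dots> = (0::real)" using n_pos by (simp add: image_constant_conv)
    finally have "0 \<in> ?V (0\<^sub>m ?N ?N)" using d0 by force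
    then have "Inf (?V (0\<^sub>m ?N ?N)) \<le> 0" by (intro cInf_lower bdd)
    then show ?thesis unfolding local_norm_def by simp
  qed
  ultimately have ne: "{Re (tr ((Q.state - state) * G)) | G. G \<in> k_local q n k \<and> local_norm q n G \<le> 1} \<noteq> {}"
    by blast
  show ?thesis
    unfolding W1_loc_dist_def by (rule cSup_abs_le[OF ne]) (use bound in blast)
qed

end

text \<open>One eigenbasis of \<open>H\<close> turns both states into probability weights on
  eigenvalue indices; domination then compares 1 / w on the optimal window with the Boltzmann
  weights.\<close>

lemma ensemble_distance_le:
  assumes q: "q \<ge> 1" and n: "n \<ge> 1" and \<beta>: "\<beta> > 0" and \<delta>: "\<delta> > 0" and \<xi>: "\<xi> > 0" and C: "C > 0"
    and H: "H \<in> self_adjoint (q ^ n)" and metric: "Metric_space {1..n} D"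
    and clustering: "has_correlation_length q n D (gibbs_state H \<beta>) \<xi> C"
    and energy: "is_arg_max (\<lambda>e. exp (- \<beta> * e) * Re (tr (energy_projector H e \<delta>))) (\<lambda>_. True) E"
    and windows: "2 * (ln (2 * real (q ^ n)) / \<beta> / \<delta> + 2) * exp (\<beta> * \<delta>) \<le> exp (2 ^ Suc s)"
    and ball: "\<And>v. v \<in> {1..n} \<Longrightarrow> real (card (Metric_space.mcball {1..n} D v (\<xi> * 2 ^ Suc s * R))) \<le> b"
    and b: "b \<ge> 0" and R: "R \<ge> 0" and \<epsilon>: "\<epsilon> > 0" "\<epsilon> \<le> 1"
    and eps_ball: "(4 * exp 1 * 2 ^ Suc s)\<^sup>2 * (real L * b) \<le> \<epsilon>\<^sup>2 * real n"
    and eps_tail: "2 * exp 1 * (C + 1) * exp (- R) \<le> \<epsilon>" and L: "L \<ge> 1"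
  shows "\<bar>W1_loc_dist q n k (microcanonical_state H E \<delta>) (gibbs_state H \<beta>)\<bar> \<le> (2 * \<epsilon> + 2 / real L) * real n"
proof -
  let ?N = "q ^ n"
  have N: "?N > 0" using q by simp
  obtain U ev where un: "unitary ?N U" and Hev: "H = fcalc ?N U (\<lambda>k. complex_of_real (ev k))"
    using hermitian_diagonalization[OF H] by blast
  define win where "win e = {k. k < ?N \<and> ev k \<in> {e - \<delta><..e}}" for e
  define Z where "Z = (\<Sum>k<?N. exp (- \<beta> * ev k))"
  define w where "w = real (card (win E))"
  have Z: "Z > 0" unfolding Z_def using N by (intro sum_pos) (auto simp: lessThan_empty_iff)
  have trE: "Re (tr (energy_projector H e \<delta>)) = real (card (win e))" for e
    unfolding Hev tr_energy_projector[OF un] win_def by simp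
  have opt: "exp (- \<beta> * e) * real (card (win e)) \<le> exp (- \<beta> * E) * real (card (win E))" for e
    using energy unfolding is_arg_max_def trE by (meson not_less)
  have "Z \<le> 2 * (ln (2 * real ?N) / \<beta> / \<delta> + 2) * exp (\<beta> * \<delta>) * (exp (- \<beta> * E) * w)"
    unfolding Z_def w_def win_def
    by (rule partition_function_le[OF N \<beta> \<delta>]) (use opt in \<open>simp add: win_def\<close>)
  also have "\<dots> \<le> exp (2 ^ Suc s) * (exp (- \<beta> * E) * w)"
    using windows by (rule mult_right_mono) (simp add: w_def)
  finally have Zle: "Z \<le> exp (2 ^ Suc s) * (exp (- \<beta> * E) * w)" .
  \<comment> \<open>The optimal window contains an eigenvalue, for otherwise the upper bound on Z >
    0 would be 0; so the weights 1 / w are a probability distribution.\<close>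
  have w: "w > 0"
  proof (rule ccontr)
    assume "\<not> w > 0"
    then have "w = 0" by (simp add: w_def)
    then show False using Zle Z by simp
  qed
  define p where "p k = exp (- \<beta> * ev k) / Z" for k
  define p' where "p' k = (if ev k \<in> {E - \<delta><..E} then 1 else 0) / w" for k
  have "(\<Sum>k<?N. p k) = 1" using Z by (simp add: p_def Z_def flip: sum_divide_distrib)
  then interpret P: diagonal_state ?N U p
    by unfold_locales (use un Z in \<open>auto simp: p_def\<close>)
  have "(\<Sum>k<?N. if ev k \<in> {E - \<delta><..E} then 1 else (0::real)) = (\<Sum>k\<in>win E. 1)"
    unfolding win_def by (rule sum.mono_neutral_cong_right) auto
  then have "(\<Sum>k<?N. p' k) = 1" using w by (simp add: p'_def w_def flip: sum_divide_distrib)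
  then interpret Q: diagonal_state ?N U p'
    by unfold_locales (use un w in \<open>auto simp: p'_def\<close>)
  have gibbs: "P.state = gibbs_state H \<beta>"
    unfolding P.state_def Hev gibbs_state_fcalc[OF un] p_def Z_def ..
  have micro: "Q.state = microcanonical_state H E \<delta>"
    unfolding Q.state_def Hev microcanonical_state_fcalc[OF un] p'_def w_def win_def ..
  have "has_correlation_length q n D P.state \<xi> C" unfolding gibbs by (rule clustering)
  then have cs: "clustering_state q n U p D \<xi> C"
    using q \<xi> C metric by (intro clustering_state.intro clustering_state_axioms.intro P.diagonal_state_axioms) simp_all
  interpret dominated_clustering_state q n U p D \<xi> C p' s R b \<epsilon> L
  proof (intro dominated_clustering_state.intro dominated_clustering_state_axioms.intro cs Q.diagonal_state_axioms)
    fix k assume k: "k < ?N"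
    show "p' k \<le> exp (2 ^ Suc s) * p k"
    proof (cases "ev k \<in> {E - \<delta><..E}")
      case True
      \<comment> \<open>Inside the window energies are at most \<open>E\<close>, so their Boltzmann
        factors are at least the one at \<open>E\<close> that appears in the bound on
        \<open>Z\<close>.\<close>
      have "Z \<le> exp (2 ^ Suc s) * (exp (- \<beta> * E) * w)" by (rule Zle)
      also have "\<dots> \<le> exp (2 ^ Suc s) * (exp (- \<beta> * ev k) * w)"
        using True \<beta> w by (intro mult_left_mono mult_right_mono) auto
      finally show ?thesis using True w Z by (simp add: p'_def p_def field_simps)
    next
      case False
      then have "p' k = 0" unfolding p'_def by (simp only: if_False div_0)
      then show ?thesis using P.nonneg[OF k] by simp
    qed
  qed (fact ball b R \<epsilon> eps_ball eps_tail L n)+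
  show ?thesis using W1_loc_dist_le[of k] unfolding gibbs micro .
qed

text \<open>The moment method needs orders that are powers of two; rounding up costs at most a
  factor 2, which the choice of constants can absorb.\<close>

lemma power_of_two_between:
  fixes x :: real
  assumes "x \<ge> 2"
  shows "\<exists>s. x \<le> 2 ^ Suc s \<and> 2 ^ Suc s \<le> 2 * x"
proof -
  obtain j :: nat where "x < 2 ^ j" using real_arch_pow[of 2 x] by auto
  moreover have "(0::real) \<le> 2 ^ j" by simp
  ultimately have ex: "x \<le> 2 ^ Suc j" unfolding power_Suc by linarith
  define s where "s = (LEAST s. x \<le> 2 ^ Suc s)"
  have s: "x \<le> 2 ^ Suc s" unfolding s_def by (rule LeastI[of _ j]) (rule ex)
  have "(2::real) ^ Suc s \<le> 2 * x"
  proof (cases s)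
    case 0
    then show ?thesis using assms by simp
  next
    case (Suc s')
    then have "\<not> x \<le> 2 ^ Suc s'" using not_less_Least[of s' "\<lambda>s. x \<le> 2 ^ Suc s"] by (simp add: s_def)
    then show ?thesis using Suc by simp
  qed
  then show ?thesis using s by blast
qed

text \<open>Writes the domination constant as a single exponential, so that its logarithm can be
  compared with m term by term. The absolute value covers negative f, that is, widths above
  1.\<close>

lemma window_count_le:
  assumes "q \<ge> 1" "n \<ge> 1" "\<beta> > 0" and \<delta>: "\<delta> = exp (- f)"
  shows "2 * (ln (2 * real (q ^ n)) / \<beta> / \<delta> + 2) * exp (\<beta> * \<delta>)
    \<le> exp (ln (2 * ((1 + ln (real q)) / \<beta> + 2)) + ln (real n) + \<bar>f\<bar> + \<beta> * \<delta>)"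
proof -
  define c where "c = (1 + ln (real q)) / \<beta>"
  have c: "c \<ge> 0" using assms by (simp add: c_def)
  have q: "real q > 0" using assms by simp
  have "ln (2 * real (q ^ n)) = ln 2 + real n * ln (real q)"
    using q by (simp add: ln_mult ln_realpow)
  also have "\<dots> \<le> real n * 1 + real n * ln (real q)"
    using assms(2) ln_2_less_1 by (intro add_right_mono) linarith
  finally have "ln (2 * real (q ^ n)) / \<beta> \<le> c * real n"
    using assms(3) by (simp add: c_def field_simps)
  then have "ln (2 * real (q ^ n)) / \<beta> * exp f \<le> c * real n * exp f"
    by (rule mult_right_mono) simp
  then have "ln (2 * real (q ^ n)) / \<beta> / \<delta> \<le> c * real n * exp f"
    unfolding \<delta> exp_minus divide_inverse inverse_inverse_eq .
  also have "\<dots> \<le> c * real n * exp \<bar>f\<bar>" using c by (intro mult_left_mono) auto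
  finally have 1: "ln (2 * real (q ^ n)) / \<beta> / \<delta> \<le> c * real n * exp \<bar>f\<bar>" .
  have "1 * 1 \<le> real n * exp \<bar>f\<bar>" using assms(2) by (intro mult_mono) auto
  then have "ln (2 * real (q ^ n)) / \<beta> / \<delta> + 2 \<le> (c + 2) * (real n * exp \<bar>f\<bar>)"
    using 1 by (simp add: algebra_simps)
  then have "2 * (ln (2 * real (q ^ n)) / \<beta> / \<delta> + 2) * exp (\<beta> * \<delta>) \<le> 2 * ((c + 2) * (real n * exp \<bar>f\<bar>)) * exp (\<beta> * \<delta>)"
    by (intro mult_right_mono mult_left_mono) auto
  also have "\<dots> = exp (ln (2 * (c + 2)) + ln (real n) + \<bar>f\<bar> + \<beta> * \<delta>)"
    using c assms(2) by (simp add: exp_add)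
  finally show ?thesis by (simp add: c_def)
qed

theorem theorem5p1:
  fixes k q :: nat and d A \<xi> C \<beta> :: real
    and D :: "nat \<Rightarrow> nat \<Rightarrow> nat \<Rightarrow> real"
    and H :: "nat \<Rightarrow> complex mat"
    and \<Delta> E f :: "nat \<Rightarrow> real"
  assumes "k \<ge> 1" and "q \<ge> 1" and "d \<ge> 1" and "A > 0" and "\<xi> > 0" and "C > 0" and "\<beta> > 0"
    and metric: "\<And>n. n \<ge> 1 \<Longrightarrow> Metric_space {1..n} (D n)"
    and growth: "\<And>n. n \<ge> 1 \<Longrightarrow> polynomial_growth n (D n) A d"
    and hamiltonian: "\<And>n. n \<ge> 1 \<Longrightarrow> H n \<in> self_adjoint (q ^ n)"
    and clustering: "\<And>n. n \<ge> 1 \<Longrightarrow>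
      has_correlation_length q n (D n) (gibbs_state (H n) \<beta>) \<xi> C"
    and width_pos: "\<And>n. n \<ge> 1 \<Longrightarrow> \<Delta> n > 0"
    and energy: "\<And>n. n \<ge> 1 \<Longrightarrow>
      is_arg_max (\<lambda>e. exp (- \<beta> * e) * Re (tr (energy_projector (H n) e (\<Delta> n)))) (\<lambda>_. True) (E n)"
    and width_lower: "f \<in> o(\<lambda>n. real n powr (1 / (2 * d + 1)))"
      "\<And>n. n \<ge> 1 \<Longrightarrow> \<Delta> n = exp (- f n)"
    and width_upper: "\<Delta> \<in> o(\<lambda>n. real n powr (1 / (2 * d + 1)))"
  shows "(\<lambda>n. 1 / real n *
      W1_loc_dist q n k (microcanonical_state (H n) (E n) (\<Delta> n)) (gibbs_state (H n) \<beta>))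
    \<in> o(\<lambda>_. 1)"
proof (rule landau_o.smallI)
  fix \<eta> :: real assume \<eta>: "\<eta> > 0"
  define a where "a = 1 / (2 * d + 1)"
  have a: "a > 0" using \<open>d \<ge> 1\<close> by (simp add: a_def)
  define t where "t n = real n powr a" for n :: nat
  \<comment> \<open>The accuracy \<eta> is shared: \<open>L\<close> limits the large sets to
    \<eta>/2 per spin, and \<epsilon> below limits the local part to the other half.\<close>
  define L where "L = nat \<lceil>4 / \<eta>\<rceil>"
  have L0: "real L \<ge> 4 / \<eta>" unfolding L_def by linarith
  have L: "L \<ge> 1" "2 / real L \<le> \<eta> / 2"
  proof -
    have "4 / \<eta> > 0" using \<eta> by simp
    then have "real L > 0" using L0 by linarith
    then show "L \<ge> 1" "2 / real L \<le> \<eta> / 2" using L0 \<eta> by (auto simp: field_simps)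
  qed
  define \<epsilon> where "\<epsilon> = min 1 (\<eta> / 4)"
  have \<epsilon>: "\<epsilon> > 0" "\<epsilon> \<le> 1" "2 * \<epsilon> \<le> \<eta> / 2" using \<eta> by (auto simp: \<epsilon>_def)
  \<comment> \<open>The first argument of the maximum gives \<xi> R \<ge> 1, so the radius \<xi> m R
    is at least 1, where the growth bound applies; the second one is what \<open>eps_tail\<close>
    requires.\<close>
  define R where "R = max (1 / \<xi>) (ln (2 * exp 1 * (C + 1) / \<epsilon>))"
  have R: "R > 0" "1 \<le> \<xi> * R"
  proof -
    have "R \<ge> 1 / \<xi>" by (simp add: R_def)
    then show "R > 0" "1 \<le> \<xi> * R" using \<open>\<xi> > 0\<close> by (auto simp: field_simps intro: less_le_trans[of 0 "1 / \<xi>"])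
  qed
  have tail: "2 * exp 1 * (C + 1) * exp (- R) \<le> \<epsilon>"
  proof -
    have "2 * exp 1 * (C + 1) / \<epsilon> = exp (ln (2 * exp 1 * (C + 1) / \<epsilon>))"
      using \<epsilon> \<open>C > 0\<close> by simp
    also have "\<dots> \<le> exp R" by (simp add: R_def)
    finally show ?thesis using \<epsilon> by (simp add: exp_minus field_simps)
  qed
  \<comment> \<open>Collects the constants of \<open>eps_ball\<close> for m \<le> 2 \<delta> t: 64
    is the square of 4 times 2, and (2 \<xi> R) powr d comes from the ball.\<close>
  define c where "c = 64 * (exp 1)\<^sup>2 * real L * A * (2 * \<xi> * R) powr d"
  have c: "c > 0" using L \<open>A > 0\<close> \<open>\<xi> > 0\<close> R by (simp add: c_def)
  \<comment> \<open>The order m will lie between \<delta> t and 2 \<delta> t. One factor \<delta> is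
    kept to compensate c; because \<delta> \<le> 1, its other powers are bounded by 1.\<close>
  define \<delta> where "\<delta> = min 1 (\<epsilon>\<^sup>2 / c)"
  have \<delta>: "\<delta> > 0" "\<delta> \<le> 1" "c * \<delta> \<le> \<epsilon>\<^sup>2"
  proof -
    show "\<delta> > 0" "\<delta> \<le> 1" using \<epsilon> c by (auto simp: \<delta>_def)
    have "\<delta> \<le> \<epsilon>\<^sup>2 / c" by (simp add: \<delta>_def)
    then show "c * \<delta> \<le> \<epsilon>\<^sup>2" using c by (simp add: field_simps)
  qed
  define c1 where "c1 = ln (2 * ((1 + ln (real q)) / \<beta> + 2))"
  \<comment> \<open>The exponent from \<open>window_count_le\<close> is split: |f|, \<beta> \<Delta>
    and the constant with ln n each get a quarter of \<delta> t, so that the domination constant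
    stays below e^m.\<close>
  have ev1: "eventually (\<lambda>n. \<bar>f n\<bar> \<le> \<delta> / 4 * t n) sequentially"
    using landau_o.smallD[OF width_lower(1), of "\<delta> / 4"] \<delta> by (simp add: t_def a_def)
  have ev2: "eventually (\<lambda>n. \<bar>\<Delta> n\<bar> \<le> \<delta> / (4 * \<beta>) * t n) sequentially"
    using landau_o.smallD[OF width_upper, of "\<delta> / (4 * \<beta>)"] \<delta> \<open>\<beta> > 0\<close> by (simp add: t_def a_def)
  have ev3: "eventually (\<lambda>n. c1 + ln (real n) \<le> \<delta> / 4 * t n) sequentially"
    unfolding t_def using a \<delta>(1) by real_asymp
  \<comment> \<open>The lower bound 2 is what \<open>power_of_two_between\<close> asks for.\<close>
  have ev4: "eventually (\<lambda>n. 2 \<le> \<delta> * t n) sequentially"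
    unfolding t_def using a \<delta>(1) by real_asymp
  show "eventually (\<lambda>n. norm (1 / real n *
      W1_loc_dist q n k (microcanonical_state (H n) (E n) (\<Delta> n)) (gibbs_state (H n) \<beta>))
      \<le> \<eta> * norm (1::real)) sequentially"
    using ev1 ev2 ev3 ev4 eventually_ge_at_top[of 1]
  proof eventually_elim
    case (elim n)
    have n: "n \<ge> 1" by (rule elim(5))
    obtain s where s: "\<delta> * t n \<le> 2 ^ Suc s" "2 ^ Suc s \<le> 2 * (\<delta> * t n)"
      using power_of_two_between[OF elim(4)] by blast
    define m where "m = (2::real) ^ Suc s"
    have m1: "m \<ge> 1" unfolding m_def by (rule one_le_power) simp
    have m2: "m \<le> 2 * \<delta> * t n" using s by (simp add: m_def)
    have t1: "t n \<ge> 1" using n a by (simp add: t_def ge_one_powr_ge_zero)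
    have windows: "2 * (ln (2 * real (q ^ n)) / \<beta> / \<Delta> n + 2) * exp (\<beta> * \<Delta> n) \<le> exp (2 ^ Suc s)"
    proof -
      have "\<beta> * \<Delta> n \<le> \<delta> / 4 * t n"
        using elim(2) \<open>\<beta> > 0\<close> width_pos[OF n] by (simp add: field_simps)
      moreover have "\<delta> / 4 * t n = (\<delta> * t n) / 4" by simp
      ultimately have "c1 + ln (real n) + \<bar>f n\<bar> + \<beta> * \<Delta> n \<le> \<delta> * t n"
        using elim(1,3,4) by linarith
      also have "\<dots> \<le> 2 ^ Suc s" by (rule s)
      finally show ?thesis
        using window_count_le[OF \<open>q \<ge> 1\<close> n \<open>\<beta> > 0\<close> width_lower(2)[OF n]] unfolding c1_def
        by (meson exp_le_cancel_iff order_trans)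
    qed
    define b where "b = A * (\<xi> * m * R) powr d"
    have r1: "\<xi> * m * R \<ge> 1"
    proof -
      have "1 * 1 \<le> m * (\<xi> * R)" using m1 R by (intro mult_mono) auto
      then show ?thesis by (simp add: mult_ac)
    qed
    have ball: "real (card (Metric_space.mcball {1..n} (D n) v (\<xi> * 2 ^ Suc s * R))) \<le> b" if "v \<in> {1..n}" for v
      using growth[OF n] that r1 unfolding polynomial_growth_def b_def m_def by blast
    have eps_ball: "(4 * exp 1 * 2 ^ Suc s)\<^sup>2 * (real L * b) \<le> \<epsilon>\<^sup>2 * real n"
    proof -
      have "(\<xi> * m * R) powr d \<le> (2 * \<xi> * R * (\<delta> * t n)) powr d"
        using m2 m1 R \<open>\<xi> > 0\<close> \<open>d \<ge> 1\<close> by (intro powr_mono2) (auto simp: mult_ac)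
      also have "\<dots> = (2 * \<xi> * R) powr d * (\<delta> powr d * t n powr d)"
        using R \<open>\<xi> > 0\<close> \<delta> t1 by (simp add: powr_mult)
      also have "\<dots> \<le> (2 * \<xi> * R) powr d * (1 * t n powr d)"
        using \<delta> \<open>d \<ge> 1\<close> by (intro mult_left_mono mult_right_mono powr_le1) auto
      finally have b: "b \<le> A * ((2 * \<xi> * R) powr d * t n powr d)"
        using \<open>A > 0\<close> by (simp add: b_def)
      have "(4 * exp 1 * m)\<^sup>2 \<le> (4 * exp 1 * (2 * \<delta> * t n))\<^sup>2"
        using m1 m2 by (intro power_mono mult_left_mono) auto
      also have "\<dots> = 64 * (exp 1)\<^sup>2 * \<delta>\<^sup>2 * (t n)\<^sup>2" by (simp add: power_mult_distrib)
      also have "\<dots> \<le> 64 * (exp 1)\<^sup>2 * \<delta> * (t n)\<^sup>2"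
        using \<delta> by (intro mult_right_mono mult_left_mono) (auto simp: power2_eq_square mult_left_le)
      finally have "(4 * exp 1 * m)\<^sup>2 * (real L * b)
          \<le> (64 * (exp 1)\<^sup>2 * \<delta> * (t n)\<^sup>2) * (real L * (A * ((2 * \<xi> * R) powr d * t n powr d)))"
        using b \<delta> \<open>A > 0\<close> by (intro mult_mono mult_left_mono) (auto simp: b_def)
      also have "\<dots> = (c * \<delta>) * ((t n)\<^sup>2 * t n powr d)" by (simp add: c_def mult_ac)
      also have "\<dots> \<le> \<epsilon>\<^sup>2 * real n"
      proof (intro mult_mono \<delta>(3))
        have "(t n)\<^sup>2 * t n powr d = t n powr (2 + d)"
          using t1 by (simp add: powr_add powr_numeral)
        also have "\<dots> \<le> t n powr (2 * d + 1)" using t1 \<open>d \<ge> 1\<close> by (intro powr_mono) auto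
        also have "\<dots> = real n" using n \<open>d \<ge> 1\<close> by (simp add: t_def a_def powr_powr)
        finally show "(t n)\<^sup>2 * t n powr d \<le> real n" .
      qed auto
      finally show ?thesis by (simp only: m_def)
    qed
    have "\<bar>W1_loc_dist q n k (microcanonical_state (H n) (E n) (\<Delta> n)) (gibbs_state (H n) \<beta>)\<bar>
        \<le> (2 * \<epsilon> + 2 / real L) * real n"
      by (rule ensemble_distance_le[OF \<open>q \<ge> 1\<close> n \<open>\<beta> > 0\<close> width_pos[OF n] \<open>\<xi> > 0\<close> \<open>C > 0\<close>
            hamiltonian[OF n] metric[OF n] clustering[OF n] energy[OF n] windows ball _ _ \<epsilon>(1,2) eps_ball tail L(1)])
         (use R \<open>A > 0\<close> in \<open>auto simp: b_def\<close>)
    also have "\<dots> \<le> \<eta> * real n" using \<epsilon>(3) L(2) by (intro mult_right_mono) auto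
    finally show ?case using n by (simp add: abs_mult field_simps)
  qed
qed

end
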